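(* There exists a real number $\beta^*$ with $0\le \beta^*<\alpha^*$ such that for all $\alpha\in\mathbb{C}$, $$h_\alpha\in\mathcal{HBF}\iff \alpha \text{ is real and } 0\le\alpha\le\beta^*.$$ Moreover $\beta^*\approx 2.18858\,63446\,61757\,09765$.
   Context: For $\alpha\in\mathbb{C}$ and $x>0$, $h_\alpha(x)=(1+1/x)^{\alpha x}:=\exp(\alpha x\log(1+1/x))$. A $C^\infty$-function $f:(0,\infty)\to[0,\infty)$ is completely monotonic if $(-1)^n f^{(n)}(x)\ge 0$ for all $n\ge 0$, $x>0$. A $C^\infty$-function $f:(0,\infty)\to[0,\infty)$ is a Bernstein function ($f\in\mathcal{BF}$) if $f'$ is completely monotonic. A $C^\infty$-function $f:(0,\infty)\to(0,\infty)$ is logarithmically completely monotonic ($f\in\mathcal L$) if $-(\log f)'=-f'/f$ is completely monotonic. Put $\mathcal L_0=\mathcal L\cup\{0\}$ (where $0$ is the zero function). The class of Horn-Bernstein functions is $\mathcal{HBF}=\{f\in\mathcal{BF}\mid f'\in\mathcal L_0\}$. The number $\alpha^*\approx 2.29965\,64432\,53461\,30332$ is the number (from earlier work) such that, for real $\alpha$, the function $\varphi_\alpha$ is non-negative on $(0,\infty)$ if and only if $0\le\alpha\le\alpha^*$; equivalently, $h_\alpha\in\mathcal{BF}$ if and only if $0\le\alpha\le\alpha^*$. Here $\varphi_\alpha(s)=e^\alpha\sum_{n=0}^\infty(-1)^n p_{n+1}(\alpha)\frac{s^n}{n!}$, where $p_0(\alpha)=1$ and $p_{n+1}(\alpha)=\frac{\alpha}{n+1}\sum_{k=0}^n\frac{k+1}{k+2}p_{n-k}(\alpha)$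 for $n\ge 0$; it satisfies $e^\alpha-h_\alpha(x)=\int_0^\infty e^{-sx}\varphi_\alpha(s)\,ds$ for $x>0$. The symbol $\approx$ is read as: the number agrees with the displayed decimal up to at most one unit in the last displayed digit. *)

theory Defs
  imports "HOL-Analysis.Analysis"
begin

text \<open>
  A function on the open half-line is represented by a total function on the reals; only its values
  at positive arguments matter. Since the half-line is open, the iterated derivatives at positive
  arguments do not depend on the other values either.
\<close>

definition smooth_pos :: "(real \<Rightarrow> real) \<Rightarrow> bool" where
  "smooth_pos f \<longleftrightarrow> (\<forall>n. \<forall>x>0. (deriv ^^ n) f field_differentiable at x)"

definition completely_monotonic :: "(real \<Rightarrow> real) set" where
  "completely_monotonic =
     {f. smooth_pos f \<and> (\<forall>n. \<forall>x>0. (- 1) ^ n * (deriv ^^ n) f x \<ge> 0)}"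

definition BF :: "(real \<Rightarrow> real) set" where
  "BF = {f. smooth_pos f \<and> (\<forall>x>0. f x \<ge> 0) \<and> deriv f \<in> completely_monotonic}"

definition log_completely_monotonic :: "(real \<Rightarrow> real) set" where
  "log_completely_monotonic =
     {f. smooth_pos f \<and> (\<forall>x>0. f x > 0) \<and> (\<lambda>x. - (deriv f x / f x)) \<in> completely_monotonic}"

definition log_completely_monotonic0 :: "(real \<Rightarrow> real) set" where
  "log_completely_monotonic0 = log_completely_monotonic \<union> {f. \<forall>x>0. f x = 0}"

definition HBF :: "(real \<Rightarrow> real) set" where
  "HBF = {f \<in> BF. deriv f \<in> log_completely_monotonic0}"

definition h_fun :: "complex \<Rightarrow> real \<Rightarrow> complex" where
  "h_fun \<alpha> x = exp (\<alpha> * complex_of_real (x * ln (1 + 1 / x)))"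

fun p_coeff :: "nat \<Rightarrow> real \<Rightarrow> real" where
  "p_coeff 0 \<alpha> = 1"
| "p_coeff (Suc n) \<alpha> = \<alpha> / real (n + 1) * (\<Sum>k\<le>n. real (k + 1) / real (k + 2) * p_coeff (n - k) \<alpha>)"

definition phi :: "real \<Rightarrow> real \<Rightarrow> real" where
  "phi \<alpha> s = exp \<alpha> * (\<Sum>n. (- 1) ^ n * p_coeff (Suc n) \<alpha> * (s ^ n / fact n))"

text \<open>
  Since \<open>phi 0\<close> is zero, such an \<open>a\<close> is non-negative and therefore unique. That it exists is a
  known theorem; its value is about 2.29965644325346130332.
\<close>

definition alpha_star :: real where
  "alpha_star = (THE a. \<forall>\<alpha>. (\<forall>s>0. phi \<alpha> s \<ge> 0) \<longleftrightarrow> 0 \<le> \<alpha> \<and> \<alpha> \<le> a)"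

end

theory Submission
  imports Defs "HOL-Complex_Analysis.Complex_Analysis" "HOL-Real_Asymp.Real_Asymp"
begin

text \<open>
  With \<open>g x = x * ln (1 + 1 / x)\<close> one has \<open>h' = \<alpha> * g' * h\<close>, so for \<open>\<alpha> > 0\<close> the function \<open>h\<close> is
  Horn-Bernstein iff \<open>F - \<alpha> * g'\<close> is completely monotonic, where \<open>F = - g'' / g'\<close>. Integrating
  the logarithmic derivative of \<open>u - 1 + exp (- u)\<close> around a rectangle in the strip
  \<open>\<bar>Im u\<bar> \<le> pi\<close>, where \<open>u = ln (1 + 1 / z)\<close>, gives \<open>F x = 1 / (x + 1) + (\<integral> w t / (x + t) dt)\<close> over the unit
  interval with an explicit positive \<open>w\<close>. Hence \<open>F - \<alpha> * g'\<close> is the Laplace transform of an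
  explicit density \<open>\<rho>\<close>, and complete monotonicity means \<open>\<rho> \<ge> 0\<close> because a continuous density can be
  recovered from the signs of the derivatives of its transform. As \<open>w - \<alpha>\<close> changes sign only once
  for \<open>\<alpha> \<ge> 2\<close>, \<open>exp s * \<rho> s\<close> first decreases and then increases, so the critical parameter is
  located by evaluating the alternating series of \<open>\<rho>\<close> at two points next to its minimiser.

  That \<open>\<beta>* < \<alpha>*\<close> follows by perturbation. For \<open>\<gamma>\<close> slightly above \<open>\<beta>*\<close> the density \<open>\<rho>\<close> is negative
  only close to its minimiser \<open>z\<close>; there it dominates \<open>s * \<nu> s\<close>, where \<open>\<nu> s\<close> is a small multiple of
  \<open>((s - z)\<^sup>2 - \<kappa>) * exp (- 2 * s)\<close>. The convolution exponential of \<open>\<nu>\<close> is nonnegative since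
  \<open>\<nu> + \<nu> * \<nu> / 2\<close>, \<open>\<nu> * \<nu>\<close> and \<open>\<nu> * \<nu> * \<nu>\<close> (convolution products) are, so \<open>h'\<close> stays completely
  monotonic for this \<open>\<gamma>\<close> although it is no longer logarithmically completely monotonic.
\<close>
section \<open>Completely monotonic functions on a half-line\<close>

text \<open>At the critical parameter the density touches zero at an interior minimum. A point at
  distance \<open>\<delta>\<close> from the minimiser misses the minimal value only by order
  \<open>\<delta>\<^sup>2\<close>, so two points \<open>10^-10\<close> apart can decide twenty
  decimals. The weight \<open>w\<close> involves pi and a logarithm, but no integral over the cut is
  computed numerically: since \<open>F * g' = 1 / (x * (x + 1)\<^sup>2)\<close>, its moments obey a
  recurrence with rational coefficients, and integer arithmetic with rounding suffices. The two
  thresholds are not compared numerically either. Any single parameter above the smaller one for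
  which \<open>h'\<close> is still completely monotonic separates them, so the decimals of the
  larger threshold do not enter.\<close>

fun cmn :: "nat \<Rightarrow> real \<Rightarrow> (real \<Rightarrow> real) \<Rightarrow> bool" where
  "cmn 0 a f \<longleftrightarrow> (\<forall>x>a. 0 \<le> f x)"
| "cmn (Suc n) a f \<longleftrightarrow> (\<forall>x>a. 0 \<le> f x) \<and>
     (\<exists>g. (\<forall>x>a. (f has_real_derivative - g x) (at x)) \<and> cmn n a g)"

text \<open>Derivatives enter as witnesses with the sign absorbed, so closure under sums and
  products is an induction on the order, with no Leibniz formula for iterated \<open>deriv\<close>.
  The left end is a parameter because the transform of \<open>phi\<close> is only available for
  \<open>x > 2\<close>.\<close>

definition cm :: "real \<Rightarrow> (real \<Rightarrow> real) \<Rightarrow> bool" where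
  "cm a f \<longleftrightarrow> (\<forall>n. cmn n a f)"

lemma cmn_SucI:
  assumes "\<And>x. x > a \<Longrightarrow> 0 \<le> f x" "\<And>x. x > a \<Longrightarrow> (f has_real_derivative - g x) (at x)" "cmn n a g"
  shows "cmn (Suc n) a f"
  unfolding cmn.simps(2) using assms by blast

lemma cmn_nonneg: "cmn n a f \<Longrightarrow> x > a \<Longrightarrow> 0 \<le> f x"
  by (cases n) auto

lemma cmn_Suc_D: "cmn (Suc n) a f \<Longrightarrow> cmn n a f"
proof (induction n arbitrary: f)
  case (Suc n)
  then obtain g where "\<forall>x>a. (f has_real_derivative - g x) (at x)" "cmn (Suc n) a g"
    by auto
  with Suc show ?case by auto
qed auto

lemma has_real_derivative_cong_gt:
  assumes "\<And>x::real. x > a \<Longrightarrow> f x = g x" "x > a"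
  shows "(f has_real_derivative D) (at x) \<longleftrightarrow> (g has_real_derivative D) (at x)"
proof (rule DERIV_cong_ev)
  have "eventually (\<lambda>y. y \<in> {a<..}) (nhds x)"
    using assms(2) by (intro eventually_nhds_in_open) auto
  then show "eventually (\<lambda>y. f y = g y) (nhds x)"
    by eventually_elim (use assms(1) in auto)
qed auto

lemma cmn_cong: "(\<And>x. x > a \<Longrightarrow> f x = g x) \<Longrightarrow> cmn n a f \<longleftrightarrow> cmn n a g"
  by (cases n) (auto simp: has_real_derivative_cong_gt[of a f g])

lemma cm_cong: "(\<And>x. x > a \<Longrightarrow> f x = g x) \<Longrightarrow> cm a f \<longleftrightarrow> cm a g"
  unfolding cm_def using cmn_cong[of a f g] by auto

lemma cmn_restrict: "a \<le> b \<Longrightarrow> cmn n a f \<Longrightarrow> cmn n b f"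
  by (induction n arbitrary: f) force+

lemma cm_restrict: "a \<le> b \<Longrightarrow> cm a f \<Longrightarrow> cm b f"
  unfolding cm_def using cmn_restrict by blast

text \<open>A coinduction principle: each order of \<open>cmn\<close> consumes one more member of a
  class closed under negated differentiation.\<close>

lemma cm_coinduct:
  assumes "P f"
    and nonneg: "\<And>f x. P f \<Longrightarrow> x > a \<Longrightarrow> 0 \<le> f x"
    and step: "\<And>f. P f \<Longrightarrow> \<exists>g. P g \<and> (\<forall>x>a. (f has_real_derivative - g x) (at x))"
  shows "cm a f"
proof -
  have "P f \<Longrightarrow> cmn n a f" for n f
  proof (induction n arbitrary: f)
    case (Suc n)
    show ?case using step[OF Suc.prems] Suc nonneg[OF Suc.prems] by auto
  qed (use nonneg in auto)
  then show ?thesis using assms(1) by (auto simp: cm_def)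
qed

lemma cm_nonneg: "cm a f \<Longrightarrow> x > a \<Longrightarrow> 0 \<le> f x"
  unfolding cm_def using cmn_nonneg by blast

text \<open>Each order of \<open>cmn\<close> may come with its own witness; uniqueness of
  derivatives identifies them, so one negated derivative serves all orders.\<close>

lemma cm_minus_deriv:
  assumes "cm a f" "\<And>x. x > a \<Longrightarrow> (f has_real_derivative - g x) (at x)"
  shows "cm a g"
  unfolding cm_def
proof
  fix n
  have "cmn (Suc n) a f" using assms(1) by (auto simp: cm_def)
  then obtain h where h: "\<forall>x>a. (f has_real_derivative - h x) (at x)" "cmn n a h"
    by auto
  have "h x = g x" if "x > a" for x
    using DERIV_unique[of f "- h x" x "- g x"] h(1) assms(2) that by auto
  then show "cmn n a g" using cmn_cong h(2) by blast
qed

lemma cm_obtain_deriv: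
  assumes "cm a f"
  obtains g where "\<And>x. x > a \<Longrightarrow> (f has_real_derivative - g x) (at x)" "cm a g"
proof -
  have "cmn (Suc 0) a f" using assms by (auto simp: cm_def)
  then obtain g where "\<And>x. x > a \<Longrightarrow> (f has_real_derivative - g x) (at x)" by auto
  with cm_minus_deriv[OF assms] that show ?thesis by blast
qed

lemma cmn_add: "cmn n a f \<Longrightarrow> cmn n a g \<Longrightarrow> cmn n a (\<lambda>x. f x + g x)"
proof (induction n arbitrary: f g)
  case (Suc n)
  from Suc.prems obtain f' g' where
    f': "\<forall>x>a. (f has_real_derivative - f' x) (at x)" "cmn n a f'" and
    g': "\<forall>x>a. (g has_real_derivative - g' x) (at x)" "cmn n a g'"
    by auto
  have "((\<lambda>x. f x + g x) has_real_derivative - (f' x + g' x)) (at x)" if "x > a" for x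
    using f'(1) g'(1) that by (auto intro!: derivative_eq_intros)
  moreover have "cmn n a (\<lambda>x. f' x + g' x)" using Suc.IH f' g' by blast
  ultimately show ?case using Suc.prems cmn_nonneg by (intro cmn_SucI) (auto intro: add_nonneg_nonneg)
qed auto

lemma cmn_const: "c \<ge> 0 \<Longrightarrow> cmn n a (\<lambda>x. c)"
proof (induction n arbitrary: c)
  case (Suc n)
  then show ?case by (auto intro!: exI[of _ "\<lambda>x. 0"])
qed auto

lemma cmn_mult: "cmn n a f \<Longrightarrow> cmn n a g \<Longrightarrow> cmn n a (\<lambda>x. f x * g x)"
proof (induction n arbitrary: f g)
  case (Suc n)
  from Suc.prems obtain f' g' where
    f': "\<forall>x>a. (f has_real_derivative - f' x) (at x)" "cmn n a f'" and
    g': "\<forall>x>a. (g has_real_derivative - g' x) (at x)" "cmn n a g'"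
    by auto
  have "((\<lambda>x. f x * g x) has_real_derivative - (f' x * g x + f x * g' x)) (at x)" if "x > a" for x
    using f'(1) g'(1) that by (auto intro!: derivative_eq_intros)
  moreover have "cmn n a (\<lambda>x. f' x * g x + f x * g' x)"
    using Suc.IH f' g' cmn_Suc_D[OF Suc.prems(1)] cmn_Suc_D[OF Suc.prems(2)] cmn_add by blast
  ultimately show ?case using Suc.prems cmn_nonneg by (intro cmn_SucI) (auto intro: mult_nonneg_nonneg)
qed auto

lemma cm_add: "cm a f \<Longrightarrow> cm a g \<Longrightarrow> cm a (\<lambda>x. f x + g x)"
  unfolding cm_def using cmn_add by blast

lemma cm_mult: "cm a f \<Longrightarrow> cm a g \<Longrightarrow> cm a (\<lambda>x. f x * g x)"
  unfolding cm_def using cmn_mult by blast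

lemma cm_const: "c \<ge> 0 \<Longrightarrow> cm a (\<lambda>x. c)"
  unfolding cm_def using cmn_const by blast

lemma cm_cmult: "c \<ge> 0 \<Longrightarrow> cm a f \<Longrightarrow> cm a (\<lambda>x. c * f x)"
  by (intro cm_mult cm_const)

text \<open>The negated derivative is \<open>b x * exp (- B x)\<close>, so order
  \<open>Suc n\<close> follows from order \<open>n\<close> and closure under products.
  \<open>B\<close> may take either sign, as it does for negative logarithms.\<close>

lemma cm_exp_minus:
  assumes B: "\<And>x. x > a \<Longrightarrow> (B has_real_derivative b x) (at x)" and b: "cm a b"
  shows "cm a (\<lambda>x. exp (- B x))"
proof -
  have "cmn n a (\<lambda>x. exp (- B x))" for n
  proof (induction n)
    case (Suc n)
    have "((\<lambda>x. exp (- B x)) has_real_derivative - (b x * exp (- B x))) (at x)" if "x > a" for x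
      using B[OF that] by (auto intro!: derivative_eq_intros)
    moreover have "cmn n a (\<lambda>x. b x * exp (- B x))"
      using b Suc cmn_mult by (auto simp: cm_def)
    ultimately show ?case by (intro cmn_SucI) auto
  qed auto
  then show ?thesis by (simp add: cm_def)
qed

text \<open>Differentiation turns \<open>c\<close> into \<open>diffs c\<close>, again nonnegative
  and summable everywhere, and splits off the completely monotonic factor \<open>X'\<close>. It
  serves for the even and odd tails of the exponential series.\<close>

lemma cm_entire_nonneg_coeffs:
  fixes c :: "nat \<Rightarrow> real"
  assumes c: "\<And>k. c k \<ge> 0" "\<And>y. summable (\<lambda>k. c k * y ^ k)" and X: "cm a X"
  shows "cm a (\<lambda>x. \<Sum>k. c k * X x ^ k)"
proof -
  obtain X' where X': "\<And>x. x > a \<Longrightarrow> (X has_real_derivative - X' x) (at x)" "cm a X'"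
    using cm_obtain_deriv[OF X] by blast
  have "cmn n a (\<lambda>x. \<Sum>k. c k * X x ^ k)"
    if "\<And>k. c k \<ge> 0" "\<And>y. summable (\<lambda>k. c k * y ^ k)" for n and c :: "nat \<Rightarrow> real"
    using that
  proof (induction n arbitrary: c)
    case 0
    then show ?case using cm_nonneg[OF X] by (auto intro!: suminf_nonneg)
  next
    case (Suc n)
    have d: "((\<lambda>x. \<Sum>k. c k * X x ^ k) has_real_derivative - (X' x * (\<Sum>k. diffs c k * X x ^ k))) (at x)"
      if "x > a" for x
    proof -
      have "((\<lambda>y. \<Sum>k. c k * y ^ k) has_real_derivative (\<Sum>k. diffs c k * X x ^ k)) (at (X x))"
        by (rule termdiffs_strong_converges_everywhere) (rule Suc.prems)
      from DERIV_chain2[OF this X'(1)[OF that]] show ?thesis by (simp add: mult.commute)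
    qed
    have "summable (\<lambda>k. diffs c k * y ^ k)" for y
      by (rule termdiff_converges_all) (rule Suc.prems)
    then have "cmn n a (\<lambda>x. \<Sum>k. diffs c k * X x ^ k)"
      using Suc.prems(1) by (intro Suc.IH) (auto simp: diffs_def)
    then have "cmn n a (\<lambda>x. X' x * (\<Sum>k. diffs c k * X x ^ k))"
      using X'(2) by (auto intro!: cmn_mult simp: cm_def)
    moreover have "0 \<le> (\<Sum>k. c k * X x ^ k)" if "x > a" for x
      using Suc.prems cm_nonneg[OF X that] by (auto intro!: suminf_nonneg)
    ultimately show ?case using d by (intro cmn_SucI)
  qed
  then show ?thesis using c by (auto simp: cm_def)
qed

section \<open>Transfer between derivative witnesses and iterated \<open>deriv\<close>\<close>

lemma field_differentiable_cong_gt: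
  assumes "\<And>x::real. x > a \<Longrightarrow> f x = g x" "x > a"
  shows "f field_differentiable at x \<longleftrightarrow> g field_differentiable at x"
  using has_real_derivative_cong_gt[OF assms] by (auto simp: field_differentiable_def)

lemma cm_higher_deriv:
  assumes "cm a f" "x > a"
  shows "(deriv ^^ n) f field_differentiable at x" "(- 1) ^ n * (deriv ^^ n) f x \<ge> 0"
proof -
  have *: "\<exists>g. cm a g \<and> (\<forall>x>a. (deriv ^^ n) f x = (- 1) ^ n * g x)"
  proof (induction n)
    case 0
    then show ?case using assms by auto
  next
    case (Suc n)
    then obtain g where g: "cm a g" "\<And>x. x > a \<Longrightarrow> (deriv ^^ n) f x = (- 1) ^ n * g x" by blast
    obtain h where h: "\<And>x. x > a \<Longrightarrow> (g has_real_derivative - h x) (at x)" "cm a h"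
      using cm_obtain_deriv[OF g(1)] by blast
    have "(deriv ^^ Suc n) f x = (- 1) ^ Suc n * h x" if "x > a" for x
    proof -
      have "((\<lambda>x. (- 1) ^ n * g x) has_real_derivative (- 1) ^ n * - h x) (at x)"
        using h(1)[OF that] by (intro DERIV_cmult) auto
      then have "((deriv ^^ n) f has_real_derivative (- 1) ^ n * - h x) (at x)"
        using has_real_derivative_cong_gt[of a "(deriv ^^ n) f", OF g(2) that] by blast
      from DERIV_imp_deriv[OF this] show ?thesis by simp
    qed
    with h(2) show ?case by blast
  qed
  from *[of ] obtain g where g: "cm a g" "\<And>x. x > a \<Longrightarrow> (deriv ^^ n) f x = (- 1) ^ n * g x" by blast
  obtain h where h: "\<And>x. x > a \<Longrightarrow> (g has_real_derivative - h x) (at x)"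
    using cm_obtain_deriv[OF g(1)] by blast
  have "((\<lambda>x. (- 1) ^ n * g x) has_real_derivative (- 1) ^ n * - h x) (at x)"
    using h(1)[OF assms(2)] by (intro DERIV_cmult) auto
  then show "(deriv ^^ n) f field_differentiable at x"
    using field_differentiable_cong_gt[of a "(deriv ^^ n) f", OF g(2) assms(2)]
    by (auto simp: field_differentiable_def)
  show "(- 1) ^ n * (deriv ^^ n) f x \<ge> 0"
    using cm_nonneg[OF g(1) assms(2)] g(2)[OF assms(2)]
    by (simp flip: mult.assoc power_mult_distrib)
qed

lemma cm_imp_completely_monotonic: "cm 0 f \<Longrightarrow> f \<in> completely_monotonic"
  using cm_higher_deriv[of 0 f] by (simp add: completely_monotonic_def smooth_pos_def)

lemma completely_monotonic_imp_cm:
  assumes "f \<in> completely_monotonic"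
  shows "cm 0 f"
proof -
  have sm: "(deriv ^^ n) f field_differentiable at x" and ucut: "(- 1) ^ n * (deriv ^^ n) f x \<ge> 0"
    if "x > 0" for n x
    using assms that by (auto simp: completely_monotonic_def smooth_pos_def)
  define P where "P g \<longleftrightarrow> (\<exists>n. g = (\<lambda>x. (- 1) ^ n * (deriv ^^ n) f x))" for g
  have Pf: "P f" unfolding P_def by (rule exI[of _ 0]) auto
  show ?thesis
  proof (rule cm_coinduct[of P, OF Pf])
    fix g assume "P g"
    then obtain n where n: "g = (\<lambda>x. (- 1) ^ n * (deriv ^^ n) f x)" by (auto simp: P_def)
    have "(g has_real_derivative - ((- 1) ^ Suc n * (deriv ^^ Suc n) f x)) (at x)" if "x > 0" for x
      using field_differentiable_derivI[OF sm[OF that, of n]] unfolding n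
      by (auto intro!: derivative_eq_intros)
    then show "\<exists>h. P h \<and> (\<forall>x>0. (g has_real_derivative - h x) (at x))"
      unfolding P_def by blast
  qed (use ucut in \<open>auto simp: P_def\<close>)
qed

section \<open>Laplace transforms\<close>

text \<open>A Bochner integral makes absolute convergence at every \<open>x > a\<close> part of the
  notion, so a point slightly to the left of \<open>x\<close> supplies an integrable
  majorant.\<close>

definition has_laplace :: "real \<Rightarrow> (real \<Rightarrow> real) \<Rightarrow> (real \<Rightarrow> real) \<Rightarrow> bool" where
  "has_laplace a r G \<longleftrightarrow> r \<in> borel_measurable borel \<and>
     (\<forall>x>a. has_bochner_integral lborel (\<lambda>s. indicator {0..} s * (r s * exp (- (x * s)))) (G x))"

lemma has_laplace_cong:
  "(\<And>x. x > a \<Longrightarrow> G x = H x) \<Longrightarrow> has_laplace a r G \<longleftrightarrow> has_laplace a r H"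
  by (auto simp: has_laplace_def)

lemma has_laplace_restrict: "has_laplace a r G \<Longrightarrow> a \<le> b \<Longrightarrow> has_laplace b r G"
  by (auto simp: has_laplace_def)

lemma has_laplace_add:
  "has_laplace a r G \<Longrightarrow> has_laplace a q H \<Longrightarrow> has_laplace a (\<lambda>s. r s + q s) (\<lambda>x. G x + H x)"
  unfolding has_laplace_def
  by (auto simp: distrib_left distrib_right intro!: has_bochner_integral_add)

lemma has_laplace_cmult: "has_laplace a r G \<Longrightarrow> has_laplace a (\<lambda>s. c * r s) (\<lambda>x. c * G x)"
  unfolding has_laplace_def
  by (auto simp: mult.assoc mult.left_commute[of _ c] intro!: has_bochner_integral_mult_right)

lemma has_laplace_diff:
  "has_laplace a r G \<Longrightarrow> has_laplace a q H \<Longrightarrow> has_laplace a (\<lambda>s. r s - q s) (\<lambda>x. G x - H x)"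
  using has_laplace_add[of a r G "\<lambda>s. (-1) * q s" "\<lambda>x. (-1) * H x"] has_laplace_cmult[of a q H "-1"]
  by simp

lemma has_laplace_nonneg:
  assumes "has_laplace a r G" "\<And>s. s > 0 \<Longrightarrow> r s \<ge> 0" "x > a"
  shows "G x \<ge> 0"
proof -
  have G: "G x = (\<integral>s. indicator {0..} s * (r s * exp (- (x * s))) \<partial>lborel)"
    using assms by (auto simp: has_laplace_def has_bochner_integral_iff)
  have "AE s in lborel. s \<noteq> (0::real)" by (rule AE_lborel_singleton)
  then have ae: "AE s in lborel. 0 \<le> indicator {0..} s * (r s * exp (- (x * s)))"
    by eventually_elim (use assms(2) in \<open>auto simp: indicator_def\<close>)
  from integral_nonneg_AE[OF ae] G show ?thesis by simp
qed

lemma abs_exp_minus_one_le: "\<bar>exp u - 1\<bar> \<le> \<bar>u\<bar> * exp \<bar>u\<bar>" for u :: real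
proof (cases "u \<ge> 0")
  case True
  have "1 - u \<le> exp (- u)" using exp_ge_add_one_self[of "-u"] by simp
  then have "(1 - u) * exp u \<le> exp (- u) * exp u" by (intro mult_right_mono) auto
  then show ?thesis using True by (simp add: algebra_simps exp_minus)
next
  case False
  have "1 - exp u \<le> - u" using exp_ge_add_one_self[of u] by linarith
  moreover have "- u * 1 \<le> - u * exp (- u)" using False by (intro mult_left_mono) auto
  ultimately have "1 - exp u \<le> - u * exp (- u)" by linarith
  then show ?thesis using False by simp
qed

lemma mult_exp_minus_le:
  fixes e s :: real
  assumes "e > 0"
  shows "s * exp (- (e * s)) \<le> 1 / e"
proof -
  have "e * s \<le> exp (e * s)" using exp_ge_add_one_self[of "e * s"] by linarith
  then have "e * s * exp (- (e * s)) \<le> exp (e * s) * exp (- (e * s))" by (intro mult_right_mono) auto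
  then show ?thesis using assms by (simp add: field_simps exp_minus)
qed

text \<open>Differentiation under the integral sign, by dominated convergence of the difference
  quotients along sequences.\<close>

lemma has_laplace_deriv:
  assumes L: "has_laplace a r G"
  obtains H where "has_laplace a (\<lambda>s. s * r s) H"
    "\<And>x. x > a \<Longrightarrow> (G has_real_derivative - H x) (at x)"
proof -
  define I where "I x s = indicator {0..} s * (r s * exp (- (x * s)))" for x s :: real
  define J where "J x s = indicator {0..} s * (s * r s * exp (- (x * s)))" for x s :: real
  have rm[measurable]: "r \<in> borel_measurable borel" using L by (simp add: has_laplace_def)
  have I: "integrable lborel (I x)" "integral\<^sup>L lborel (I x) = G x" if "x > a" for x
    using L that by (auto simp: has_laplace_def I_def[abs_def] has_bochner_integral_iff)
  have main: "integrable lborel (J x) \<and> (G has_real_derivative - integral\<^sup>L lborel (J x)) (at x)" if x: "x > a" for x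
  proof -
    define e where "e = (x - a) / 2"
    have e: "e > 0" "x - e > a" using x by (auto simp: e_def field_simps)
    \<comment> \<open>For steps \<open>\<bar>h\<bar> \<le> e / 2\<close>, half of the margin
      \<open>e\<close> absorbs \<open>exp (\<bar>h\<bar> * s)\<close> and the other half the factor
      \<open>s\<close>, as \<open>s * exp (- (e / 2 * s)) \<le> 2 / e\<close>.\<close>
    define w where "w s = 2 / e * norm (I (x - e) s)" for s
    have w: "integrable lborel w" unfolding w_def[abs_def] using I(1)[OF e(2)] by auto
    have bnd: "norm (((I (x + h) s) - I x s) / h) \<le> w s" if h: "h \<noteq> 0" "\<bar>h\<bar> \<le> e / 2" for h s
    proof (cases "s \<ge> 0")
      case True
      have "norm (((I (x + h) s) - I x s) / h) = \<bar>r s\<bar> * exp (- (x * s)) * (\<bar>exp (- (h * s)) - 1\<bar> / \<bar>h\<bar>)"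
        using True unfolding I_def
        by (simp add: abs_mult abs_divide distrib_right exp_diff exp_minus exp_add field_simps
                 flip: right_diff_distrib)
           (simp add: field_simps flip: abs_mult)
      also have "\<bar>exp (- (h * s)) - 1\<bar> / \<bar>h\<bar> \<le> s * exp (\<bar>h\<bar> * s)"
        using abs_exp_minus_one_le[of "- (h * s)"] h True by (simp add: abs_mult field_simps)
      also have "\<dots> \<le> s * exp (e / 2 * s)" using h True mult_right_mono[OF h(2) True] by (intro mult_left_mono) auto
      also have "s * exp (e / 2 * s) = s * exp (- (e / 2 * s)) * exp (e * s)"
        by (simp add: field_simps flip: exp_add)
      also have "s * exp (- (e / 2 * s)) \<le> 1 / (e / 2)"
        by (rule mult_exp_minus_le) (use e in auto)
      finally have "norm (((I (x + h) s) - I x s) / h) \<le> \<bar>r s\<bar> * exp (- (x * s)) * (1 / (e / 2) * exp (e * s))"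
        by (simp add: mult_left_mono mult_right_mono)
      also have "\<dots> = w s"
        using True e unfolding w_def I_def
        by (simp add: abs_mult field_simps exp_diff exp_minus left_diff_distrib flip: exp_add)
      finally show ?thesis .
    next
      case False
      then show ?thesis using e by (simp add: I_def w_def)
    qed
    have lim: "((\<lambda>h. ((I (x + h) s) - I x s) / h) \<longlongrightarrow> - J x s) (at 0)" for s
    proof -
      have "((\<lambda>y. I y s) has_real_derivative - J x s) (at x)"
        unfolding I_def J_def by (auto intro!: derivative_eq_intros)
      then show ?thesis by (simp add: DERIV_def)
    qed
    have seq: "integrable lborel (\<lambda>s. - J x s) \<and>
        (\<lambda>n. integral\<^sup>L lborel (\<lambda>s. ((I (x + X n) s) - I x s) / X n)) \<longlonglongrightarrow> integral\<^sup>L lborel (\<lambda>s. - J x s)"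
      if X: "\<And>n. X n \<noteq> 0" "\<And>n. \<bar>X n\<bar> \<le> e / 2" "X \<longlonglongrightarrow> 0" for X :: "nat \<Rightarrow> real"
    proof -
      have m: "(\<lambda>s. - J x s) \<in> borel_measurable lborel" unfolding J_def[abs_def] by measurable
      have m2: "(\<lambda>s. ((I (x + X n) s) - I x s) / X n) \<in> borel_measurable lborel" for n
        unfolding I_def[abs_def] by measurable
      have l: "AE s in lborel. (\<lambda>n. ((I (x + X n) s) - I x s) / X n) \<longlonglongrightarrow> - J x s"
      proof (intro AE_I2)
        fix s
        have "filterlim X (at 0) sequentially" using X by (auto simp: filterlim_at)
        from filterlim_compose[OF lim this]
        show "(\<lambda>n. ((I (x + X n) s) - I x s) / X n) \<longlonglongrightarrow> - J x s" .
      qed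
      have b: "AE s in lborel. norm (((I (x + X n) s) - I x s) / X n) \<le> w s" for n
        using bnd X by auto
      show ?thesis
        using integrable_dominated_convergence[OF m m2 w l b] integral_dominated_convergence[OF m m2 w l b]
        by blast
    qed
    \<comment> \<open>One concrete null sequence suffices for the integrability of
      \<open>J x\<close>.\<close>
    define X0 where "X0 n = e / 2 / real (Suc n)" for n
    have "X0 \<longlonglongrightarrow> 0" unfolding X0_def by real_asymp
    moreover have "\<bar>X0 n\<bar> \<le> e / 2" for n
      using e by (simp add: X0_def divide_le_eq mult_le_cancel_left1)
    ultimately have int: "integrable lborel (\<lambda>s. - J x s)" using seq[of X0] e by (auto simp: X0_def)
    have "((\<lambda>h. (G (x + h) - G x) / h) \<longlongrightarrow> - integral\<^sup>L lborel (J x)) (at 0)"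
      unfolding tendsto_at_iff_sequentially
    proof (intro allI impI, goal_cases)
      case (1 Y)
      then have Y: "\<And>n. Y n \<noteq> 0" "Y \<longlonglongrightarrow> 0" by auto
      have "eventually (\<lambda>n. \<bar>Y n\<bar> < e / 2) sequentially"
        using Y(2) e order_tendstoD(2)[OF tendsto_rabs_zero[OF Y(2)], of "e / 2"] by auto
      then obtain N where N: "\<And>n. n \<ge> N \<Longrightarrow> \<bar>Y n\<bar> < e / 2" by (auto simp: eventually_sequentially)
      define X where "X n = Y (n + N)" for n
      have X: "X n \<noteq> 0" "\<bar>X n\<bar> \<le> e / 2" for n using Y N[of "n + N"] by (auto simp: X_def)
      have Xl: "X \<longlonglongrightarrow> 0" unfolding X_def using Y(2) by (rule LIMSEQ_ignore_initial_segment)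
      have eq: "integral\<^sup>L lborel (\<lambda>s. ((I (x + X n) s) - I x s) / X n) = (G (x + X n) - G x) / X n" for n
      proof -
        have "x + X n > a" using X[of n] e by (auto simp: e_def abs_le_iff field_simps)
        then show ?thesis using I x by simp
      qed
      have "(\<lambda>n. (G (x + X n) - G x) / X n) \<longlonglongrightarrow> - integral\<^sup>L lborel (J x)"
        using conjunct2[OF seq[OF X Xl]] unfolding eq by simp
      then have "(\<lambda>n. (G (x + Y (n + N)) - G x) / Y (n + N)) \<longlonglongrightarrow> - integral\<^sup>L lborel (J x)"
        by (simp add: X_def)
      from LIMSEQ_offset[OF this]
      show ?case by (simp add: o_def)
    qed
    then have "(G has_real_derivative - integral\<^sup>L lborel (J x)) (at x)" by (simp add: DERIV_def)
    with int show ?thesis by simp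
  qed
  show ?thesis
  proof (rule that)
    show "has_laplace a (\<lambda>s. s * r s) (\<lambda>x. integral\<^sup>L lborel (J x))"
      unfolding has_laplace_def has_bochner_integral_iff
      using main by (auto simp: J_def[abs_def] mult.assoc)
  qed (use main in auto)
qed

text \<open>Each negated derivative multiplies the density by \<open>s\<close> and so keeps it
  nonnegative on the positive axis.\<close>

lemma cm_laplace:
  assumes "has_laplace a r G" "\<And>s. s > 0 \<Longrightarrow> r s \<ge> 0"
  shows "cm a G"
proof (rule cm_coinduct[of "\<lambda>G. \<exists>r. has_laplace a r G \<and> (\<forall>s>0. r s \<ge> 0)"])
  show "\<exists>r. has_laplace a r G \<and> (\<forall>s>0. r s \<ge> 0)" using assms by blast
next
  fix f x assume "\<exists>r. has_laplace a r f \<and> (\<forall>s>0. r s \<ge> 0)" "x > a"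
  then show "0 \<le> f x" using has_laplace_nonneg by blast
next
  fix f assume "\<exists>r. has_laplace a r f \<and> (\<forall>s>0. r s \<ge> 0)"
  then obtain r where r: "has_laplace a r f" "\<forall>s>0. r s \<ge> 0" by blast
  obtain H where "has_laplace a (\<lambda>s. s * r s) H" "\<And>x. x > a \<Longrightarrow> (f has_real_derivative - H x) (at x)"
    using has_laplace_deriv[OF r(1)] by blast
  moreover have "\<forall>s>0. s * r s \<ge> 0" using r(2) by auto
  ultimately show "\<exists>g. (\<exists>r. has_laplace a r g \<and> (\<forall>s>0. r s \<ge> 0)) \<and> (\<forall>x>a. (f has_real_derivative - g x) (at x))"
    by blast
qed

lemma has_laplace_exp: "has_laplace (- t) (\<lambda>s. exp (- (t * s))) (\<lambda>x. 1 / (x + t))"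
  unfolding has_laplace_def
proof (intro conjI allI impI)
  fix x assume "- t < x"
  define c where "c = x + t"
  have x: "c > 0" using \<open>- t < x\<close> by (simp add: c_def)
  have "(\<integral>\<^sup>+s. ennreal (exp (- (c * s))) * indicator {0..} s \<partial>lborel) = 0 - (- 1 / c * exp (- (c * 0)))"
  proof (rule nn_integral_FTC_atLeast)
    show "((\<lambda>s. - 1 / c * exp (- (c * s))) has_real_derivative exp (- (c * s))) (at s)" for s
      using x by (auto intro!: derivative_eq_intros)
    show "((\<lambda>s. - 1 / c * exp (- (c * s))) \<longlongrightarrow> 0) at_top"
      using x by real_asymp
  qed auto
  moreover have "ennreal (indicator {0..} s * (exp (- (t * s)) * exp (- (x * s)))) =
      ennreal (exp (- (c * s))) * indicator {0..} s" for s
    by (simp add: c_def indicator_def algebra_simps flip: exp_add)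
  ultimately have "(\<integral>\<^sup>+s. ennreal (indicator {0..} s * (exp (- (t * s)) * exp (- (x * s)))) \<partial>lborel) = ennreal (1 / (x + t))"
    by (simp add: c_def)
  then show "has_bochner_integral lborel (\<lambda>s. indicator {0..} s * (exp (- (t * s)) * exp (- (x * s)))) (1 / (x + t))"
    using x by (intro has_bochner_integral_nn_integral) (auto simp: c_def)
qed auto

lemma has_laplace_power: "has_laplace (- t) (\<lambda>s. s ^ k * exp (- (t * s))) (\<lambda>x. fact k / (x + t) ^ Suc k)"
proof (induction k)
  case 0
  then show ?case using has_laplace_exp by simp
next
  case (Suc k)
  obtain H where H: "has_laplace (-t) (\<lambda>s. s * (s ^ k * exp (- (t * s)))) H"
    "\<And>x. x > -t \<Longrightarrow> ((\<lambda>x. fact k / (x + t) ^ Suc k) has_real_derivative - H x) (at x)"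
    using has_laplace_deriv[OF Suc] by blast
  have "H x = fact (Suc k) / (x + t) ^ Suc (Suc k)" if "x > -t" for x
  proof -
    from that have x: "x + t > 0" by simp
    have "((\<lambda>x. fact k / (x + t) ^ Suc k) has_real_derivative
        (0 * (x + t) ^ Suc k - fact k * (real (Suc k) * (x + t) ^ k * 1)) / ((x + t) ^ Suc k * (x + t) ^ Suc k)) (at x)"
      using x by (intro DERIV_divide) (auto intro!: derivative_eq_intros simp del: power_Suc)
    from DERIV_unique[OF H(2)[OF that] this] have
      *: "H x = fact k * (real (Suc k) * (x + t) ^ k) / ((x + t) ^ Suc k * (x + t) ^ Suc k)" by simp
    show ?thesis
      unfolding * using x by (simp add: frac_eq_eq)
  qed
  then show ?case using H(1) has_laplace_cong[of "-t" H] by (simp add: mult.assoc)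
qed

lemma summable_geometric_bound:
  fixes d :: "nat \<Rightarrow> real"
  assumes "\<And>k. \<bar>d k\<bar> \<le> C * R ^ k" "0 \<le> R" "\<bar>y\<bar> * R < 1"
  shows "summable (\<lambda>k. \<bar>d k * y ^ k\<bar>)"
proof (rule summable_comparison_test')
  show "summable (\<lambda>k. C * (\<bar>y\<bar> * R) ^ k)"
    using assms by (intro summable_mult summable_geometric) (auto simp: abs_mult)
  fix k
  have "\<bar>d k\<bar> * \<bar>y\<bar> ^ k \<le> C * R ^ k * \<bar>y\<bar> ^ k" using assms(1) by (intro mult_right_mono) auto
  then show "norm \<bar>d k * y ^ k\<bar> \<le> C * (\<bar>y\<bar> * R) ^ k"
    by (simp add: abs_mult power_abs power_mult_distrib mult_ac)
qed

lemma summable_exp_bound: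
  fixes d :: "nat \<Rightarrow> real"
  assumes "\<And>k. \<bar>d k\<bar> \<le> C * R ^ k" "0 \<le> R"
  shows "summable (\<lambda>k. \<bar>d k * (s ^ k / fact k)\<bar>)"
proof (rule summable_comparison_test')
  show "summable (\<lambda>k. C * (inverse (fact k) * (R * \<bar>s\<bar>) ^ k))"
    by (intro summable_mult summable_exp)
  fix k
  have "\<bar>d k\<bar> * (\<bar>s\<bar> ^ k / fact k) \<le> C * R ^ k * (\<bar>s\<bar> ^ k / fact k)" using assms(1) by (intro mult_right_mono) auto
  then show "norm \<bar>d k * (s ^ k / fact k)\<bar> \<le> C * (inverse (fact k) * (R * \<bar>s\<bar>) ^ k)"
    by (simp add: abs_mult power_abs power_mult_distrib field_simps)
qed

text \<open>Termwise integration: the norms of the terms integrate to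
  \<open>\<bar>d k\<bar> * (1 / x) ^ Suc k\<close>, which is summable for
  \<open>x > R\<close>.\<close>

lemma has_laplace_powerseries:
  fixes d :: "nat \<Rightarrow> real"
  assumes d: "\<And>k. \<bar>d k\<bar> \<le> C * R ^ k" and R: "0 \<le> R"
  shows "has_laplace R (\<lambda>s. \<Sum>k. d k * (s ^ k / fact k)) (\<lambda>x. \<Sum>k. d k * (1 / x) ^ Suc k)"
  unfolding has_laplace_def
proof (intro conjI allI impI)
  show "(\<lambda>s. \<Sum>k. d k * (s ^ k / fact k)) \<in> borel_measurable borel"
    by measurable
  fix x assume x: "x > R"
  then have x0: "x > 0" using R by simp
  define f where "f k s = indicator {0..} s * (d k * (s ^ k / fact k) * exp (- (x * s)))" for k and s :: real
  have pw: "has_bochner_integral lborel (\<lambda>s. indicator {0..} s * (s ^ k * exp (- (x * s)))) (fact k / x ^ Suc k)" for k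
    using has_laplace_power[of 0 k] x0 by (simp add: has_laplace_def)
  have f: "has_bochner_integral lborel (f k) (d k * (1 / x) ^ Suc k)" for k
    using has_bochner_integral_mult_right[OF pw[of k], of "d k / fact k"]
    unfolding f_def by (simp add: power_one_over mult_ac)
  have nf: "has_bochner_integral lborel (\<lambda>s. norm (f k s)) (\<bar>d k\<bar> * (1 / x) ^ Suc k)" for k
  proof -
    have "norm (f k s) = \<bar>d k\<bar> / fact k * (indicator {0..} s * (s ^ k * exp (- (x * s))))" for s
      by (auto simp: f_def abs_mult indicator_def)
    then show ?thesis
      using has_bochner_integral_mult_right[OF pw[of k], of "\<bar>d k\<bar> / fact k"]
      by (simp add: power_one_over mult_ac)
  qed
  have sm: "summable (\<lambda>k. \<integral>s. norm (f k s) \<partial>lborel)"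
  proof -
    have "summable (\<lambda>k. \<bar>d k * (1 / x) ^ k\<bar>)"
      using x x0 R by (intro summable_geometric_bound[OF d]) (auto simp: field_simps)
    then have "summable (\<lambda>k. (1 / x) * \<bar>d k * (1 / x) ^ k\<bar>)" by (rule summable_mult)
    moreover have "(\<integral>s. norm (f k s) \<partial>lborel) = (1 / x) * \<bar>d k * (1 / x) ^ k\<bar>" for k
      using nf[of k] x0 by (simp add: has_bochner_integral_iff abs_mult power_abs)
    ultimately show ?thesis by simp
  qed
  have ae: "AE s in lborel. summable (\<lambda>k. norm (f k s))"
  proof (intro AE_I2)
    fix s :: real
    have "summable (\<lambda>k. \<bar>d k * (s ^ k / fact k)\<bar> * exp (- (x * s)))"
      using summable_mult2[OF summable_exp_bound[OF d R]] .
    then show "summable (\<lambda>k. norm (f k s))"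
      by (cases "s \<ge> 0") (auto simp: f_def abs_mult)
  qed
  have fi: "\<And>k. integrable lborel (f k)" using f by (simp add: has_bochner_integral_iff)
  have "(\<Sum>k. f k s) = indicator {0..} s * ((\<Sum>k. d k * (s ^ k / fact k)) * exp (- (x * s)))" for s
  proof -
    have s: "summable (\<lambda>k. d k * (s ^ k / fact k))"
      using summable_exp_bound[OF d R] by (rule summable_rabs_cancel)
    show ?thesis unfolding f_def
      using suminf_mult[OF summable_mult2[OF s, of "exp (- (x * s))"], of "indicator {0..} s"] suminf_mult2[OF s]
      by simp
  qed
  moreover have "has_bochner_integral lborel (\<lambda>s. \<Sum>k. f k s) (\<Sum>k. integral\<^sup>L lborel (f k))"
    unfolding has_bochner_integral_iff
    using integrable_suminf[OF fi ae sm] integral_suminf[OF fi ae sm] by simp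
  moreover have "integral\<^sup>L lborel (f k) = d k * (1 / x) ^ Suc k" for k
    using f[of k] by (simp add: has_bochner_integral_iff)
  ultimately show "has_bochner_integral lborel (\<lambda>s. indicator {0..} s * ((\<Sum>k. d k * (s ^ k / fact k)) * exp (- (x * s))))
      (\<Sum>k. d k * (1 / x) ^ Suc k)" by simp
qed

section \<open>Recovering the sign of a density from its transform\<close>

lemma mult_exp_minus_unimodal:
  fixes m s t :: real
  assumes m: "m > 0"
  shows "0 \<le> s \<Longrightarrow> s < t \<Longrightarrow> t \<le> m \<Longrightarrow> s * exp (- (s / m)) < t * exp (- (t / m))"
    and "m \<le> s \<Longrightarrow> s < t \<Longrightarrow> t * exp (- (t / m)) < s * exp (- (s / m))"
proof -
  have d: "((\<lambda>s. s * exp (- (s / m))) has_real_derivative (1 - s / m) * exp (- (s / m))) (at s)" for s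
    using m by (auto intro!: derivative_eq_intros simp: field_simps)
  have c: "continuous_on A (\<lambda>s. s * exp (- (s / m)))" for A
    using m by (intro continuous_intros) auto
  show "s * exp (- (s / m)) < t * exp (- (t / m))" if "0 \<le> s" "s < t" "t \<le> m"
    by (rule DERIV_pos_imp_increasing_open[OF that(2)]) (use d c that m in \<open>auto simp: field_simps intro!: exI\<close>)
  show "t * exp (- (t / m)) < s * exp (- (s / m))" if "m \<le> s" "s < t"
    by (rule DERIV_neg_imp_decreasing_open[OF that(2)])
       (use d c that m in \<open>auto simp: field_simps mult_less_0_iff intro!: exI\<close>)
qed

text \<open>
  The kernel \<open>s ^ n * exp (- n * s / m)\<close> concentrates at \<open>s = m\<close>, so the signs of the derivatives
  of a Laplace transform determine the sign of a continuous density.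
\<close>

lemma laplace_cm_imp_nonneg:
  assumes L: "has_laplace a r G" and cm: "cm a G" and m: "m > 0" and cont: "isCont r m"
  shows "r m \<ge> 0"
proof (rule ccontr)
  assume "\<not> r m \<ge> 0"
  then have neg: "r m < 0" by simp
  have Ln: "\<exists>H. has_laplace a (\<lambda>s. s ^ n * r s) H \<and> cm a H" for n
  proof (induction n)
    case (Suc n)
    then obtain H where H: "has_laplace a (\<lambda>s. s ^ n * r s) H" "cm a H" by blast
    obtain K where K: "has_laplace a (\<lambda>s. s * (s ^ n * r s)) K"
      "\<And>x. x > a \<Longrightarrow> (H has_real_derivative - K x) (at x)"
      using has_laplace_deriv[OF H(1)] by blast
    then show ?case using cm_minus_deriv[OF H(2) K(2)] by (auto simp: mult.assoc)
  qed (use L cm in auto)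
  define \<kappa> where "\<kappa> s = s * exp (- (s / m))" for s :: real
  have \<kappa>_cont: "isCont \<kappa> s" for s unfolding \<kappa>_def using m by (intro continuous_intros) auto
  have "eventually (\<lambda>s. r s < r m / 2) (nhds m)"
    using cont neg by (intro order_tendstoD(2)[where y = "r m"]) (auto simp: continuous_at tendsto_at_iff_tendsto_nhds)
  then obtain d0 where d0: "d0 > 0" "\<And>s. dist s m < d0 \<Longrightarrow> r s < r m / 2"
    by (auto simp: eventually_nhds_metric)
  define d where "d = min (d0 / 2) (m / 2)"
  have d: "d > 0" "d < m" and rd: "\<And>s. \<bar>s - m\<bar> \<le> d \<Longrightarrow> r s < r m / 2"
    using d0 m by (auto simp: d_def dist_real_def min_def split: if_splits)
  \<comment> \<open>\<open>\<theta>\<close> bounds the kernel base \<open>\<kappa>\<close> outside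
    the \<open>d\<close>-neighbourhood of \<open>m\<close>; the larger \<open>\<theta>'\<close>
    below is a lower bound for it close to \<open>m\<close>.\<close>
  define \<theta> where "\<theta> = max (\<kappa> (m - d)) (\<kappa> (m + d))"
  have "\<kappa> (m - d) < \<kappa> m" "\<kappa> (m + d) < \<kappa> m" "\<kappa> (m - d) > 0"
    unfolding \<kappa>_def using d m
    by (intro mult_exp_minus_unimodal[OF m] mult_pos_pos; simp)+
  then have \<theta>: "\<theta> < \<kappa> m" "\<theta> > 0" by (auto simp: \<theta>_def)
  have \<theta>_out: "\<kappa> s \<le> \<theta>" if "s \<ge> 0" "\<bar>s - m\<bar> > d" for s
  proof (cases "s < m")
    case True
    then have "\<kappa> s < \<kappa> (m - d)" using that d m unfolding \<kappa>_def
      by (intro mult_exp_minus_unimodal(1)) auto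
    then show ?thesis by (simp add: \<theta>_def)
  next
    case False
    then have "\<kappa> s < \<kappa> (m + d)" using that d m unfolding \<kappa>_def
      by (intro mult_exp_minus_unimodal(2)) auto
    then show ?thesis by (simp add: \<theta>_def)
  qed
  define \<theta>' where "\<theta>' = (\<theta> + \<kappa> m) / 2"
  have \<theta>': "\<theta> < \<theta>'" "\<theta>' < \<kappa> m" using \<theta> by (auto simp: \<theta>'_def)
  have "eventually (\<lambda>s. \<theta>' < \<kappa> s) (nhds m)"
    using \<kappa>_cont[of m] \<theta>' by (intro order_tendstoD(1)[where y = "\<kappa> m"]) (auto simp: continuous_at tendsto_at_iff_tendsto_nhds)
  then obtain d1 where d1: "d1 > 0" "\<And>s. dist s m < d1 \<Longrightarrow> \<theta>' < \<kappa> s"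
    by (auto simp: eventually_nhds_metric)
  define d' where "d' = min (d1 / 2) d"
  have d': "d' > 0" "d' \<le> d" and kd: "\<And>s. \<bar>s - m\<bar> \<le> d' \<Longrightarrow> \<theta>' < \<kappa> s"
    using d1 d by (auto simp: d'_def dist_real_def min_def split: if_splits)
  \<comment> \<open>The kernel \<open>\<kappa> s ^ n\<close> comes from evaluating the
    \<open>n\<close>-th negated derivative at \<open>n / m\<close>, which must lie beyond
    \<open>a\<close>. The fixed power \<open>N\<close> keeps the integral \<open>M\<close> finite;
    only the remaining \<open>n - N\<close> powers are estimated by \<open>\<theta>\<close>.\<close>
  obtain N :: nat where N: "real N > a * m" using reals_Archimedean2 by blast
  have Na: "real n / m > a" if "n \<ge> N" for n
  proof -
    have "real N \<le> real n" using that by simp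
    then show ?thesis using N m by (simp add: pos_less_divide_eq)
  qed
  have pow: "s ^ n * exp (- (real n / m * s)) = \<kappa> s ^ n" for n s
    by (simp add: \<kappa>_def power_mult_distrib exp_of_nat_mult[symmetric])
  define M where "M = (\<integral>s. norm (indicator {0..} s * (\<kappa> s ^ N * r s)) \<partial>lborel)"
  have int: "integrable lborel (\<lambda>s. indicator {0..} s * (\<kappa> s ^ n * r s))"
    "(\<integral>s. indicator {0..} s * (\<kappa> s ^ n * r s) \<partial>lborel) \<ge> 0" if "n \<ge> N" for n
  proof -
    obtain H where H: "has_laplace a (\<lambda>s. s ^ n * r s) H" "cm a H" using Ln by blast
    have "has_bochner_integral lborel (\<lambda>s. indicator {0..} s * (s ^ n * r s * exp (- (real n / m * s)))) (H (real n / m))"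
      using H(1) Na[OF that] unfolding has_laplace_def by blast
    moreover have "(\<lambda>s. indicator {0..} s * (s ^ n * r s * exp (- (real n / m * s)))) =
        (\<lambda>s. indicator {0..} s * (\<kappa> s ^ n * r s))"
      using pow[of _ n] by (auto simp: fun_eq_iff simp flip: pow)
    ultimately have "has_bochner_integral lborel (\<lambda>s. indicator {0..} s * (\<kappa> s ^ n * r s)) (H (real n / m))"
      by metis
    then show "integrable lborel (\<lambda>s. indicator {0..} s * (\<kappa> s ^ n * r s))"
      "(\<integral>s. indicator {0..} s * (\<kappa> s ^ n * r s) \<partial>lborel) \<ge> 0"
      using cm_nonneg[OF H(2) Na[OF that]] by (auto simp: has_bochner_integral_iff)
  qed
  have bound: "- r m * d' * \<theta>' ^ n \<le> \<theta> ^ (n - N) * M" if n: "n \<ge> N" for n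
  proof -
    have i1: "integrable lborel (\<lambda>s. \<theta> ^ (n - N) * norm (indicator {0..} s * (\<kappa> s ^ N * r s)))"
      using int(1)[of N] by (intro integrable_mult_right) auto
    have i2: "integrable lborel (\<lambda>s. \<theta>' ^ n * (r m / 2) * indicator {m - d'..m + d'} s)"
      by (intro integrable_mult_right integrable_real_indicator) (auto simp: emeasure_lborel_Icc_eq)
    \<comment> \<open>Three zones: beyond distance \<open>d\<close> the bound
      \<open>\<theta>\<close> applies, between \<open>d'\<close> and \<open>d\<close> the integrand
      is at most 0, and within \<open>d'\<close> it is at most
      \<open>\<theta>' ^ n * (r m / 2)\<close>, a negative number. Since
      \<open>\<theta> < \<theta>'\<close>, the last zone wins for large \<open>n\<close>.\<close>
    have pt: "indicator {0..} s * (\<kappa> s ^ n * r s) \<le>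
        \<theta> ^ (n - N) * norm (indicator {0..} s * (\<kappa> s ^ N * r s)) + \<theta>' ^ n * (r m / 2) * indicator {m - d'..m + d'} s" for s
    proof (cases "s \<ge> 0")
      case True
      then have k0: "\<kappa> s \<ge> 0" by (simp add: \<kappa>_def)
      consider "\<bar>s - m\<bar> > d" | "\<bar>s - m\<bar> \<le> d" "\<bar>s - m\<bar> > d'" | "\<bar>s - m\<bar> \<le> d'" by linarith
      then show ?thesis
      proof cases
        case 1
        have e: "\<kappa> s ^ n = \<kappa> s ^ (n - N) * \<kappa> s ^ N" using n by (simp flip: power_add)
        have "\<kappa> s ^ n * r s \<le> \<kappa> s ^ n * \<bar>r s\<bar>" using k0 by (intro mult_left_mono) auto
        also have "\<dots> \<le> \<theta> ^ (n - N) * \<kappa> s ^ N * \<bar>r s\<bar>"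
          unfolding e using \<theta>_out[OF True 1] k0 by (intro mult_right_mono power_mono) auto
        finally have "\<kappa> s ^ n * r s \<le> \<theta> ^ (n - N) * (\<kappa> s ^ N * \<bar>r s\<bar>)" by (simp add: mult.assoc)
        then show ?thesis using 1 True d' k0 by (auto simp: indicator_def abs_mult)
      next
        case 2
        have "\<kappa> s ^ n * r s \<le> 0" using k0 rd[OF 2(1)] neg by (intro mult_nonneg_nonpos) auto
        then show ?thesis using 2 True \<theta> by (auto simp: indicator_def intro: order_trans)
      next
        case 3
        have "\<kappa> s ^ n * r s \<le> \<kappa> s ^ n * (r m / 2)" using k0 rd[of s] 3 d' by (intro mult_left_mono) auto
        also have "\<dots> \<le> \<theta>' ^ n * (r m / 2)"
          using kd[OF 3] \<theta> \<theta>' neg by (intro mult_right_mono_neg power_mono) auto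
        also have "\<dots> \<le> \<theta> ^ (n - N) * \<bar>\<kappa> s ^ N * r s\<bar> + \<theta>' ^ n * (r m / 2)" using \<theta> by simp
        finally show ?thesis using 3 True by (auto simp: indicator_def)
      qed
    next
      case False
      then have "s \<notin> {m - d'..m + d'}" using d d' by auto
      then show ?thesis using False by simp
    qed
    have "0 \<le> (\<integral>s. indicator {0..} s * (\<kappa> s ^ n * r s) \<partial>lborel)" using int(2)[OF n] .
    also have "\<dots> \<le> (\<integral>s. \<theta> ^ (n - N) * norm (indicator {0..} s * (\<kappa> s ^ N * r s)) + \<theta>' ^ n * (r m / 2) * indicator {m - d'..m + d'} s \<partial>lborel)"
      by (intro integral_mono int(1)[OF n] Bochner_Integration.integrable_add i1 i2 pt)
    also have "\<dots> = \<theta> ^ (n - N) * M + \<theta>' ^ n * (r m / 2) * (2 * d')"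
      using d' i1 i2 by (subst Bochner_Integration.integral_add) (auto simp: M_def)
    finally show ?thesis by (simp add: field_simps)
  qed
  have "(\<lambda>n. (\<theta> / \<theta>') ^ n * M) \<longlonglongrightarrow> 0 * M"
    using \<theta> \<theta>' by (intro tendsto_mult_right LIMSEQ_realpow_zero) auto
  moreover have "- r m * d' * \<theta>' ^ N > 0" using neg d' \<theta> \<theta>' by (simp add: mult_neg_pos)
  ultimately have "eventually (\<lambda>n. (\<theta> / \<theta>') ^ n * M < - r m * d' * \<theta>' ^ N) sequentially"
    by (intro order_tendstoD(2)) auto
  then obtain n where n: "(\<theta> / \<theta>') ^ n * M < - r m * d' * \<theta>' ^ N" by (auto simp: eventually_sequentially)
  have "- r m * d' * \<theta>' ^ (n + N) \<le> \<theta> ^ n * M" using bound[of "n + N"] by simp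
  also have "\<theta> ^ n * M = \<theta>' ^ n * ((\<theta> / \<theta>') ^ n * M)" using \<theta> \<theta>' by (simp add: power_divide)
  also have "\<dots> < \<theta>' ^ n * (- r m * d' * \<theta>' ^ N)" using n \<theta> \<theta>' by (intro mult_strict_left_mono) auto
  finally show False by (simp add: power_add mult_ac)
qed

section \<open>The Stieltjes representation\<close>

text \<open>In the coordinate \<open>u = ln (1 + 1 / z)\<close> one has
  \<open>exp (- u) = z / (z + 1)\<close>, so this is \<open>g'\<close> continued to complex
  arguments.\<close>

definition qlog :: "complex \<Rightarrow> complex" where "qlog u = u - 1 + exp (- u)"

lemma cos_lt_sinc: "0 < b \<Longrightarrow> b < pi \<Longrightarrow> b * cos b < sin b" for b :: real
proof -
  assume b: "0 < b" "b < pi"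
  have "(\<lambda>b. sin b - b * cos b) 0 < (\<lambda>b. sin b - b * cos b) b"
  proof (rule DERIV_pos_imp_increasing_open[OF b(1)])
    fix x assume x: "0 < x" "x < b"
    have "((\<lambda>b. sin b - b * cos b) has_real_derivative x * sin x) (at x)"
      by (auto intro!: derivative_eq_intros)
    moreover have "x * sin x > 0" using x b sin_gt_zero by simp
    ultimately show "\<exists>y. ((\<lambda>b. sin b - b * cos b) has_real_derivative y) (at x) \<and> 0 < y" by blast
  qed (intro continuous_intros)
  then show ?thesis by simp
qed

text \<open>For real \<open>u\<close> the inequality \<open>1 - a < exp (- a)\<close> leaves only 0.
  Otherwise put \<open>c = \<bar>Im u\<bar>\<close>: the imaginary part gives
  \<open>c = exp (- a) * sin c\<close>, hence \<open>c < pi\<close> and, as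
  \<open>sin c \<le> c\<close>, also \<open>a \<le> 0\<close>. Then \<open>c * cos c < sin c\<close>
  yields \<open>exp (- a) * cos c < 1\<close>, and the real part is negative.\<close>

lemma qlog_nonzero:
  assumes "\<bar>Im u\<bar> < 2 * pi" "u \<noteq> 0"
  shows "qlog u \<noteq> 0"
proof
  assume "qlog u = 0"
  define a b where "a = Re u" and "b = Im u"
  have re: "a - 1 + exp (- a) * cos b = 0" and im: "b - exp (- a) * sin b = 0"
    using \<open>qlog u = 0\<close> by (auto simp: qlog_def a_def b_def complex_eq_iff Re_exp Im_exp)
  define c where "c = \<bar>b\<bar>"
  have re': "a - 1 + exp (- a) * cos c = 0" and im': "c = exp (- a) * sin c"
    using re im by (auto simp: c_def abs_if)
  show False
  proof (cases "b = 0")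
    case True
    then have "1 - a = exp (- a)" using re by simp
    then have "a = 0" using exp_minus_greater[of a] by linarith
    with True assms show False by (auto simp: a_def b_def complex_eq_iff)
  next
    case False
    then have c: "0 < c" "c < 2 * pi" using assms by (auto simp: c_def b_def)
    then have "sin c > 0" using im' by (metis exp_gt_zero zero_less_mult_pos)
    then have cpi: "c < pi" using c sin_le_zero[of c] by linarith
    have "exp (- a) * cos c < 1"
    proof -
      have "c * cos c < sin c" using cos_lt_sinc c cpi by blast
      then have "exp (- a) * sin c * cos c < sin c" using im' by simp
      then have "(exp (- a) * cos c) * sin c < 1 * sin c" by (simp add: mult_ac)
      then show ?thesis using \<open>sin c > 0\<close> by (simp only: mult_less_cancel_right_pos)
    qed
    moreover have "a \<le> 0"
    proof -
      have "1 * c \<le> exp (- a) * c" using im' sin_x_le_x[of c] c by (metis exp_ge_zero less_imp_le mult_1 mult_left_mono)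
      then have "1 \<le> exp (- a)" using c(1) by (simp only: mult_le_cancel_right_pos)
      then show ?thesis by simp
    qed
    ultimately show False using re' by simp
  qed
qed

text \<open>
  Up to sign this is \<open>F z / (x - z) dz\<close> in the coordinate \<open>u = ln (1 + 1 / z)\<close>, which maps the plane cut
  along \<open>{-1..0}\<close> onto the strip \<open>\<bar>Im u\<bar> < pi\<close> with \<open>0\<close> removed.
\<close>

definition Phi :: "real \<Rightarrow> complex \<Rightarrow> complex" where
  "Phi x u = (1 - exp (- u)) / qlog u * ((exp u - 1) / (of_real x * (exp u - 1) - 1))"

text \<open>
  The edges \<open>u = \<tau> + pi * \<i>\<close> and \<open>u = \<tau> - pi * \<i>\<close> of the strip correspond to the two sides of the cut at \<open>z = - tcut \<tau>\<close>.
  All integrals over the cut are taken with respect to \<open>\<tau>\<close>.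
\<close>

definition wcut :: "real \<Rightarrow> real" where
  "wcut \<tau> = (1 + exp (- \<tau>)) / ((\<tau> - 1 - exp (- \<tau>))\<^sup>2 + pi\<^sup>2)"

definition tcut :: "real \<Rightarrow> real" where "tcut \<tau> = 1 / (exp \<tau> + 1)"

text \<open>These are \<open>g'\<close> and \<open>- g'' / g'\<close> for \<open>g x = x * ln (1 + 1 / x)\<close>.\<close>

definition dg :: "real \<Rightarrow> real" where "dg x = ln (1 + 1 / x) - 1 / (x + 1)"

definition Fg :: "real \<Rightarrow> real" where "Fg x = 1 / (x * (x + 1)\<^sup>2 * dg x)"

lemma tcut_bounds: "0 < tcut \<tau>" "tcut \<tau> < 1"
  by (auto simp: tcut_def add_pos_pos divide_less_eq)

lemma wcut_pos: "wcut \<tau> > 0"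
  unfolding wcut_def by (intro divide_pos_pos add_pos_pos add_nonneg_pos) auto

lemma dg_pos: "x > 0 \<Longrightarrow> dg x > 0"
proof -
  assume x: "x > 0"
  define y where "y = x / (x + 1)"
  have y: "0 < y" "y < 1" using x by (auto simp: y_def)
  have "ln y \<le> y - 1" using y by (intro ln_le_minus_one)
  moreover have "ln y \<noteq> y - 1" using ln_eq_minus_one[of y] y by auto
  ultimately have "ln y < y - 1" by simp
  moreover have "ln (1 + 1 / x) = - ln y"
  proof -
    have "1 + 1 / x = inverse y" using x by (simp add: y_def field_simps)
    then show ?thesis using y by (simp add: ln_inverse)
  qed
  moreover have "1 / (x + 1) = 1 - y" using x by (simp add: y_def field_simps)
  ultimately show ?thesis by (simp add: dg_def)
qed

context
  fixes x :: real and U :: real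
  assumes x: "x > 0"
  defines "U \<equiv> ln (1 + 1 / x)"
begin

lemma exp_U: "exp (complex_of_real U) = 1 + 1 / of_real x"
proof -
  have "exp U = 1 + 1 / x" unfolding U_def using x by (simp add: add_pos_pos)
  then show ?thesis by (metis exp_of_real of_real_1 of_real_add of_real_divide)
qed

lemma U_pos: "U > 0" unfolding U_def using x by (intro ln_gt_zero) auto

lemma Phi_den_nonzero:
  assumes "\<bar>Im u\<bar> < 2 * pi" "u \<noteq> of_real U"
  shows "of_real x * (exp u - 1) - 1 \<noteq> 0"
proof
  assume "of_real x * (exp u - 1) - 1 = (0 :: complex)"
  then have "exp u = exp (of_real U)" using x unfolding exp_U by (simp add: field_simps)
  then obtain n :: int where n: "u = of_real U + (of_int (2 * n) * pi) * \<i>" by (auto simp: exp_eq)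
  then have "\<bar>2 * real_of_int n * pi\<bar> < 2 * pi" using assms(1) by simp
  then have "\<bar>real_of_int n\<bar> < 1" by (simp add: abs_mult)
  then have "n = 0" by linarith
  then show False using n assms(2) by simp
qed

lemma Phi_holomorphic: "Phi x holomorphic_on {u. \<bar>Im u\<bar> < 2 * pi} - {0, of_real U}"
  unfolding Phi_def
  by (intro holomorphic_intros) (use qlog_nonzero Phi_den_nonzero in \<open>auto simp: qlog_def[abs_def] intro!: holomorphic_intros\<close>)

lemma qlog_limit: "((\<lambda>u. qlog u / u\<^sup>2) \<longlongrightarrow> 1 / 2) (at 0)"
proof -
  have "((\<lambda>u. qlog u / u\<^sup>2 - 1 / 2) \<longlongrightarrow> 0) (at 0)"
  proof (rule Lim_null_comparison)
    have "norm (qlog u / u\<^sup>2 - 1 / 2) \<le> exp \<bar>Re u\<bar> * norm u / 2" if "u \<noteq> 0" for u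
    proof -
      have "norm (exp (- u) - (\<Sum>k\<le>2. (- u) ^ k / fact k)) \<le> exp \<bar>Re (- u)\<bar> * norm (- u) ^ Suc 2 / fact 2"
        by (rule Taylor_exp)
      also have "(\<Sum>k\<le>2. (- u) ^ k / fact k) = 1 - u + u\<^sup>2 / 2"
        by (simp add: numeral_2_eq_2)
      also have "exp (- u) - (1 - u + u\<^sup>2 / 2) = u\<^sup>2 * (qlog u / u\<^sup>2 - 1 / 2)"
        using that by (simp add: qlog_def field_simps)
      finally have "norm u ^ 2 * norm (qlog u / u\<^sup>2 - 1 / 2) \<le> norm u ^ 2 * (exp \<bar>Re u\<bar> * norm u / 2)"
        by (simp add: norm_mult norm_power fact_numeral power3_eq_cube power2_eq_square eval_nat_numeral mult_ac)
      then show ?thesis using that by (simp add: mult_le_cancel_left_pos)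
    qed
    then show "\<forall>\<^sub>F u in at 0. norm (qlog u / u\<^sup>2 - 1 / 2) \<le> exp \<bar>Re u\<bar> * norm u / 2"
      by (auto simp: eventually_at_filter)
    show "((\<lambda>u::complex. exp \<bar>Re u\<bar> * norm u / 2) \<longlongrightarrow> 0) (at 0)"
      by (rule tendsto_eq_intros refl | simp)+
  qed
  then show ?thesis by (simp add: LIM_zero_iff)
qed

text \<open>The double zero of \<open>qlog\<close> at 0 is cancelled by the simple zeros of
  \<open>1 - exp (- u)\<close> and \<open>exp u - 1\<close>, so the singularity is
  removable.\<close>

lemma residue_Phi_0: "residue (Phi x) 0 = 0"
proof (rule residue_simple'[where s = "{u. \<bar>Im u\<bar> < 2 * pi} - {of_real U}"])
  show "open ({u. \<bar>Im u\<bar> < 2 * pi} - {complex_of_real U})"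
    by (intro open_Diff open_Collect_less continuous_intros finite_imp_closed finite.intros)
  show "0 \<in> {u. \<bar>Im u\<bar> < 2 * pi} - {complex_of_real U}" using U_pos by auto
  show "Phi x holomorphic_on {u. \<bar>Im u\<bar> < 2 * pi} - {of_real U} - {0}"
    by (rule holomorphic_on_subset[OF Phi_holomorphic]) auto
  have l1: "((\<lambda>u. (1 - exp (- u)) / u) \<longlongrightarrow> 1) (at (0::complex))"
    by (rule lhopital_complex_simple[where f' = 1 and g' = 1]) (auto intro!: derivative_eq_intros)
  have l2: "((\<lambda>u. (exp u - 1) / u) \<longlongrightarrow> 1) (at (0::complex))"
    by (rule lhopital_complex_simple[where f' = 1 and g' = 1]) (auto intro!: derivative_eq_intros)
  have l3: "((\<lambda>u. u / (of_real x * (exp u - 1) - 1)) \<longlongrightarrow> 0) (at (0::complex))"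
    by (rule tendsto_eq_intros refl | simp)+
  have "((\<lambda>u. (1 - exp (- u)) / u * ((exp u - 1) / u) / (qlog u / u\<^sup>2) * (u / (of_real x * (exp u - 1) - 1)))
      \<longlongrightarrow> 1 * 1 / (1 / 2) * 0) (at 0)"
    by (intro tendsto_intros l1 l2 l3 qlog_limit) auto
  then have "((\<lambda>u. (1 - exp (- u)) / u * ((exp u - 1) / u) / (qlog u / u\<^sup>2) * (u / (of_real x * (exp u - 1) - 1)))
      \<longlongrightarrow> 0) (at 0)" by simp
  moreover have "\<forall>\<^sub>F u in at 0. (1 - exp (- u)) / u * ((exp u - 1) / u) / (qlog u / u\<^sup>2) * (u / (of_real x * (exp u - 1) - 1)) =
      Phi x u * (u - 0)"
    unfolding eventually_at_filter by (intro always_eventually) (auto simp: Phi_def power2_eq_square)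
  ultimately show "((\<lambda>u. Phi x u * (u - 0)) \<longlongrightarrow> 0) (at 0)"
    by (rule Lim_transform_eventually)
qed

text \<open>The pole is simple and comes from \<open>x * (exp u - 1) = 1\<close>. The derivative of
  that denominator at \<open>U\<close> is \<open>x * exp U = x + 1\<close>; the other factors are
  \<open>1 / (x + 1)\<close>, \<open>1 / dg x\<close> and \<open>1 / x\<close>.\<close>

lemma residue_Phi_U: "residue (Phi x) (of_real U) = of_real (Fg x)"
proof (rule residue_simple'[where s = "{u. \<bar>Im u\<bar> < 2 * pi} - {0}"])
  show "open ({u. \<bar>Im u\<bar> < 2 * pi} - {0::complex})"
    by (intro open_Diff open_Collect_less continuous_intros finite_imp_closed finite.intros)
  show "complex_of_real U \<in> {u. \<bar>Im u\<bar> < 2 * pi} - {0}" using U_pos by auto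
  show "Phi x holomorphic_on {u. \<bar>Im u\<bar> < 2 * pi} - {0} - {of_real U}"
    by (rule holomorphic_on_subset[OF Phi_holomorphic]) auto
  let ?U = "complex_of_real U"
  have l1: "((\<lambda>u. (u - ?U) / (of_real x * (exp u - 1) - 1)) \<longlongrightarrow> 1 / of_real (x + 1)) (at ?U)"
  proof (rule lhopital_complex_simple)
    have xe: "of_real x * exp ?U = of_real (x + 1)" unfolding exp_U using x by (simp add: field_simps)
    show "((\<lambda>u. u - ?U) has_field_derivative 1) (at ?U)" by (auto intro!: derivative_eq_intros)
    have "((\<lambda>u. of_real x * (exp u - 1) - 1) has_field_derivative of_real x * exp ?U) (at ?U)"
      by (auto intro!: derivative_eq_intros)
    then show "((\<lambda>u. of_real x * (exp u - 1) - 1) has_field_derivative of_real (x + 1)) (at ?U)"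
      unfolding xe .
    show "of_real x * (exp ?U - 1) - 1 = 0" unfolding exp_U using x by simp
    show "of_real (x + 1) \<noteq> (0::complex)" using x by (simp only: of_real_eq_0_iff)
  qed auto
  have q: "qlog ?U \<noteq> 0" using qlog_nonzero[of ?U] U_pos by auto
  have "((\<lambda>u. (1 - exp (- u)) / qlog u * (exp u - 1) * ((u - ?U) / (of_real x * (exp u - 1) - 1)))
      \<longlongrightarrow> (1 - exp (- ?U)) / qlog ?U * (exp ?U - 1) * (1 / of_real (x + 1))) (at ?U)"
    using q by (intro tendsto_intros l1) (auto simp: qlog_def[abs_def] intro!: tendsto_intros)
  moreover have "(1 - exp (- ?U)) / qlog ?U * (exp ?U - 1) * (1 / of_real (x + 1)) = of_real (Fg x)"
  proof -
    have e: "exp (- ?U) = of_real (x / (x + 1))" unfolding exp_minus exp_U using x by (simp add: field_simps)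
    have "dg x = U - 1 + x / (x + 1)" using x by (simp add: dg_def U_def field_simps)
    then have "qlog ?U = of_real (dg x)" unfolding qlog_def e by (simp only: of_real_add of_real_diff of_real_1)
    moreover have "1 - exp (- ?U) = of_real (1 / (x + 1))"
    proof -
      have "1 / (x + 1) = 1 - x / (x + 1)" using x by (simp add: field_simps)
      then show ?thesis unfolding e by (simp only: of_real_diff of_real_1)
    qed
    moreover have "exp ?U - 1 = of_real (1 / x)" unfolding exp_U by simp
    ultimately show ?thesis using x by (simp add: Fg_def power2_eq_square)
  qed
  ultimately show "((\<lambda>u. Phi x u * (u - ?U)) \<longlongrightarrow> of_real (Fg x)) (at ?U)"
    by (simp add: Phi_def)
qed


text \<open>To the right \<open>qlog u\<close> grows like \<open>u\<close> while the other factors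
  stay bounded. This is expressed as continuity at the origin of a function of
  \<open>exp (- u)\<close> and \<open>1 / u\<close>.\<close>

lemma Phi_right:
  assumes "e > 0"
  shows "\<exists>B0>0. \<forall>u. Re u \<ge> B0 \<longrightarrow> norm (Phi x u) < e"
proof -
  define \<Psi> where "\<Psi> p = snd p * (1 - fst p) / (1 + snd p * (fst p - 1)) * ((1 - fst p) / (of_real x * (1 - fst p) - fst p))"
    for p :: "complex \<times> complex"
  have "isCont \<Psi> (0, 0)" unfolding \<Psi>_def using x by (intro continuous_intros) auto
  moreover have "\<Psi> (0, 0) = 0" by (simp add: \<Psi>_def)
  ultimately obtain d where d: "d > 0" "\<And>p. norm p < d \<Longrightarrow> norm (\<Psi> p) < e"
    unfolding continuous_at_eps_delta using assms by (metis dist_0_norm dist_commute zero_prod_def)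
  define B0 where "B0 = max 1 (4 / d)"
  have "norm (Phi x u) < e" if u: "Re u \<ge> B0" for u
  proof -
    have Bd: "1 / B0 \<le> d / 4" "B0 \<ge> 1" using d(1) by (auto simp: B0_def field_simps max_def)
    have u0: "u \<noteq> 0" using u Bd by auto
    have "norm (1 / u) \<le> 1 / B0" using u Bd complex_Re_le_cmod[of u] by (simp add: norm_divide frac_le)
    moreover have "norm (exp (- u)) \<le> 1 / B0"
    proof -
      have "Re u \<le> exp (Re u)" using exp_ge_add_one_self[of "Re u"] by linarith
      then have "exp (- Re u) \<le> 1 / B0" unfolding exp_minus inverse_eq_divide using u Bd by (intro frac_le) auto
      then show ?thesis by (simp add: norm_exp_eq_Re)
    qed
    ultimately have "norm (exp (- u), 1 / u) < d"
      using norm_Pair_le[of "exp (- u)" "1 / u"] Bd d(1) by linarith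
    then have "norm (\<Psi> (exp (- u), 1 / u)) < e" by (rule d)
    moreover have "\<Psi> (exp (- u), 1 / u) = Phi x u"
    proof -
      have "qlog u = u * (1 + 1 / u * (exp (- u) - 1))" using u0 by (simp add: qlog_def field_simps)
      moreover have "exp u - 1 = exp u * (1 - exp (- u))" by (simp add: exp_minus field_simps)
      moreover have "of_real x * (exp u - 1) - 1 = exp u * (of_real x * (1 - exp (- u)) - exp (- u))"
        by (simp add: exp_minus field_simps)
      ultimately show ?thesis using u0 by (simp add: \<Psi>_def Phi_def)
    qed
    ultimately show ?thesis by simp
  qed
  then show ?thesis by (intro exI[of _ B0]) (auto simp: B0_def)
qed

text \<open>The left end is the point \<open>z = -1\<close> of the cut. The nonzero limit there is
  the source of the separate summand \<open>1 / (x + 1)\<close> of \<open>Fg\<close>. The small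
  variables are now \<open>exp u\<close> and \<open>(u - 1) * exp u\<close>.\<close>

lemma Phi_left:
  assumes "e > 0"
  shows "\<exists>A0>0. \<forall>u. Re u \<le> - A0 \<and> \<bar>Im u\<bar> \<le> pi \<longrightarrow> norm (Phi x u + 1 / of_real (x + 1)) < e"
proof -
  define \<Psi> where "\<Psi> p = (fst p - 1) / (snd p + 1) * ((fst p - 1) / (of_real x * (fst p - 1) - 1)) + 1 / of_real (x + 1)"
    for p :: "complex \<times> complex"
  have nz: "- complex_of_real x - 1 \<noteq> 0"
  proof -
    have "- complex_of_real x - 1 = - of_real (x + 1)" by simp
    then show ?thesis using x by (simp only: neg_equal_0_iff_equal of_real_eq_0_iff)
  qed
  have "isCont \<Psi> (0, 0)" unfolding \<Psi>_def using x nz by (intro continuous_intros) auto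
  moreover have "\<Psi> (0, 0) = 0"
  proof -
    have "- 1 / (- complex_of_real x - 1) = 1 / of_real (x + 1)"
    proof -
      have "- complex_of_real x - 1 = - of_real (x + 1)" by simp
      then show ?thesis by (simp only: divide_minus_right minus_divide_left minus_minus)
    qed
    then show ?thesis by (simp add: \<Psi>_def)
  qed
  ultimately obtain d where d: "d > 0" "\<And>p. norm p < d \<Longrightarrow> norm (\<Psi> p) < e"
    unfolding continuous_at_eps_delta using assms by (metis dist_0_norm dist_commute zero_prod_def)
  have "((\<lambda>A::real. exp (- A) + (A + 5) * exp (- A)) \<longlongrightarrow> 0) at_top" by real_asymp
  then have "eventually (\<lambda>A. exp (- A) + (A + 5) * exp (- A) < d) at_top"
    using d(1) by (rule order_tendstoD)
  then obtain A0 where A0: "\<And>A. A \<ge> A0 \<Longrightarrow> exp (- A) + (A + 5) * exp (- A) < d"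
    by (auto simp: eventually_at_top_linorder)
  have "norm (Phi x u + 1 / of_real (x + 1)) < e" if u: "Re u \<le> - max A0 1" "\<bar>Im u\<bar> \<le> pi" for u
  proof -
    define A where "A = - Re u"
    have A: "A \<ge> A0" "A \<ge> 1" using u by (auto simp: A_def)
    have n1: "norm (exp u) = exp (- A)" by (simp add: norm_exp_eq_Re A_def)
    have "norm (u - 1) \<le> norm u + 1" using norm_triangle_ineq4[of u 1] by simp
    also have "norm u \<le> A + 4" using cmod_le[of u] u(2) A pi_less_4 by (simp add: A_def)
    finally have "norm ((u - 1) * exp u) \<le> (A + 5) * exp (- A)"
      unfolding norm_mult n1 by (intro mult_right_mono) auto
    then have "norm (exp u, (u - 1) * exp u) < d"
      using norm_Pair_le[of "exp u" "(u - 1) * exp u"] A0[OF A(1)] n1 by linarith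
    then have "norm (\<Psi> (exp u, (u - 1) * exp u)) < e" by (rule d)
    moreover have "\<Psi> (exp u, (u - 1) * exp u) = Phi x u + 1 / of_real (x + 1)"
    proof -
      have "qlog u = exp (- u) * ((u - 1) * exp u + 1)" by (simp add: qlog_def exp_minus field_simps)
      moreover have "1 - exp (- u) = exp (- u) * (exp u - 1)" by (simp add: exp_minus field_simps)
      ultimately show ?thesis by (simp add: \<Psi>_def Phi_def)
    qed
    ultimately show ?thesis by simp
  qed
  then show ?thesis by (intro exI[of _ "max A0 1"]) auto
qed

text \<open>On both edges \<open>exp u = - exp t\<close>, so all factors agree except
  \<open>1 / qlog\<close>, whose two values are complex conjugate. Their difference produces the
  denominator of \<open>wcut\<close>; the common real factor is
  \<open>1 / (x + tcut t)\<close>.\<close>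

lemma Phi_lines:
  "Phi x (of_real t - \<i> * pi) - Phi x (of_real t + \<i> * pi) = of_real (wcut t / (x + tcut t)) * (2 * pi * \<i>)"
proof -
  define Q where "Q = t - 1 - exp (- t)"
  have e: "exp (of_real t + \<i> * pi) = - of_real (exp t)" "exp (of_real t - \<i> * pi) = - of_real (exp t)"
    "exp (- (of_real t + \<i> * pi)) = - of_real (exp (- t))" "exp (- (of_real t - \<i> * pi)) = - of_real (exp (- t))"
    by (simp_all add: exp_add exp_diff exp_minus exp_of_real mult.commute inverse_eq_divide)
  have q: "qlog (of_real t + \<i> * pi) = Complex Q pi" "qlog (of_real t - \<i> * pi) = Complex Q (- pi)"
    unfolding qlog_def e by (simp_all add: Q_def complex_eq_iff)
  have "x * (exp t + 1) + 1 > 0" using x by (intro add_pos_pos mult_pos_pos) auto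
  then have K: "(- complex_of_real (exp t) - 1) / (of_real x * (- of_real (exp t) - 1) - 1) = of_real (1 / (x + tcut t))"
  proof -
    have "(- complex_of_real (exp t) - 1) / (of_real x * (- of_real (exp t) - 1) - 1)
        = of_real ((- exp t - 1) / (x * (- exp t - 1) - 1))" by simp
    also have "(- exp t - 1) / (x * (- exp t - 1) - 1) = (exp t + 1) / (x * (exp t + 1) + 1)"
    proof -
      have "- exp t - 1 = - (exp t + 1)" "x * (- exp t - 1) - 1 = - (x * (exp t + 1) + 1)" by (auto simp: algebra_simps)
      then show ?thesis by (simp only: minus_divide_divide)
    qed
    also have "(exp t + 1) / (x * (exp t + 1) + 1) = 1 / (x + tcut t)"
    proof -
      have "exp t + 1 > 0" by (simp add: add_pos_pos)
      moreover have "x * E + 1 = E * (x + 1 / E)" if "E > 0" for E using that by (simp add: field_simps)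
      ultimately have "x * (exp t + 1) + 1 = (exp t + 1) * (x + tcut t)" unfolding tcut_def by blast
      then show ?thesis using \<open>exp t + 1 > 0\<close> by simp
    qed
    finally show ?thesis .
  qed
  have "1 / Complex Q (- pi) - 1 / Complex Q pi = of_real (1 / (Q\<^sup>2 + pi\<^sup>2)) * (2 * pi * \<i>)"
  proof -
    have "Q\<^sup>2 + pi\<^sup>2 > 0" by (intro add_nonneg_pos) auto
    then have "d / d\<^sup>2 = 1 / d" if "d = Q\<^sup>2 + pi\<^sup>2" for d using that by (simp add: power2_eq_square)
    then have "2 * pi * (Q\<^sup>2 + pi\<^sup>2) / (Q\<^sup>2 + pi\<^sup>2)\<^sup>2 = 2 * pi / (Q\<^sup>2 + pi\<^sup>2)"
      by (metis mult.right_neutral times_divide_eq_right)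
    then show ?thesis by (simp add: complex_eq_iff Re_divide Im_divide)
  qed
  then have d: "(1 + complex_of_real (exp (- t))) / Complex Q (- pi) - (1 + of_real (exp (- t))) / Complex Q pi =
     (1 + of_real (exp (- t))) * (of_real (1 / (Q\<^sup>2 + pi\<^sup>2)) * (2 * pi * \<i>))"
    by (metis mult.right_neutral right_diff_distrib times_divide_eq_right)
  have "(1 - - complex_of_real (exp (- t))) / Complex Q (- pi) * of_real (1 / (x + tcut t)) -
      (1 - - complex_of_real (exp (- t))) / Complex Q pi * of_real (1 / (x + tcut t)) =
      ((1 + of_real (exp (- t))) * (of_real (1 / (Q\<^sup>2 + pi\<^sup>2)) * (2 * pi * \<i>))) * of_real (1 / (x + tcut t))"
    by (simp only: d left_diff_distrib[symmetric] diff_minus_eq_add)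
  also have "\<dots> = of_real (wcut t / (x + tcut t)) * (2 * pi * \<i>)"
    unfolding wcut_def Q_def[symmetric] by simp
  finally show ?thesis
    unfolding Phi_def q e K .
qed

end

section \<open>The contour integral and its limit\<close>

lemma abs_less_2pi: "- pi \<le> y \<Longrightarrow> y \<le> pi \<Longrightarrow> \<bar>y\<bar> < 2 * pi"
  using pi_gt_zero by linarith

lemma contour_integral_linepath_shift:
  "contour_integral (linepath (a + c) (b + c)) f = contour_integral (linepath a b) (\<lambda>z. f (z + c))"
proof -
  have "(f has_contour_integral i) (linepath (a + c) (b + c)) \<longleftrightarrow>
        ((\<lambda>z. f (z + c)) has_contour_integral i) (linepath a b)" for i
  proof -
    have "linepath (a + c) (b + c) x = linepath a b x + c" for x
      by (simp add: linepath_def algebra_simps)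
    then show ?thesis by (simp add: has_contour_integral_linepath)
  qed
  then show ?thesis by (simp add: contour_integral_def contour_integrable_on_def)
qed

text \<open>Residue theorem on a rectangle of height \<open>2 * pi\<close>. The function is
  considered on a strip twice as wide, so that the horizontal edges lie inside its domain; the bound
  on \<open>n\<close> makes the rectangle enclose the pole.\<close>

lemma Stieltjes_truncated:
  assumes x: "x > 0" and n: "n > ln (1 + 1 / x)"
  shows "integral {-n..n} (\<lambda>t. wcut t / (x + tcut t)) * (2 * pi * \<i>) +
    contour_integral (linepath (Complex n (-pi)) (Complex n pi)) (Phi x) -
    contour_integral (linepath (Complex (-n) (-pi)) (Complex (-n) pi)) (Phi x) = 2 * pi * \<i> * Fg x"
proof -
  define U where "U = ln (1 + 1 / x)"
  define S where "S = {u. \<bar>Im u\<bar> < 2 * pi}"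
  have U: "U > 0" "U < n" using U_pos[OF x] n by (auto simp: U_def)
  then have n0: "n > 0" by simp
  have S: "open S" "convex S"
  proof -
    show "open S" unfolding S_def by (intro open_Collect_less continuous_intros)
    have "S = {u. Im u < 2 * pi} \<inter> {u. Im u > - (2 * pi)}" by (auto simp: S_def)
    then show "convex S" by (simp add: convex_Int convex_halfspace_Im_lt convex_halfspace_Im_gt)
  qed
  have hol: "Phi x holomorphic_on S - {0, of_real U}"
    unfolding S_def U_def by (rule Phi_holomorphic[OF x])
  have cont: "continuous_on T (Phi x)" if "T \<subseteq> S - {0, of_real U}" for T
    using holomorphic_on_imp_continuous_on[OF hol] that by (rule continuous_on_subset)
  let ?a1 = "Complex (-n) (-pi)" and ?a2 = "Complex n (-pi)" and ?a3 = "Complex n pi" and ?a4 = "Complex (-n) pi"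
  have seg: "closed_segment ?a1 ?a2 \<subseteq> S - {0, of_real U}" "closed_segment ?a2 ?a3 \<subseteq> S - {0, of_real U}"
    "closed_segment ?a3 ?a4 \<subseteq> S - {0, of_real U}" "closed_segment ?a4 ?a1 \<subseteq> S - {0, of_real U}"
    "closed_segment ?a4 ?a3 \<subseteq> S - {0, of_real U}" "closed_segment ?a1 ?a4 \<subseteq> S - {0, of_real U}"
    using U n0 pi_gt_zero
    by (auto simp: closed_segment_same_Re closed_segment_same_Im closed_segment_eq_real_ivl S_def complex_eq_iff intro!: abs_less_2pi)
  have "path_image (rectpath ?a1 ?a3) \<subseteq> S - {0, of_real U}"
    unfolding rectpath_def Let_def using seg by (auto simp: path_image_join)
  moreover have box: "0 \<in> box ?a1 ?a3" "of_real U \<in> box ?a1 ?a3"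
    using U n0 by (auto simp: in_box_complex_iff)
  moreover have "\<forall>z. z \<notin> S \<longrightarrow> winding_number (rectpath ?a1 ?a3) z = 0"
    using calculation(1) S by (auto intro!: winding_number_zero_outside[of _ S])
  ultimately have "contour_integral (rectpath ?a1 ?a3) (Phi x) =
      2 * pi * \<i> * (\<Sum>p\<in>{0, of_real U}. winding_number (rectpath ?a1 ?a3) p * residue (Phi x) p)"
    using S hol by (intro Residue_theorem[of S]) (auto simp: convex_connected)
  also have "\<dots> = 2 * pi * \<i> * Fg x"
    using box U residue_Phi_0[OF x] residue_Phi_U[OF x] by (simp add: winding_number_rectpath U_def)
  finally have R: "contour_integral (rectpath ?a1 ?a3) (Phi x) = 2 * pi * \<i> * Fg x" .
  have ci: "Phi x contour_integrable_on linepath p q" if "closed_segment p q \<subseteq> S - {0, of_real U}" for p q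
    using cont[OF that] by (rule contour_integrable_continuous_linepath)
  have J: "contour_integral (rectpath ?a1 ?a3) (Phi x) =
      contour_integral (linepath ?a1 ?a2) (Phi x) + (contour_integral (linepath ?a2 ?a3) (Phi x) +
      (contour_integral (linepath ?a3 ?a4) (Phi x) + contour_integral (linepath ?a4 ?a1) (Phi x)))"
    unfolding rectpath_def Let_def using seg
    by (simp add: contour_integral_join ci contour_integrable_joinI valid_path_join)
  have r1: "contour_integral (linepath ?a3 ?a4) (Phi x) = - contour_integral (linepath ?a4 ?a3) (Phi x)"
    by (rule contour_integral_reverse_linepath) (rule cont, rule seg)
  have r2: "contour_integral (linepath ?a4 ?a1) (Phi x) = - contour_integral (linepath ?a1 ?a4) (Phi x)"
    by (rule contour_integral_reverse_linepath) (rule cont, rule seg)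
  have sh1: "linepath ?a1 ?a2 = linepath (of_real (-n) + (- \<i> * pi)) (of_real n + (- \<i> * pi))"
    by (rule arg_cong2[of _ _ _ _ linepath]) (auto simp: complex_eq_iff)
  have sh2: "linepath ?a4 ?a3 = linepath (of_real (-n) + \<i> * pi) (of_real n + \<i> * pi)"
    by (rule arg_cong2[of _ _ _ _ linepath]) (auto simp: complex_eq_iff)
  have "contour_integral (linepath ?a1 ?a2) (Phi x) - contour_integral (linepath ?a4 ?a3) (Phi x) =
      integral {-n..n} (\<lambda>t. Phi x (of_real t - \<i> * pi)) - integral {-n..n} (\<lambda>t. Phi x (of_real t + \<i> * pi))"
    unfolding sh1 sh2 contour_integral_linepath_shift using n0
    by (subst (1 2) contour_integral_linepath_Reals_eq) auto
  also have "\<dots> = integral {-n..n} (\<lambda>t. Phi x (of_real t - \<i> * pi) - Phi x (of_real t + \<i> * pi))"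
  proof (rule integral_diff[symmetric]; rule integrable_continuous_real)
    have "of_real t - \<i> * pi \<in> S - {0, of_real U}" "of_real t + \<i> * pi \<in> S - {0, of_real U}" for t
      using pi_gt_zero by (auto simp: S_def complex_eq_iff)
    then show "continuous_on {-n..n} (\<lambda>t. Phi x (of_real t - \<i> * pi))"
      "continuous_on {-n..n} (\<lambda>t. Phi x (of_real t + \<i> * pi))"
      by (auto intro!: continuous_on_compose2[OF cont[OF order_refl]] continuous_intros)
  qed
  also have "\<dots> = integral {-n..n} (\<lambda>t. of_real (wcut t / (x + tcut t)) * (2 * pi * \<i>))"
    by (simp only: Phi_lines[OF x])
  also have "\<dots> = integral {-n..n} (\<lambda>t. complex_of_real (wcut t / (x + tcut t))) * (2 * pi * \<i>)"
    by (rule integral_mult_left)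
  also have "integral {-n..n} (\<lambda>t. complex_of_real (wcut t / (x + tcut t))) = of_real (integral {-n..n} (\<lambda>t. wcut t / (x + tcut t)))"
  proof -
    have "continuous_on {-n..n} (\<lambda>t. wcut t / (x + tcut t))"
    proof -
      have "(t - 1 - exp (- t))\<^sup>2 + pi\<^sup>2 \<noteq> 0" for t using add_nonneg_pos[of "(t - 1 - exp (- t))\<^sup>2" "pi\<^sup>2"] by simp
      moreover have "x + 1 / (exp t + 1) \<noteq> 0" "exp t + 1 \<noteq> 0" for t
        using x tcut_bounds(1)[of t] exp_gt_zero[of t] unfolding tcut_def by linarith+
      ultimately show ?thesis unfolding wcut_def tcut_def by (intro continuous_intros) auto
    qed
    then show ?thesis
      by (intro integral_unique has_integral_of_real integrable_integral integrable_continuous_real)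
  qed
  finally show ?thesis using R unfolding J r1 r2 by (simp add: algebra_simps)
qed

text \<open>As the rectangle widens, the right edge vanishes and the left edge tends to
  \<open>- 2 * pi * \<i> / (x + 1)\<close>. The integrand is nonnegative, so monotone convergence
  delivers integrability along with the value.\<close>

lemma Fg_Stieltjes:
  assumes x: "x > 0"
  shows "has_bochner_integral lborel (\<lambda>t. wcut t / (x + tcut t)) (Fg x - 1 / (x + 1))"
proof -
  define f where "f t = wcut t / (x + tcut t)" for t
  have f0: "f t \<ge> 0" for t using wcut_pos[of t] tcut_bounds[of t] x by (simp add: f_def)
  have fc: "continuous_on T f" for T
  proof -
    have "(t - 1 - exp (- t))\<^sup>2 + pi\<^sup>2 \<noteq> 0" for t using add_nonneg_pos[of "(t - 1 - exp (- t))\<^sup>2" "pi\<^sup>2"] by simp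
    moreover have "x + 1 / (exp t + 1) \<noteq> 0" "exp t + 1 \<noteq> 0" for t
      using x tcut_bounds(1)[of t] exp_gt_zero[of t] unfolding tcut_def by linarith+
    ultimately show ?thesis unfolding f_def wcut_def tcut_def by (intro continuous_intros) auto
  qed
  have fm[measurable]: "f \<in> borel_measurable borel" using fc by (rule borel_measurable_continuous_onI)
  define V where "V n = contour_integral (linepath (Complex (real n) (-pi)) (Complex (real n) pi)) (Phi x)" for n
  define W where "W n = contour_integral (linepath (Complex (- real n) (-pi)) (Complex (- real n) pi)) (Phi x)" for n
  have evn: "\<forall>\<^sub>F n in sequentially. real n > c" for c
    using filterlim_real_sequentially by (simp add: filterlim_at_top_dense)
  have int_line: "Phi x contour_integrable_on linepath (Complex c (-pi)) (Complex c pi)"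
    if c: "\<bar>c\<bar> > ln (1 + 1 / x)" for c
  proof (rule contour_integrable_continuous_linepath, rule continuous_on_subset)
    show "continuous_on ({u. \<bar>Im u\<bar> < 2 * pi} - {0, of_real (ln (1 + 1 / x))}) (Phi x)"
      by (rule holomorphic_on_imp_continuous_on[OF Phi_holomorphic[OF x]])
    show "closed_segment (Complex c (-pi)) (Complex c pi) \<subseteq> {u. \<bar>Im u\<bar> < 2 * pi} - {0, of_real (ln (1 + 1 / x))}"
      using U_pos[OF x] c pi_gt_zero by (auto simp: closed_segment_same_Re closed_segment_eq_real_ivl complex_eq_iff intro!: abs_less_2pi)
  qed
  have len: "norm (Complex c pi - Complex c (-pi)) = 2 * pi" for c
  proof -
    have "Complex c pi - Complex c (-pi) = of_real (2 * pi) * \<i>" by (simp add: complex_eq_iff)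
    then show ?thesis by (simp add: norm_mult)
  qed
  have V: "V \<longlonglongrightarrow> 0"
  proof (rule tendstoI)
    fix e :: real assume e: "e > 0"
    obtain B where B: "\<And>u. Re u \<ge> B \<Longrightarrow> norm (Phi x u) < e / (4 * pi)"
      using Phi_right[OF x, of "e / (4 * pi)"] e by auto
    show "\<forall>\<^sub>F n in sequentially. dist (V n) 0 < e"
      using evn[of "max B (ln (1 + 1 / x))"]
    proof eventually_elim
      case (elim n)
      have "norm (V n) \<le> e / (4 * pi) * norm (Complex (real n) pi - Complex (real n) (-pi))"
        unfolding V_def
      proof (rule contour_integral_bound_linepath)
        show "Phi x contour_integrable_on linepath (Complex (real n) (-pi)) (Complex (real n) pi)"
          using elim by (intro int_line) auto
        show "norm (Phi x u) \<le> e / (4 * pi)" if "u \<in> closed_segment (Complex (real n) (-pi)) (Complex (real n) pi)" for u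
          using that elim B[of u] by (auto simp: closed_segment_same_Re)
      qed (use e in auto)
      then show ?case using e by (simp add: len dist_norm)
    qed
  qed
  have W: "W \<longlonglongrightarrow> - (2 * pi * \<i> / of_real (x + 1))"
  proof (rule tendstoI)
    fix e :: real assume e: "e > 0"
    obtain A where A: "\<And>u. Re u \<le> - A \<Longrightarrow> \<bar>Im u\<bar> \<le> pi \<Longrightarrow> norm (Phi x u + 1 / of_real (x + 1)) < e / (4 * pi)"
      using Phi_left[OF x, of "e / (4 * pi)"] e by (metis divide_pos_pos mult_pos_pos pi_gt_zero zero_less_numeral)
    show "\<forall>\<^sub>F n in sequentially. dist (W n) (- (2 * pi * \<i> / of_real (x + 1))) < e"
      using evn[of "max A (ln (1 + 1 / x))"]
    proof eventually_elim
      case (elim n)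
      let ?l = "linepath (Complex (- real n) (-pi)) (Complex (- real n) pi)"
      have i: "Phi x contour_integrable_on ?l" using elim by (intro int_line) auto
      have c: "((\<lambda>u. 1 / of_real (x + 1)) has_contour_integral 1 / of_real (x + 1) * (Complex (- real n) pi - Complex (- real n) (-pi))) ?l"
        by (rule has_contour_integral_const_linepath)
      have d: "Complex (- real n) pi - Complex (- real n) (-pi) = 2 * pi * \<i>" by (simp add: complex_eq_iff)
      have h: "((\<lambda>u. Phi x u + 1 / of_real (x + 1)) has_contour_integral (W n + 1 / of_real (x + 1) * (2 * pi * \<i>))) ?l"
        using has_contour_integral_add[OF has_contour_integral_integral[OF i] c] unfolding W_def d .
      have "norm (W n + 1 / of_real (x + 1) * (2 * pi * \<i>)) \<le> e / (4 * pi) * norm (Complex (- real n) pi - Complex (- real n) (-pi))"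
      proof (rule has_contour_integral_bound_linepath[OF h])
        fix u assume "u \<in> closed_segment (Complex (- real n) (-pi)) (Complex (- real n) pi)"
        then show "norm (Phi x u + 1 / of_real (x + 1)) \<le> e / (4 * pi)"
          using elim by (intro A[THEN less_imp_le]) (auto simp: closed_segment_same_Re closed_segment_eq_real_ivl)
      qed (use e in auto)
      then show ?case using e by (simp add: len dist_norm)
    qed
  qed
  define f' where "f' n t = indicator {- real n..real n} t * f t" for n :: nat and t :: real
  have fi: "integrable lborel (f' n)" "integral\<^sup>L lborel (f' n) = integral {- real n..real n} f" for n
  proof -
    have s: "set_integrable lborel {- real n..real n} f"
      by (rule borel_integrable_atLeastAtMost') (rule fc)
    then show "integrable lborel (f' n)" by (simp add: set_integrable_def f'_def[abs_def])
    show "integral\<^sup>L lborel (f' n) = integral {- real n..real n} f"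
      using set_borel_integral_eq_integral(2)[OF s] by (simp add: set_lebesgue_integral_def f'_def[abs_def])
  qed
  have lim: "(\<lambda>n. integral\<^sup>L lborel (f' n)) \<longlonglongrightarrow> Fg x - 1 / (x + 1)"
  proof -
    have "(\<lambda>n. (2 * pi * \<i> * Fg x - V n + W n) / (2 * pi * \<i>)) \<longlonglongrightarrow> (2 * pi * \<i> * Fg x - 0 + - (2 * pi * \<i> / of_real (x + 1))) / (2 * pi * \<i>)"
      by (intro tendsto_intros V W) auto
    also have "(2 * pi * \<i> * Fg x - 0 + - (2 * pi * \<i> / of_real (x + 1))) / (2 * pi * \<i>) = of_real (Fg x - 1 / (x + 1))"
      by (simp add: field_simps)
    finally have "(\<lambda>n. (2 * pi * \<i> * Fg x - V n + W n) / (2 * pi * \<i>)) \<longlonglongrightarrow> of_real (Fg x - 1 / (x + 1))" .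
    moreover have "\<forall>\<^sub>F n in sequentially. (2 * pi * \<i> * Fg x - V n + W n) / (2 * pi * \<i>) = of_real (integral\<^sup>L lborel (f' n))"
      using evn[of "ln (1 + 1 / x)"]
    proof eventually_elim
      case (elim n)
      have "integral {- real n..real n} f * (2 * pi * \<i>) + V n - W n = 2 * pi * \<i> * Fg x"
        using Stieltjes_truncated[OF x elim] unfolding V_def W_def f_def .
      then have "2 * pi * \<i> * Fg x - V n + W n = integral {- real n..real n} f * (2 * pi * \<i>)"
        by (simp add: algebra_simps)
      then show ?case by (simp add: fi)
    qed
    ultimately have "(\<lambda>n. complex_of_real (integral\<^sup>L lborel (f' n))) \<longlonglongrightarrow> of_real (Fg x - 1 / (x + 1))"
      by (rule Lim_transform_eventually)
    then show ?thesis by (simp only: tendsto_of_real_iff)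
  qed
  have mono: "AE t in lborel. mono (\<lambda>n. f' n t)"
    using f0 by (intro AE_I2 monoI) (auto simp: f'_def indicator_def)
  have conv: "AE t in lborel. (\<lambda>n. f' n t) \<longlonglongrightarrow> f t"
  proof (intro AE_I2)
    fix t
    have "\<forall>\<^sub>F n in sequentially. f t = f' n t"
      using evn[of "\<bar>t\<bar>"] by eventually_elim (auto simp: f'_def indicator_def)
    then show "(\<lambda>n. f' n t) \<longlonglongrightarrow> f t" by (rule Lim_transform_eventually[OF tendsto_const])
  qed
  have "integrable lborel f" "integral\<^sup>L lborel f = Fg x - 1 / (x + 1)"
    by (rule integral_monotone_convergence_nonneg[OF fi(1) mono _ conv lim]; use f0 in \<open>auto simp: f'_def\<close>)+
  then show ?thesis unfolding f_def[abs_def] has_bochner_integral_iff by blast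
qed

section \<open>Laplace transforms and moments over the cut\<close>

definition Lcut :: "(real \<Rightarrow> real) \<Rightarrow> real \<Rightarrow> real" where
  "Lcut \<psi> s = (\<integral>\<tau>. \<psi> \<tau> * exp (- (tcut \<tau> * s)) \<partial>lborel)"

definition moment :: "(real \<Rightarrow> real) \<Rightarrow> nat \<Rightarrow> real" where
  "moment \<psi> n = (\<integral>\<tau>. \<psi> \<tau> * tcut \<tau> ^ n \<partial>lborel)"

lemma tcut_measurable[measurable]: "tcut \<in> borel_measurable borel"
  unfolding tcut_def[abs_def] by measurable

lemma wcut_measurable[measurable]: "wcut \<in> borel_measurable borel"
  unfolding wcut_def[abs_def] by measurable

lemma integrable_bounded_mult:
  fixes \<psi> f :: "real \<Rightarrow> real"
  assumes "integrable lborel \<psi>" "f \<in> borel_measurable borel" "\<And>x. \<bar>f x\<bar> \<le> B"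
  shows "integrable lborel (\<lambda>x. \<psi> x * f x)"
proof (rule Bochner_Integration.integrable_bound)
  show "integrable lborel (\<lambda>x. B * \<psi> x)" using assms(1) by simp
  have [measurable]: "\<psi> \<in> borel_measurable borel" using assms(1) by auto
  note assms(2)[measurable]
  show "(\<lambda>x. \<psi> x * f x) \<in> borel_measurable lborel" by measurable
  have "B \<ge> 0" using assms(3)[of 0] by linarith
  then have "\<bar>\<psi> x * f x\<bar> \<le> \<bar>B * \<psi> x\<bar>" for x
    using mult_right_mono[OF assms(3)[of x], of "\<bar>\<psi> x\<bar>"] by (simp add: abs_mult mult.commute)
  then show "AE x in lborel. norm (\<psi> x * f x) \<le> norm (B * \<psi> x)" by simp
qed

lemma integrable_mult_tcut_power: "integrable lborel \<psi> \<Longrightarrow> integrable lborel (\<lambda>\<tau>. \<psi> \<tau> * tcut \<tau> ^ n)"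
  using tcut_bounds by (intro integrable_bounded_mult[where B = 1]) (auto simp: less_imp_le power_le_one)

lemma integrable_mult_tcut: "integrable lborel \<psi> \<Longrightarrow> integrable lborel (\<lambda>\<tau>. \<psi> \<tau> * tcut \<tau>)"
  using integrable_mult_tcut_power[of \<psi> 1] by simp

lemma integrable_mult_exp_tcut: "integrable lborel \<psi> \<Longrightarrow> integrable lborel (\<lambda>\<tau>. \<psi> \<tau> * exp (- (tcut \<tau> * s)))"
proof (intro integrable_bounded_mult[where B = "exp \<bar>s\<bar>"])
  fix \<tau>
  have "- (tcut \<tau> * s) \<le> tcut \<tau> * \<bar>s\<bar>" using mult_left_mono[of "- s" "\<bar>s\<bar>" "tcut \<tau>"] tcut_bounds[of \<tau>] by simp
  also have "\<dots> \<le> \<bar>s\<bar>" using tcut_bounds[of \<tau>] by (simp add: mult_left_le_one_le)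
  finally show "\<bar>exp (- (tcut \<tau> * s))\<bar> \<le> exp \<bar>s\<bar>" by simp
qed auto

lemma abs_moment_le:
  assumes "integrable lborel \<psi>"
  shows "\<bar>moment \<psi> n\<bar> \<le> (\<integral>\<tau>. \<bar>\<psi> \<tau>\<bar> \<partial>lborel)"
proof -
  have "\<bar>moment \<psi> n\<bar> \<le> (\<integral>\<tau>. \<bar>\<psi> \<tau> * tcut \<tau> ^ n\<bar> \<partial>lborel)"
    unfolding moment_def by (rule integral_abs_bound)
  also have "\<dots> \<le> (\<integral>\<tau>. \<bar>\<psi> \<tau>\<bar> \<partial>lborel)"
  proof (rule integral_mono)
    fix \<tau>
    show "\<bar>\<psi> \<tau> * tcut \<tau> ^ n\<bar> \<le> \<bar>\<psi> \<tau>\<bar>"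
      using tcut_bounds[of \<tau>] by (simp add: abs_mult mult_left_le power_le_one less_imp_le)
  qed (use assms integrable_mult_tcut_power[OF assms] in auto)
  finally show ?thesis .
qed

text \<open>Because \<open>0 < tcut \<tau> < 1\<close>, the expanded exponential is dominated by
  \<open>\<bar>\<psi> \<tau>\<bar> * \<bar>s\<bar> ^ n / fact n\<close>, for \<open>s\<close> of
  either sign.\<close>

lemma Lcut_sums:
  assumes \<psi>: "integrable lborel \<psi>"
  shows "(\<lambda>n. (- 1) ^ n * moment \<psi> n / fact n * s ^ n) sums Lcut \<psi> s"
proof -
  define f where "f n \<tau> = \<psi> \<tau> * tcut \<tau> ^ n * ((- s) ^ n / fact n)" for n \<tau>
  have fi: "integrable lborel (f n)" for n
    unfolding f_def[abs_def] by (intro integrable_mult_left integrable_mult_tcut_power \<psi>)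
  have fn: "norm (f n \<tau>) \<le> \<bar>\<psi> \<tau>\<bar> * (\<bar>s\<bar> ^ n / fact n)" for n \<tau>
  proof -
    have "norm (f n \<tau>) = \<bar>\<psi> \<tau>\<bar> * tcut \<tau> ^ n * (\<bar>s\<bar> ^ n / fact n)"
      using tcut_bounds[of \<tau>] by (simp add: f_def abs_mult power_abs)
    also have "\<dots> \<le> \<bar>\<psi> \<tau>\<bar> * (\<bar>s\<bar> ^ n / fact n)"
      using tcut_bounds[of \<tau>] by (intro mult_right_mono mult_left_le power_le_one) auto
    finally show ?thesis .
  qed
  have se: "summable (\<lambda>n. \<bar>s\<bar> ^ n / fact n)" using summable_exp[of "\<bar>s\<bar>"] by (simp add: field_simps)
  have ae: "AE \<tau> in lborel. summable (\<lambda>n. norm (f n \<tau>))"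
  proof (intro AE_I2)
    fix \<tau>
    show "summable (\<lambda>n. norm (f n \<tau>))"
      by (rule summable_comparison_test'[OF summable_mult[OF se, of "\<bar>\<psi> \<tau>\<bar>"]]) (use fn in auto)
  qed
  have sm: "summable (\<lambda>n. \<integral>\<tau>. norm (f n \<tau>) \<partial>lborel)"
  proof (rule summable_comparison_test')
    show "summable (\<lambda>n. (\<integral>\<tau>. \<bar>\<psi> \<tau>\<bar> \<partial>lborel) * (\<bar>s\<bar> ^ n / fact n))" by (rule summable_mult[OF se])
    fix n
    have "(\<integral>\<tau>. norm (f n \<tau>) \<partial>lborel) \<le> (\<integral>\<tau>. \<bar>\<psi> \<tau>\<bar> * (\<bar>s\<bar> ^ n / fact n) \<partial>lborel)"
      using fi \<psi> fn by (intro integral_mono integrable_norm integrable_mult_left integrable_abs) auto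
    then show "norm (\<integral>\<tau>. norm (f n \<tau>) \<partial>lborel) \<le> (\<integral>\<tau>. \<bar>\<psi> \<tau>\<bar> \<partial>lborel) * (\<bar>s\<bar> ^ n / fact n)"
      by simp
  qed
  have "(\<lambda>n. integral\<^sup>L lborel (f n)) sums (\<integral>\<tau>. (\<Sum>n. f n \<tau>) \<partial>lborel)"
    by (rule sums_integral[OF fi ae sm])
  moreover have "(\<Sum>n. f n \<tau>) = \<psi> \<tau> * exp (- (tcut \<tau> * s))" for \<tau>
  proof -
    have "(\<lambda>n. (- (tcut \<tau> * s)) ^ n /\<^sub>R fact n) sums exp (- (tcut \<tau> * s))" by (rule exp_converges)
    moreover have "(- (tcut \<tau> * s)) ^ n = tcut \<tau> ^ n * (- s) ^ n" for n
      by (metis mult_minus_right power_mult_distrib)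
    ultimately have "(\<lambda>n. \<psi> \<tau> * (tcut \<tau> ^ n * (- s) ^ n /\<^sub>R fact n)) sums (\<psi> \<tau> * exp (- (tcut \<tau> * s)))"
      by (intro sums_mult) simp
    moreover have "\<psi> \<tau> * (tcut \<tau> ^ n * (- s) ^ n /\<^sub>R fact n) = f n \<tau>" for n
      by (simp add: f_def divide_inverse)
    ultimately have "(\<lambda>n. f n \<tau>) sums (\<psi> \<tau> * exp (- (tcut \<tau> * s)))" by simp
    then show ?thesis by (simp add: sums_iff)
  qed
  moreover have "integral\<^sup>L lborel (f n) = (- 1) ^ n * moment \<psi> n / fact n * s ^ n" for n
    by (simp add: f_def[abs_def] moment_def power_minus[of s])
  ultimately show ?thesis by (simp add: Lcut_def)
qed

text \<open>Read off from the power series: differentiation shifts the moments by one, which is the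
  effect of an extra factor \<open>tcut\<close>.\<close>

lemma Lcut_deriv:
  assumes \<psi>: "integrable lborel \<psi>"
  shows "(Lcut \<psi> has_real_derivative - Lcut (\<lambda>\<tau>. \<psi> \<tau> * tcut \<tau>) s) (at s)"
proof -
  define a where "a n = (- 1) ^ n * moment \<psi> n / fact n" for n
  have L: "Lcut \<psi> = (\<lambda>s. \<Sum>n. a n * s ^ n)"
    using Lcut_sums[OF \<psi>] by (auto simp: a_def sums_iff)
  have "(Lcut \<psi> has_real_derivative (\<Sum>n. diffs a n * s ^ n)) (at s)"
    unfolding L by (rule termdiffs_strong_converges_everywhere)
      (use Lcut_sums[OF \<psi>] in \<open>auto simp: a_def sums_iff\<close>)
  moreover have "(\<lambda>n. diffs a n * s ^ n) sums - Lcut (\<lambda>\<tau>. \<psi> \<tau> * tcut \<tau>) s"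
  proof -
    have "diffs a n * s ^ n = - ((- 1) ^ n * moment (\<lambda>\<tau>. \<psi> \<tau> * tcut \<tau>) n / fact n * s ^ n)" for n
    proof -
      have "moment (\<lambda>\<tau>. \<psi> \<tau> * tcut \<tau>) n = moment \<psi> (Suc n)" by (simp add: moment_def mult.assoc)
      then show ?thesis by (simp add: diffs_def a_def fact_Suc del: of_nat_Suc)
    qed
    then show ?thesis using sums_minus[OF Lcut_sums[OF integrable_mult_tcut[OF \<psi>]]] by simp
  qed
  ultimately show ?thesis by (simp add: sums_iff)
qed

lemma Lcut_continuous: "integrable lborel \<psi> \<Longrightarrow> continuous_on A (Lcut \<psi>)"
  by (intro continuous_at_imp_continuous_on) (auto intro: DERIV_isCont Lcut_deriv)

text \<open>Tonelli: the inner integral of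
  \<open>exp (- (tcut \<tau> * s)) * exp (- (x * s))\<close> over \<open>s \<ge> 0\<close> is
  \<open>1 / (x + tcut \<tau>)\<close>.\<close>

lemma has_laplace_Lcut:
  assumes \<psi>: "integrable lborel \<psi>" "\<And>\<tau>. \<psi> \<tau> \<ge> 0"
  shows "has_laplace 0 (Lcut \<psi>) (\<lambda>x. \<integral>\<tau>. \<psi> \<tau> / (x + tcut \<tau>) \<partial>lborel)"
  unfolding has_laplace_def
proof (intro conjI allI impI)
  show Lm[measurable]: "Lcut \<psi> \<in> borel_measurable borel"
    using Lcut_continuous[OF \<psi>(1)] by (rule borel_measurable_continuous_onI)
  have pm[measurable]: "\<psi> \<in> borel_measurable borel" using \<psi>(1) by auto
  fix x :: real assume x: "x > 0"
  have Lt0: "Lcut \<psi> s \<ge> 0" for s unfolding Lcut_def using \<psi>(2) by (intro Bochner_Integration.integral_nonneg) auto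
  have int: "integrable lborel (\<lambda>\<tau>. \<psi> \<tau> / (x + tcut \<tau>))"
    unfolding divide_inverse
  proof (rule integrable_bounded_mult[OF \<psi>(1), where B = "1 / x"])
    fix \<tau> show "\<bar>inverse (x + tcut \<tau>)\<bar> \<le> 1 / x"
      using tcut_bounds[of \<tau>] x by (auto simp: field_simps)
  qed auto
  have "(\<integral>\<^sup>+s. ennreal (indicator {0..} s * (Lcut \<psi> s * exp (- (x * s)))) \<partial>lborel) =
      (\<integral>\<^sup>+s. (\<integral>\<^sup>+\<tau>. ennreal (\<psi> \<tau> * (indicator {0..} s * (exp (- (tcut \<tau> * s)) * exp (- (x * s))))) \<partial>lborel) \<partial>lborel)"
  proof (rule nn_integral_cong)
    fix s :: real
    have "indicator {0..} s * (Lcut \<psi> s * exp (- (x * s))) = (\<integral>\<tau>. \<psi> \<tau> * exp (- (tcut \<tau> * s)) * (indicator {0..} s * exp (- (x * s))) \<partial>lborel)"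
      using integrable_mult_exp_tcut[OF \<psi>(1), of s] by (simp add: Lcut_def)
    moreover have "(\<integral>\<^sup>+\<tau>. ennreal (\<psi> \<tau> * exp (- (tcut \<tau> * s)) * (indicator {0..} s * exp (- (x * s)))) \<partial>lborel)
        = ennreal (\<integral>\<tau>. \<psi> \<tau> * exp (- (tcut \<tau> * s)) * (indicator {0..} s * exp (- (x * s))) \<partial>lborel)"
      using \<psi>(2) by (intro nn_integral_eq_integral integrable_mult_left integrable_mult_exp_tcut \<psi>(1)) auto
    ultimately show "ennreal (indicator {0..} s * (Lcut \<psi> s * exp (- (x * s)))) =
        (\<integral>\<^sup>+\<tau>. ennreal (\<psi> \<tau> * (indicator {0..} s * (exp (- (tcut \<tau> * s)) * exp (- (x * s))))) \<partial>lborel)"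
      by (simp add: mult_ac)
  qed
  also have "\<dots> = (\<integral>\<^sup>+\<tau>. (\<integral>\<^sup>+s. ennreal (\<psi> \<tau> * (indicator {0..} s * (exp (- (tcut \<tau> * s)) * exp (- (x * s))))) \<partial>lborel) \<partial>lborel)"
    by (rule lborel_pair.Fubini') measurable
  also have "\<dots> = (\<integral>\<^sup>+\<tau>. ennreal (\<psi> \<tau> / (x + tcut \<tau>)) \<partial>lborel)"
  proof (rule nn_integral_cong)
    fix \<tau>
    have "has_bochner_integral lborel (\<lambda>s. indicator {0..} s * (exp (- (tcut \<tau> * s)) * exp (- (x * s)))) (1 / (x + tcut \<tau>))"
      using has_laplace_exp[of "tcut \<tau>"] x tcut_bounds[of \<tau>] by (simp add: has_laplace_def)
    from has_bochner_integral_mult_right[OF this, of "\<psi> \<tau>"]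
    show "(\<integral>\<^sup>+s. ennreal (\<psi> \<tau> * (indicator {0..} s * (exp (- (tcut \<tau> * s)) * exp (- (x * s))))) \<partial>lborel) = ennreal (\<psi> \<tau> / (x + tcut \<tau>))"
      using \<psi>(2) by (subst nn_integral_eq_integral) (auto simp: has_bochner_integral_iff)
  qed
  also have "\<dots> = ennreal (\<integral>\<tau>. \<psi> \<tau> / (x + tcut \<tau>) \<partial>lborel)"
    using int \<psi>(2) x tcut_bounds by (intro nn_integral_eq_integral) (auto simp: add_nonneg_nonneg less_imp_le)
  finally show "has_bochner_integral lborel (\<lambda>s. indicator {0..} s * (Lcut \<psi> s * exp (- (x * s)))) (\<integral>\<tau>. \<psi> \<tau> / (x + tcut \<tau>) \<partial>lborel)"
    using Lt0 \<psi>(2) x tcut_bounds by (intro has_bochner_integral_nn_integral) (auto intro!: Bochner_Integration.integral_nonneg simp: add_nonneg_nonneg less_imp_le)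
qed

text \<open>Taken from the representation at \<open>x = 1\<close>, where the denominator
  \<open>1 + tcut t\<close> is at most 2.\<close>

lemma wcut_integrable: "integrable lborel wcut"
proof (rule Bochner_Integration.integrable_bound)
  have "integrable lborel (\<lambda>t. wcut t / (1 + tcut t))"
    using Fg_Stieltjes[OF zero_less_one] unfolding has_bochner_integral_iff by blast
  then show "integrable lborel (\<lambda>t. 2 * (wcut t / (1 + tcut t)))"
    by (rule integrable_mult_right)
  have "norm (wcut t) \<le> norm (2 * (wcut t / (1 + tcut t)))" for t
  proof -
    have "0 \<le> wcut t / (1 + tcut t)" using tcut_bounds[of t] wcut_pos[of t] by simp
    moreover have "wcut t = wcut t / (1 + tcut t) * (1 + tcut t)" using tcut_bounds[of t] by simp
    moreover have "wcut t / (1 + tcut t) * (1 + tcut t) \<le> wcut t / (1 + tcut t) * 2"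
      using calculation(1) tcut_bounds[of t] by (intro mult_left_mono) auto
    ultimately have "wcut t \<le> 2 * (wcut t / (1 + tcut t))" by linarith
    then show ?thesis using wcut_pos[of t] tcut_bounds[of t] by simp
  qed
  then show "AE t in lborel. norm (wcut t) \<le> norm (2 * (wcut t / (1 + tcut t)))" by simp
qed auto

section \<open>The densities of \<open>Fg\<close> and \<open>dg\<close>\<close>

definition ucut :: "real \<Rightarrow> real" where "ucut \<tau> = tcut \<tau> * (1 - tcut \<tau>)"

lemma ucut_pos: "ucut \<tau> > 0" using tcut_bounds[of \<tau>] by (simp add: ucut_def)

lemma ucut_measurable[measurable]: "ucut \<in> borel_measurable borel"
  unfolding ucut_def[abs_def] by measurable

lemma tcut_deriv: "(tcut has_real_derivative - ucut \<tau>) (at \<tau>)"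
proof -
  have "exp \<tau> + 1 \<noteq> 0" using exp_gt_zero[of \<tau>] by linarith
  then show ?thesis unfolding tcut_def[abs_def] ucut_def
    by (auto intro!: derivative_eq_intros simp: field_simps power2_eq_square)
qed

lemma tcut_limits: "(tcut \<longlongrightarrow> 0) at_top" "(tcut \<longlongrightarrow> 1) at_bot"
  unfolding tcut_def[abs_def] by real_asymp+

text \<open>Substitution \<open>t = tcut \<tau>\<close>, under which \<open>ucut \<tau>\<close> is the density of \<open>dt\<close> on the unit interval.\<close>

lemma ucut_substitution:
  assumes G: "\<And>t. 0 \<le> t \<Longrightarrow> t \<le> 1 \<Longrightarrow> (G has_real_derivative f t) (at t)"
    and f: "\<And>t. 0 < t \<Longrightarrow> t < 1 \<Longrightarrow> isCont f t" "\<And>t. 0 < t \<Longrightarrow> t < 1 \<Longrightarrow> f t \<ge> 0"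
  shows "has_bochner_integral lborel (\<lambda>\<tau>. ucut \<tau> * f (tcut \<tau>)) (G 1 - G 0)"
proof -
  let ?F = "\<lambda>\<tau>. - G (tcut \<tau>)" and ?f = "\<lambda>\<tau>. ucut \<tau> * f (tcut \<tau>)"
  have sc: "isCont ucut \<tau>" "isCont tcut \<tau>" for \<tau>
  proof -
    show "isCont tcut \<tau>" using tcut_deriv by (rule DERIV_isCont)
    then show "isCont ucut \<tau>" unfolding ucut_def[abs_def] by (intro continuous_intros)
  qed
  have F: "DERIV ?F \<tau> :> ?f \<tau>" for \<tau>
    using DERIV_minus[OF DERIV_chain2[OF G tcut_deriv]] tcut_bounds[of \<tau>] by (simp add: mult.commute less_imp_le)
  have fc: "isCont ?f \<tau>" for \<tau>
    using tcut_bounds[of \<tau>] by (intro continuous_mult sc isCont_o2[OF sc(2)] f(1)) auto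
  have l1: "((?F \<circ> real_of_ereal) \<longlongrightarrow> - G 1) (at_right (- \<infinity>))"
    unfolding ereal_tendsto_simps
    by (intro tendsto_minus isCont_tendsto_compose[OF DERIV_isCont[OF G]] tcut_limits) auto
  have l2: "((?F \<circ> real_of_ereal) \<longlongrightarrow> - G 0) (at_left \<infinity>)"
    unfolding ereal_tendsto_simps
    by (intro tendsto_minus isCont_tendsto_compose[OF DERIV_isCont[OF G]] tcut_limits) auto
  have nn: "AE x in lborel. - \<infinity> < ereal x \<longrightarrow> ereal x < \<infinity> \<longrightarrow> 0 \<le> ?f x"
    using ucut_pos tcut_bounds f(2) by (intro AE_I2) (auto simp: less_imp_le)
  have "set_integrable lborel (einterval (- \<infinity>) \<infinity>) ?f"
    "(LBINT x=- \<infinity>..\<infinity>. ?f x) = - G 0 - - G 1"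
    by (rule interval_integral_FTC_nonneg[where F = ?F and A = "- G 1" and B = "- G 0"]; (use F fc nn l1 l2 in auto)[1])+
  then show ?thesis
    by (auto simp: has_bochner_integral_iff interval_lebesgue_integral_def set_integrable_def set_lebesgue_integral_def einterval_def)
qed

lemma ucut_moment: "has_bochner_integral lborel (\<lambda>\<tau>. ucut \<tau> * tcut \<tau> ^ n) (1 / real (Suc n))"
proof -
  have "has_bochner_integral lborel (\<lambda>\<tau>. ucut \<tau> * tcut \<tau> ^ n) (1 ^ Suc n / real (Suc n) - 0 ^ Suc n / real (Suc n))"
    by (rule ucut_substitution[where G = "\<lambda>t. t ^ Suc n / real (Suc n)"])
       (auto intro!: derivative_eq_intros simp del: power_Suc)
  then show ?thesis by simp
qed

lemma ucut_integrable: "integrable lborel ucut" and ucut_integral: "integral\<^sup>L lborel ucut = 1"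
  using ucut_moment[of 0] by (auto simp: has_bochner_integral_iff)

lemma dg_Stieltjes:
  assumes "x > 0"
  shows "(\<integral>\<tau>. ucut \<tau> / (x + tcut \<tau>) \<partial>lborel) = ln (1 + 1 / x)"
proof -
  have "has_bochner_integral lborel (\<lambda>\<tau>. ucut \<tau> * (1 / (x + tcut \<tau>))) (ln (x + 1) - ln (x + 0))"
    by (rule ucut_substitution[where G = "\<lambda>t. ln (x + t)" and f = "\<lambda>t. 1 / (x + t)"])
       (use assms in \<open>auto intro!: derivative_eq_intros continuous_intros\<close>)
  moreover have "ln (x + 1) - ln (x + 0) = ln (1 + 1 / x)"
  proof -
    have "1 + 1 / x = (x + 1) / x" using assms by (simp add: field_simps)
    then show ?thesis using assms by (simp add: ln_div)
  qed
  ultimately show ?thesis by (simp add: has_bochner_integral_iff)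
qed

text \<open>\<open>exp (- s)\<close> is the density of \<open>1 / (x + 1)\<close>, which enters
  \<open>Fg\<close> with a plus sign and \<open>dg x = ln (1 + 1 / x) - 1 / (x + 1)\<close> with a
  minus sign.\<close>

definition rhoF :: "real \<Rightarrow> real" where "rhoF s = exp (- s) + Lcut wcut s"
definition rhog :: "real \<Rightarrow> real" where "rhog s = Lcut ucut s - exp (- s)"

lemma has_laplace_rhoF: "has_laplace 0 rhoF Fg"
proof -
  have e: "has_laplace 0 (\<lambda>s. exp (- s)) (\<lambda>x. 1 / (x + 1))"
    using has_laplace_restrict[OF has_laplace_exp[of 1]] by simp
  have L: "has_laplace 0 rhoF (\<lambda>x. 1 / (x + 1) + (\<integral>\<tau>. wcut \<tau> / (x + tcut \<tau>) \<partial>lborel))"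
    unfolding rhoF_def[abs_def] using wcut_pos
    by (intro has_laplace_add e has_laplace_Lcut wcut_integrable) (auto simp: less_imp_le)
  have eq: "1 / (x + 1) + (\<integral>\<tau>. wcut \<tau> / (x + tcut \<tau>) \<partial>lborel) = Fg x" if "x > 0" for x
    using Fg_Stieltjes[OF that] by (simp add: has_bochner_integral_iff)
  show ?thesis by (rule iffD1[OF has_laplace_cong, OF eq L])
qed

lemma has_laplace_rhog: "has_laplace 0 rhog dg"
proof -
  have e: "has_laplace 0 (\<lambda>s. exp (- s)) (\<lambda>x. 1 / (x + 1))"
    using has_laplace_restrict[OF has_laplace_exp[of 1]] by simp
  have L: "has_laplace 0 rhog (\<lambda>x. (\<integral>\<tau>. ucut \<tau> / (x + tcut \<tau>) \<partial>lborel) - 1 / (x + 1))"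
    unfolding rhog_def[abs_def] using ucut_pos
    by (intro has_laplace_diff e has_laplace_Lcut ucut_integrable) (auto simp: less_imp_le)
  have eq: "(\<integral>\<tau>. ucut \<tau> / (x + tcut \<tau>) \<partial>lborel) - 1 / (x + 1) = dg x" if "x > 0" for x
    using dg_Stieltjes[OF that] by (simp add: dg_def)
  show ?thesis by (rule iffD1[OF has_laplace_cong, OF eq L])
qed

text \<open>A vanishing integral would make \<open>f\<close> zero almost everywhere. The exceptional
  point accommodates a weight that vanishes where both of its factors change sign.\<close>

lemma integral_pos_lborel_off_point:
  fixes f :: "real \<Rightarrow> real"
  assumes "integrable lborel f" "\<And>x. x \<noteq> c \<Longrightarrow> f x > 0" "f c \<ge> 0"
  shows "integral\<^sup>L lborel f > 0"
proof -
  have f0: "0 \<le> f x" for x using assms(2)[of x] assms(3) by (cases "x = c") auto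
  have "integral\<^sup>L lborel f \<ge> 0" by (rule Bochner_Integration.integral_nonneg) (rule f0)
  moreover have "integral\<^sup>L lborel f \<noteq> 0"
  proof
    assume "integral\<^sup>L lborel f = 0"
    then have "AE x in lborel. f x = 0"
      using integral_nonneg_eq_0_iff_AE[OF assms(1)] f0 by simp
    moreover have "AE x in lborel. x \<noteq> c" by (rule AE_lborel_singleton)
    ultimately have "AE x::real in lborel. False"
      by eventually_elim (use assms(2) in force)
    then show False by (simp add: AE_iff_null null_sets_def)
  qed
  ultimately show ?thesis by linarith
qed

lemma integral_pos_lborel:
  fixes f :: "real \<Rightarrow> real"
  assumes "integrable lborel f" "\<And>x. f x > 0"
  shows "integral\<^sup>L lborel f > 0"
  using integral_pos_lborel_off_point[OF assms(1), of 0] assms(2) less_imp_le by blast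

lemma rhoF_pos: "rhoF s > 0"
  unfolding rhoF_def Lcut_def using wcut_pos
  by (intro add_pos_pos integral_pos_lborel integrable_mult_exp_tcut wcut_integrable) auto

text \<open>\<open>ucut\<close> has total mass 1, so \<open>exp (- s)\<close> moves under the
  integral; with \<open>tcut < 1\<close> the integrand is then visibly positive for
  \<open>s > 0\<close>.\<close>

lemma rhog_eq: "rhog s = (\<integral>\<tau>. ucut \<tau> * (exp (- (tcut \<tau> * s)) - exp (- s)) \<partial>lborel)"
  using integrable_mult_exp_tcut[OF ucut_integrable, of s] ucut_integrable ucut_integral
  by (simp add: rhog_def Lcut_def right_diff_distrib)

lemma rhog_pos: "s > 0 \<Longrightarrow> rhog s > 0"
  unfolding rhog_eq
proof (rule integral_pos_lborel)
  show "integrable lborel (\<lambda>\<tau>. ucut \<tau> * (exp (- (tcut \<tau> * s)) - exp (- s)))"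
    using integrable_mult_exp_tcut[OF ucut_integrable, of s] ucut_integrable by (simp add: right_diff_distrib)
  show "ucut \<tau> * (exp (- (tcut \<tau> * s)) - exp (- s)) > 0" if "s > 0" for \<tau>
    using that ucut_pos[of \<tau>] tcut_bounds[of \<tau>] by (intro mult_pos_pos) auto
qed

lemma rhog_le_1: "s \<ge> 0 \<Longrightarrow> rhog s \<le> 1"
proof -
  assume s: "s \<ge> 0"
  have "Lcut ucut s \<le> integral\<^sup>L lborel ucut" unfolding Lcut_def
  proof (rule integral_mono[OF integrable_mult_exp_tcut[OF ucut_integrable] ucut_integrable])
    fix \<tau>
    show "ucut \<tau> * exp (- (tcut \<tau> * s)) \<le> ucut \<tau>"
      using ucut_pos[of \<tau>] tcut_bounds[of \<tau>] s by (simp add: mult_left_le)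
  qed
  then show ?thesis using ucut_integral exp_gt_zero[of "-s"] unfolding rhog_def by linarith
qed

section \<open>Quasi-convexity of the density\<close>

text \<open>The quotient \<open>ucut / wcut\<close>, the reciprocal of the weight with respect to
  \<open>dt\<close>. For \<open>a > 0\<close> the sign of \<open>wcut - a * ucut\<close> is that of
  \<open>1 / a - wratio\<close>.\<close>

definition wratio :: "real \<Rightarrow> real" where
  "wratio \<tau> = exp (2 * \<tau>) / (1 + exp \<tau>) ^ 3 * ((\<tau> - 1 - exp (- \<tau>))\<^sup>2 + pi\<^sup>2)"

lemma ucut_eq_wratio_wcut: "ucut \<tau> = wratio \<tau> * wcut \<tau>"
proof -
  define y where "y = exp \<tau>"
  have y: "y > 0" by (simp add: y_def)
  define D where "D = (\<tau> - 1 - exp (- \<tau>))\<^sup>2 + pi\<^sup>2"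
  have D: "D > 0" unfolding D_def by (intro add_nonneg_pos) auto
  have "exp (2 * \<tau>) = y\<^sup>2" unfolding y_def by (simp add: exp_double)
  moreover have "exp (- \<tau>) = 1 / y" unfolding y_def by (simp add: exp_minus inverse_eq_divide)
  ultimately have "wratio \<tau> = y\<^sup>2 / (1 + y) ^ 3 * D" "wcut \<tau> = (1 + 1 / y) / D"
    unfolding wratio_def wcut_def D_def y_def by simp_all
  then have "wratio \<tau> * wcut \<tau> = y\<^sup>2 / (1 + y) ^ 3 * (1 + 1 / y)" using D by simp
  also have "1 + 1 / y = (1 + y) / y" using y by (simp add: field_simps)
  also have "y\<^sup>2 / (1 + y) ^ 3 * ((1 + y) / y) = y / (1 + y)\<^sup>2" using y by (simp add: power2_eq_square power3_eq_cube)
  also have "\<dots> = ucut \<tau>"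
  proof -
    have "1 - 1 / (y + 1) = y / (y + 1)" using y by (simp add: field_simps)
    then show ?thesis unfolding ucut_def tcut_def y_def[symmetric] by (simp add: power2_eq_square add.commute)
  qed
  finally show ?thesis by simp
qed

lemma pi_squared_gt: "pi\<^sup>2 > 9"
  using power_strict_mono[of 3 pi 2] pi_gt3 by simp

text \<open>Let \<open>y = exp \<tau>\<close>. For \<open>\<tau> \<le> 0\<close> the last factor
  exceeds \<open>(1 + 1 / y)\<^sup>2\<close>, which leaves \<open>1 / (1 + y)\<close>. For
  \<open>1 \<le> y \<le> 9\<close> it is replaced by 9, and
  \<open>18 * y\<^sup>2 > (1 + y) ^ 3\<close> remains. The cut at \<open>y = 9\<close> suits both
  this cubic and the monotonicity beyond it.\<close>

lemma wratio_gt_half: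
  assumes "\<tau> \<le> ln 9"
  shows "wratio \<tau> > 1 / 2"
proof -
  define y where "y = exp \<tau>"
  have y: "y > 0" by (simp add: y_def)
  have y9: "y \<le> 9" using assms by (simp add: y_def ln_ge_iff flip: exp_le_cancel_iff[of \<tau>])
  define L where "L = \<tau> - 1 - exp (- \<tau>)"
  have e: "exp (2 * \<tau>) = y\<^sup>2" unfolding y_def by (simp add: exp_double)
  have wratio: "wratio \<tau> = y\<^sup>2 / (1 + y) ^ 3 * (L\<^sup>2 + pi\<^sup>2)" unfolding wratio_def e L_def y_def by simp
  show ?thesis
  proof (cases "\<tau> \<le> 0")
    case True
    then have y1: "y \<le> 1" by (simp add: y_def)
    have "exp (- \<tau>) = 1 / y" unfolding y_def by (simp add: exp_minus inverse_eq_divide)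
    then have "1 + 1 / y \<le> - L" using True by (simp add: L_def)
    then have "(1 + 1 / y)\<^sup>2 \<le> (- L)\<^sup>2" using y by (intro power_mono) auto
    then have "(1 + 1 / y)\<^sup>2 < L\<^sup>2 + pi\<^sup>2" using pi_squared_gt by simp
    then have "y\<^sup>2 / (1 + y) ^ 3 * (1 + 1 / y)\<^sup>2 < wratio \<tau>"
      unfolding wratio using y by (intro mult_strict_left_mono) auto
    moreover have "y\<^sup>2 / (1 + y) ^ 3 * (1 + 1 / y)\<^sup>2 = 1 / (1 + y)"
    proof -
      have "1 + 1 / y = (1 + y) / y" using y by (simp add: field_simps)
      then show ?thesis using y by (simp add: power_divide power2_eq_square power3_eq_cube)
    qed
    moreover have "1 / (1 + y) \<ge> 1 / 2" using y y1 by (intro divide_left_mono) auto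
    ultimately show ?thesis by linarith
  next
    case False
    then have y1: "y \<ge> 1" by (simp add: y_def)
    have "18 * y\<^sup>2 - (1 + y) ^ 3 \<ge> 8"
    proof -
      have "18 * y\<^sup>2 - (1 + y) ^ 3 - 10 = (y - 1) * ((9 - y) * (y - 1) + 4 * y + 20)"
        by (simp add: algebra_simps power2_eq_square power3_eq_cube)
      moreover have "\<dots> \<ge> 0" using y1 y9 by (intro mult_nonneg_nonneg add_nonneg_nonneg) auto
      ultimately show ?thesis by linarith
    qed
    then have "(1 + y) ^ 3 < 18 * y\<^sup>2" by linarith
    then have "1 / 18 < y\<^sup>2 / (1 + y) ^ 3" using y by (simp add: field_simps)
    moreover have "9 \<le> L\<^sup>2 + pi\<^sup>2" using pi_squared_gt zero_le_power2[of L] by linarith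
    ultimately have "1 / 18 * 9 < y\<^sup>2 / (1 + y) ^ 3 * (L\<^sup>2 + pi\<^sup>2)"
      by (intro mult_less_le_imp_less) auto
    then show ?thesis unfolding wratio by simp
  qed
qed

text \<open>In the logarithmic derivative, \<open>2 - 3 * exp \<tau> / (1 + exp \<tau>)\<close> is
  at most \<open>- 7 / 10\<close>, and the other term is at most \<open>10 / 27\<close> by
  \<open>6 * L \<le> L\<^sup>2 + 9\<close> and \<open>pi\<^sup>2 > 9\<close>.\<close>

lemma wratio_strict_antimono:
  assumes "ln 9 \<le> \<tau>1" "\<tau>1 < \<tau>2"
  shows "wratio \<tau>2 < wratio \<tau>1"
proof -
  define L where "L \<tau> = \<tau> - 1 - exp (- \<tau>)" for \<tau> :: real
  define l where "l \<tau> = 2 * \<tau> - 3 * ln (1 + exp \<tau>) + ln ((L \<tau>)\<^sup>2 + pi\<^sup>2)" for \<tau>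
  have D: "(L \<tau>)\<^sup>2 + pi\<^sup>2 > 0" for \<tau> by (intro add_nonneg_pos) auto
  have ml: "wratio \<tau> = exp (l \<tau>)" for \<tau>
  proof -
    have "exp (3 * ln (1 + exp \<tau>)) = (1 + exp \<tau>) ^ 3"
      using exp_of_nat_mult[of 3 "ln (1 + exp \<tau>)"] by (simp add: add_pos_pos)
    then show ?thesis using D[of \<tau>] by (simp add: wratio_def l_def L_def exp_add exp_diff)
  qed
  have "l \<tau>2 < l \<tau>1"
  proof (rule DERIV_neg_imp_decreasing[OF assms(2)])
    fix \<tau> assume "\<tau>1 \<le> \<tau>" "\<tau> \<le> \<tau>2"
    then have "ln 9 \<le> \<tau>" using assms by linarith
    have "9 = exp (ln (9::real))" by simp
    also have "\<dots> \<le> exp \<tau>" using \<open>ln 9 \<le> \<tau>\<close> by (simp only: exp_le_cancel_iff)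
    finally have y9: "exp \<tau> \<ge> 9" .
    have dL: "(L has_real_derivative 1 + exp (- \<tau>)) (at \<tau>)"
      unfolding L_def[abs_def] by (auto intro!: derivative_eq_intros)
    have d1: "((\<lambda>\<tau>. (L \<tau>)\<^sup>2 + pi\<^sup>2) has_real_derivative 2 * L \<tau> * (1 + exp (- \<tau>))) (at \<tau>)"
      by (auto intro!: derivative_eq_intros dL)
    have d2: "((\<lambda>\<tau>. 1 + exp \<tau>) has_real_derivative exp \<tau>) (at \<tau>)"
      by (auto intro!: derivative_eq_intros)
    have p: "1 + exp \<tau> > 0" by (simp add: add_pos_pos)
    have d: "(l has_real_derivative (2 - 3 * (exp \<tau> / (1 + exp \<tau>)) + 2 * L \<tau> / ((L \<tau>)\<^sup>2 + pi\<^sup>2) * (1 + exp (- \<tau>)))) (at \<tau>)"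
      unfolding l_def[abs_def]
      using DERIV_add[OF DERIV_diff[OF DERIV_cmult[OF DERIV_ident, of 2]
            DERIV_cmult[OF DERIV_chain2[OF DERIV_ln_divide[OF p] d2], of 3]]
          DERIV_chain2[OF DERIV_ln_divide[OF D] d1]]
      by simp
    have "exp \<tau> / (1 + exp \<tau>) \<ge> 9 / 10" using y9 by (simp add: field_simps)
    moreover have "2 * L \<tau> / ((L \<tau>)\<^sup>2 + pi\<^sup>2) \<le> 1 / 3"
    proof -
      have "6 * L \<tau> \<le> (L \<tau>)\<^sup>2 + 9" using zero_le_power2[of "L \<tau> - 3"] by (simp add: power2_diff)
      then show ?thesis using pi_squared_gt D[of \<tau>] by (simp add: field_simps)
    qed
    moreover have "1 + exp (- \<tau>) \<le> 10 / 9" using y9 by (simp add: exp_minus field_simps)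
    ultimately have "2 * L \<tau> / ((L \<tau>)\<^sup>2 + pi\<^sup>2) * (1 + exp (- \<tau>)) \<le> 1 / 3 * (10 / 9)"
      by (intro order_trans[OF mult_right_mono mult_left_mono]) auto
    then have "2 - 3 * (exp \<tau> / (1 + exp \<tau>)) + 2 * L \<tau> / ((L \<tau>)\<^sup>2 + pi\<^sup>2) * (1 + exp (- \<tau>)) < 0"
      using \<open>exp \<tau> / (1 + exp \<tau>) \<ge> 9 / 10\<close> by linarith
    with d show "\<exists>y. (l has_real_derivative y) (at \<tau>) \<and> y < 0" by blast
  qed
  then show ?thesis by (simp add: ml)
qed

lemma wratio_continuous: "continuous_on A wratio"
proof -
  have "1 + exp \<tau> \<noteq> 0" for \<tau> :: real using exp_gt_zero[of \<tau>] by linarith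
  then show ?thesis unfolding wratio_def by (intro continuous_intros) auto
qed

definition wrho :: "real \<Rightarrow> real \<Rightarrow> real" where "wrho a \<tau> = wcut \<tau> - a * ucut \<tau>"

text \<open>\<open>a \<ge> 2\<close> puts the level \<open>1 / a\<close> at or below the bound
  \<open>1 / 2\<close> valid up to \<open>ln 9\<close>. Beyond that \<open>wratio\<close> decreases
  strictly to 0, so the level is crossed exactly once.\<close>

lemma wrho_sign_change:
  assumes a: "a \<ge> 2"
  obtains \<tau>0 where "\<And>\<tau>. \<tau> < \<tau>0 \<Longrightarrow> wrho a \<tau> < 0" "\<And>\<tau>. \<tau> > \<tau>0 \<Longrightarrow> wrho a \<tau> > 0"
proof -
  have "(wratio \<longlongrightarrow> 0) at_top" unfolding wratio_def by real_asymp
  then have "eventually (\<lambda>\<tau>. wratio \<tau> < 1 / a) at_top" using a by (intro order_tendstoD(2)) auto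
  then obtain T where T: "\<And>\<tau>. \<tau> \<ge> T \<Longrightarrow> wratio \<tau> < 1 / a" by (auto simp: eventually_at_top_linorder)
  have a2: "1 / a \<le> 1 / 2" using a by (intro divide_left_mono) auto
  have "\<exists>\<tau>\<ge>ln 9. \<tau> \<le> max T (ln 9) \<and> wratio \<tau> = 1 / a"
    using T[of "max T (ln 9)"] wratio_gt_half[of "ln 9"] a2
    by (intro IVT2') (auto intro: wratio_continuous)
  then obtain \<tau>0 where \<tau>0: "\<tau>0 \<ge> ln 9" "wratio \<tau>0 = 1 / a" by blast
  have w: "wrho a \<tau> = wcut \<tau> * a * (1 / a - wratio \<tau>)" for \<tau>
    using a by (simp add: wrho_def ucut_eq_wratio_wcut algebra_simps)
  show ?thesis
  proof (rule that[of \<tau>0])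
    fix \<tau> assume "\<tau> < \<tau>0"
    then have "wratio \<tau> > 1 / a" using wratio_gt_half[of \<tau>] a2 wratio_strict_antimono[of \<tau> \<tau>0] \<tau>0 by (cases "\<tau> \<le> ln 9") auto
    then show "wrho a \<tau> < 0" unfolding w using a wcut_pos[of \<tau>] by (intro mult_pos_neg) auto
  next
    fix \<tau> assume "\<tau> > \<tau>0"
    then have "wratio \<tau> < 1 / a" using wratio_strict_antimono[of \<tau>0 \<tau>] \<tau>0 by auto
    then show "wrho a \<tau> > 0" unfolding w using a wcut_pos[of \<tau>] by (intro mult_pos_pos) auto
  qed
qed

definition rho :: "real \<Rightarrow> real \<Rightarrow> real" where "rho a s = rhoF s - a * rhog s"

text \<open>This is \<open>rho\<close> plus its derivative, that is \<open>exp (- s)\<close> times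
  the derivative of \<open>exp s * rho a s\<close>. The term \<open>(1 + a) * exp (- s)\<close> of
  \<open>rho\<close> cancels, and \<open>wrho a\<close> acquires the factor
  \<open>1 - tcut\<close>.\<close>

definition rhop :: "real \<Rightarrow> real \<Rightarrow> real" where "rhop a s = Lcut (\<lambda>\<tau>. wrho a \<tau> * (1 - tcut \<tau>)) s"

lemma wrho_integrable: "integrable lborel (wrho a)"
  unfolding wrho_def[abs_def] using wcut_integrable ucut_integrable by auto

lemma wrho_integrable1: "integrable lborel (\<lambda>\<tau>. wrho a \<tau> * (1 - tcut \<tau>))"
  using wrho_integrable integrable_mult_tcut[OF wrho_integrable] by (simp add: right_diff_distrib)

lemma Lcut_diff:
  assumes "integrable lborel f" "integrable lborel g"
  shows "Lcut (\<lambda>\<tau>. f \<tau> - g \<tau>) s = Lcut f s - Lcut g s"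
  unfolding Lcut_def left_diff_distrib
  by (rule Bochner_Integration.integral_diff[OF integrable_mult_exp_tcut[OF assms(1)] integrable_mult_exp_tcut[OF assms(2)]])

lemma Lcut_cmult: "Lcut (\<lambda>\<tau>. c * f \<tau>) s = c * Lcut f s"
  unfolding Lcut_def by (simp add: mult.assoc)

lemma rho_eq: "rho a s = (1 + a) * exp (- s) + Lcut (wrho a) s"
proof -
  have "Lcut (wrho a) s = Lcut wcut s - Lcut (\<lambda>\<tau>. a * ucut \<tau>) s"
    unfolding wrho_def[abs_def] by (intro Lcut_diff wcut_integrable integrable_mult_right ucut_integrable)
  then show ?thesis by (simp add: rho_def rhoF_def rhog_def Lcut_cmult algebra_simps)
qed

lemma rhop_eq: "rhop a s = Lcut (wrho a) s - Lcut (\<lambda>\<tau>. wrho a \<tau> * tcut \<tau>) s"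
proof -
  have "(\<lambda>\<tau>. wrho a \<tau> * (1 - tcut \<tau>)) = (\<lambda>\<tau>. wrho a \<tau> - wrho a \<tau> * tcut \<tau>)" by (simp add: right_diff_distrib)
  then show ?thesis unfolding rhop_def using Lcut_diff[OF wrho_integrable integrable_mult_tcut[OF wrho_integrable]] by simp
qed

lemma rho_deriv: "(rho a has_real_derivative rhop a s - rho a s) (at s)"
proof -
  have "((\<lambda>s. (1 + a) * exp (- s) + Lcut (wrho a) s) has_real_derivative
      - ((1 + a) * exp (- s)) + - Lcut (\<lambda>\<tau>. wrho a \<tau> * tcut \<tau>) s) (at s)"
    by (rule DERIV_add[OF _ Lcut_deriv[OF wrho_integrable]]) (auto intro!: derivative_eq_intros)
  then have "((\<lambda>s. (1 + a) * exp (- s) + Lcut (wrho a) s) has_real_derivative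
      Lcut (wrho a) s - Lcut (\<lambda>\<tau>. wrho a \<tau> * tcut \<tau>) s - ((1 + a) * exp (- s) + Lcut (wrho a) s)) (at s)"
    by (rule DERIV_cong) simp
  then show ?thesis unfolding rho_eq[abs_def] rhop_eq .
qed

definition rhoe :: "real \<Rightarrow> real \<Rightarrow> real" where "rhoe a s = exp s * rho a s"

lemma rhoe_deriv: "(rhoe a has_real_derivative exp s * rhop a s) (at s)"
  unfolding rhoe_def[abs_def] by (auto intro!: derivative_eq_intros rho_deriv simp: algebra_simps)

text \<open>
  Since \<open>wrho a\<close> changes sign once, \<open>exp (t0 * s) * rhop a s\<close> is strictly increasing for a
  suitable \<open>t0\<close>; hence \<open>rhoe a\<close> first decreases and then increases.
\<close>

lemma rhop_increasing:
  assumes a: "a \<ge> 2"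
  obtains t0 Q where "0 < t0" "t0 < 1"
    "\<And>s. ((\<lambda>s. exp (t0 * s) * rhop a s) has_real_derivative exp (t0 * s) * Q s) (at s)"
    "\<And>s. Q s > 0" "continuous_on UNIV Q"
proof -
  obtain \<tau>0 where \<tau>0: "\<And>\<tau>. \<tau> < \<tau>0 \<Longrightarrow> wrho a \<tau> < 0" "\<And>\<tau>. \<tau> > \<tau>0 \<Longrightarrow> wrho a \<tau> > 0"
    using wrho_sign_change[OF a] by blast
  define t0 where "t0 = tcut \<tau>0"
  \<comment> \<open>Differentiating \<open>exp (t0 * s) * rhop a s\<close> multiplies the weight by
    \<open>t0 - tcut \<tau>\<close>. This factor and \<open>wrho a\<close> both pass from negative
    to positive at \<open>\<tau>0\<close>, so the product is positive elsewhere.\<close>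
  define \<psi> where "\<psi> \<tau> = t0 * (wrho a \<tau> * (1 - tcut \<tau>)) - wrho a \<tau> * (1 - tcut \<tau>) * tcut \<tau>" for \<tau>
  have \<psi>i: "integrable lborel \<psi>" unfolding \<psi>_def[abs_def]
    using wrho_integrable1 integrable_mult_tcut[OF wrho_integrable1] by auto
  have \<psi>e: "\<psi> \<tau> = (t0 - tcut \<tau>) * wrho a \<tau> * (1 - tcut \<tau>)" for \<tau> by (simp add: \<psi>_def algebra_simps)
  have tcut_mono: "tcut x > tcut y" if "x < y" for x y
    unfolding tcut_def using that by (intro divide_strict_left_mono) (auto simp: add_pos_pos)
  have \<psi>p: "\<psi> \<tau> > 0" if "\<tau> \<noteq> \<tau>0" for \<tau>
  proof (cases "\<tau> < \<tau>0")
    case True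
    then have "t0 - tcut \<tau> < 0" using tcut_mono by (simp add: t0_def)
    then show ?thesis unfolding \<psi>e using \<tau>0(1)[OF True] tcut_bounds[of \<tau>] by (intro mult_pos_pos mult_neg_neg) auto
  next
    case False
    then have "\<tau> > \<tau>0" using that by simp
    then show ?thesis unfolding \<psi>e using \<tau>0(2) tcut_mono tcut_bounds[of \<tau>] by (intro mult_pos_pos) (auto simp: t0_def)
  qed
  have "Lcut \<psi> s > 0" for s unfolding Lcut_def
  proof (rule integral_pos_lborel_off_point[where c = \<tau>0])
    show "0 < \<psi> \<tau> * exp (- (tcut \<tau> * s))" if "\<tau> \<noteq> \<tau>0" for \<tau> using \<psi>p[OF that] by simp
    show "0 \<le> \<psi> \<tau>0 * exp (- (tcut \<tau>0 * s))" by (simp add: \<psi>e t0_def)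
  qed (rule integrable_mult_exp_tcut[OF \<psi>i])
  moreover have "((\<lambda>s. exp (t0 * s) * rhop a s) has_real_derivative exp (t0 * s) * Lcut \<psi> s) (at s)" for s
  proof -
    define R where "R = Lcut (\<lambda>\<tau>. wrho a \<tau> * (1 - tcut \<tau>) * tcut \<tau>) s"
    have L: "Lcut \<psi> s = t0 * rhop a s - R"
      unfolding \<psi>_def rhop_def R_def Lcut_cmult[symmetric]
      by (intro Lcut_diff integrable_mult_right integrable_mult_tcut wrho_integrable1)
    have dp: "(rhop a has_real_derivative - R) (at s)"
      unfolding rhop_def[abs_def] R_def by (rule Lcut_deriv[OF wrho_integrable1])
    have "((\<lambda>s. exp (t0 * s)) has_real_derivative t0 * exp (t0 * s)) (at s)"
      by (auto intro!: derivative_eq_intros)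
    from DERIV_mult[OF this dp]
    have "((\<lambda>s. exp (t0 * s) * rhop a s) has_real_derivative t0 * exp (t0 * s) * rhop a s + - R * exp (t0 * s)) (at s)" .
    then show ?thesis by (rule DERIV_cong) (simp add: L algebra_simps)
  qed
  moreover have "continuous_on UNIV (Lcut \<psi>)" by (rule Lcut_continuous[OF \<psi>i])
  ultimately show ?thesis using that[of t0 "Lcut \<psi>"] tcut_bounds[of \<tau>0] by (simp add: t0_def)
qed

lemma rhop_pos_after:
  assumes a: "a \<ge> 2" and "rhop a s1 \<ge> 0" "s1 < s2"
  shows "rhop a s2 > 0"
proof -
  obtain t0 Q where Q: "\<And>s. ((\<lambda>s. exp (t0 * s) * rhop a s) has_real_derivative exp (t0 * s) * Q s) (at s)"
    "\<And>s. Q s > 0" using rhop_increasing[OF a] by metis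
  have "exp (t0 * s1) * rhop a s1 < exp (t0 * s2) * rhop a s2"
    by (rule DERIV_pos_imp_increasing[OF assms(3)]) (use Q in \<open>auto intro!: exI mult_pos_pos\<close>)
  moreover have "0 \<le> exp (t0 * s1) * rhop a s1" using assms(2) by simp
  ultimately have "0 < exp (t0 * s2) * rhop a s2" by linarith
  then show ?thesis by (simp add: zero_less_mult_iff)
qed

lemma rhop_neg_before: "a \<ge> 2 \<Longrightarrow> rhop a s2 \<le> 0 \<Longrightarrow> s1 < s2 \<Longrightarrow> rhop a s1 < 0"
  using rhop_pos_after[of a s1 s2] by linarith

lemma rhoe_min:
  assumes a: "a \<ge> 2" and z: "rhop a z = 0"
  shows "rhoe a z \<le> rhoe a s"
proof (cases "s \<le> z")
  case True
  show ?thesis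
  proof (rule DERIV_nonpos_imp_nonincreasing[OF True, where f = "rhoe a"])
    fix x assume "s \<le> x" "x \<le> z"
    then have "rhop a x \<le> 0" using rhop_neg_before[OF a, of z x] z by (cases "x = z") auto
    then show "\<exists>y. (rhoe a has_real_derivative y) (at x) \<and> y \<le> 0" using rhoe_deriv by (auto simp: mult_le_0_iff intro!: exI)
  qed
next
  case False
  show ?thesis
  proof (rule DERIV_nonneg_imp_nondecreasing[where f = "rhoe a"])
    show "z \<le> s" using False by simp
  next
    fix x assume "z \<le> x" "x \<le> s"
    then have "rhop a x \<ge> 0" using rhop_pos_after[OF a, of z x] z by (cases "x = z") auto
    then show "\<exists>y. (rhoe a has_real_derivative y) (at x) \<and> 0 \<le> y" using rhoe_deriv by (auto intro!: exI)
  qed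
qed

lemma rhoe_mono_after:
  assumes a: "a \<ge> 2" and z: "rhop a z \<ge> 0" and s: "z \<le> s"
  shows "rhoe a z \<le> rhoe a s"
proof (rule DERIV_nonneg_imp_nondecreasing[OF s])
  fix x assume "z \<le> x" "x \<le> s"
  then have "rhop a x \<ge> 0" using rhop_pos_after[OF a z, of x] z by (cases "x = z") auto
  then show "\<exists>y. (rhoe a has_real_derivative y) (at x) \<and> 0 \<le> y" using rhoe_deriv by (auto intro!: exI)
qed

lemma rhop_continuous: "continuous_on A (rhop a)"
  unfolding rhop_def by (rule Lcut_continuous[OF wrho_integrable1])

lemma rhop_zero:
  assumes "rhop a s1 \<le> 0" "0 \<le> rhop a s2" "s1 \<le> s2"
  obtains z where "s1 \<le> z" "z \<le> s2" "rhop a z = 0"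
proof -
  have "\<exists>z\<ge>s1. z \<le> s2 \<and> rhop a z = 0"
    by (rule IVT'[OF assms]) (rule rhop_continuous)
  then show ?thesis using that by blast
qed

text \<open>Between \<open>s1\<close> and \<open>s2\<close> lies a zero of \<open>rhop\<close>,
  which minimises \<open>rhoe\<close>. On the way there the slope at \<open>x\<close> is at least
  \<open>exp x * rhop a s1\<close> with \<open>exp x \<le> 2 * exp s1\<close>, so the possible loss
  is a product of two small numbers.\<close>

lemma rho_nonneg_criterion:
  assumes a: "a \<ge> 2" and s: "s1 < s2" "s2 - s1 \<le> 1 / 2"
    and p: "rhop a s1 \<le> 0" "0 \<le> rhop a s2" and r: "rho a s1 + 2 * (s2 - s1) * rhop a s1 \<ge> 0"
  shows "rho a s \<ge> 0"
proof -
  obtain z where z: "s1 \<le> z" "z \<le> s2" "rhop a z = 0" using rhop_zero[OF p] s by auto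
  obtain t0 Q where t0: "0 < t0" and
    Q: "\<And>s. ((\<lambda>s. exp (t0 * s) * rhop a s) has_real_derivative exp (t0 * s) * Q s) (at s)"
    "\<And>s. Q s > 0" using rhop_increasing[OF a] by metis
  have "rhoe a z \<ge> 0"
  proof (cases "z = s1")
    case True
    then show ?thesis using r z by (simp add: rhoe_def)
  next
    case False
    then have "s1 < z" using z by simp
    then obtain x where x: "s1 < x" "x < z" "rhoe a z - rhoe a s1 = (z - s1) * (exp x * rhop a x)"
      using MVT2[of s1 z "rhoe a" "\<lambda>x. exp x * rhop a x"] rhoe_deriv by blast
    have "exp (t0 * s1) * rhop a s1 \<le> exp (t0 * x) * rhop a x"
      by (rule DERIV_nonneg_imp_nondecreasing[OF less_imp_le[OF x(1)]])
         (use Q in \<open>auto intro!: exI mult_nonneg_nonneg simp: less_imp_le\<close>)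
    then have "exp (t0 * (s1 - x)) * rhop a s1 \<le> rhop a x"
      by (simp add: right_diff_distrib exp_diff field_simps)
    moreover have "rhop a s1 * 1 \<le> rhop a s1 * exp (t0 * (s1 - x))"
      using p(1) x t0 by (intro mult_left_mono_neg) (auto simp: mult_le_0_iff)
    ultimately have px: "rhop a s1 \<le> rhop a x" by (simp add: mult.commute)
    have e2: "exp (s2 - s1) \<le> 2"
    proof -
      have "exp (s2 - s1) \<le> exp (1 / 2)" using s by simp
      also have "exp (1 / 2 :: real) \<le> 1 + 2 * (1/2)" using exp_bound_half[of "1/2 :: real"] by simp
      finally show ?thesis by simp
    qed
    have "(z - s1) * (exp x * rhop a x) \<ge> (z - s1) * (exp x * rhop a s1)"
      using px x by (intro mult_left_mono) auto
    moreover have "(z - s1) * (exp x * rhop a s1) \<ge> (s2 - s1) * (exp s1 * 2 * rhop a s1)"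
    proof -
      have "exp x \<le> exp s1 * exp (s2 - s1)" using x z by (simp flip: exp_add)
      also have "\<dots> \<le> exp s1 * 2" using e2 by simp
      finally have "(z - s1) * exp x \<le> (s2 - s1) * (exp s1 * 2)" using x z by (intro mult_mono) auto
      from mult_right_mono_neg[OF this p(1)] show ?thesis by (simp add: mult.assoc)
    qed
    ultimately have "rhoe a z \<ge> exp s1 * (rho a s1 + 2 * (s2 - s1) * rhop a s1)"
      using x(3) by (simp add: rhoe_def algebra_simps)
    then show ?thesis using r by (meson exp_ge_zero mult_nonneg_nonneg order_trans)
  qed
  then have "rhoe a s \<ge> 0" using rhoe_min[OF a z(3), of s] by linarith
  then show ?thesis by (simp add: rhoe_def zero_le_mult_iff)
qed

text \<open>The constant is half the minimum over \<open>{0..2 * z}\<close> of the derivative of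
  \<open>exp (t0 * s) * rhop a s\<close>. Passing from \<open>exp (t0 * s)\<close> to
  \<open>exp s\<close> only helps, as \<open>t0 < 1\<close> and \<open>rhop\<close> has the sign of
  \<open>s - z\<close>. This growth is the room for the perturbation.\<close>

lemma rhoe_quadratic:
  assumes a: "a \<ge> 2" and z: "rhop a z = 0" "z > 0"
  obtains c where "c > 0" "\<And>s. 0 \<le> s \<Longrightarrow> s \<le> 2 * z \<Longrightarrow> rhoe a z + c * (s - z)\<^sup>2 \<le> rhoe a s"
proof -
  obtain t0 Q where t0: "0 < t0" "t0 < 1" and
    Q: "\<And>s. ((\<lambda>s. exp (t0 * s) * rhop a s) has_real_derivative exp (t0 * s) * Q s) (at s)"
    "\<And>s. Q s > 0" "continuous_on UNIV Q" using rhop_increasing[OF a] by metis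
  have "continuous_on {0..2 * z} (\<lambda>s. exp (t0 * s) * Q s)"
    by (intro continuous_intros continuous_on_subset[OF Q(3)]) auto
  then obtain x0 where x0: "x0 \<in> {0..2*z}" "\<And>x. x \<in> {0..2*z} \<Longrightarrow> exp (t0 * x0) * Q x0 \<le> exp (t0 * x) * Q x"
    using continuous_attains_inf[of "{0..2*z}" "\<lambda>s. exp (t0 * s) * Q s"] z(2) by auto
  define c where "c = exp (t0 * x0) * Q x0"
  have c: "c > 0" unfolding c_def using Q(2) by simp
  have dA: "((\<lambda>s. exp (t0 * s) * rhop a s - c * s) has_real_derivative exp (t0 * s) * Q s - c) (at s)" for s
    by (rule DERIV_diff[OF Q(1)]) (auto intro!: derivative_eq_intros)
  have P: "exp s * rhop a s \<ge> c * (s - z)" if "z \<le> s" "s \<le> 2 * z" for s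
  proof -
    have "exp (t0 * z) * rhop a z - c * z \<le> exp (t0 * s) * rhop a s - c * s"
    proof (rule DERIV_nonneg_imp_nondecreasing[OF that(1), where f = "\<lambda>s. exp (t0 * s) * rhop a s - c * s"])
      fix x assume "z \<le> x" "x \<le> s"
      then have "exp (t0 * x) * Q x - c \<ge> 0" using x0(2)[of x] that z by (simp add: c_def)
      then show "\<exists>y. ((\<lambda>s. exp (t0 * s) * rhop a s - c * s) has_real_derivative y) (at x) \<and> 0 \<le> y" using dA by blast
    qed
    then have 1: "c * (s - z) \<le> exp (t0 * s) * rhop a s" using z by (simp add: algebra_simps)
    moreover have "0 \<le> c * (s - z)" using c that by simp
    ultimately have "0 \<le> exp (t0 * s) * rhop a s" by linarith
    then have "0 \<le> rhop a s" by (simp add: zero_le_mult_iff)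
    then have "exp (t0 * s) * rhop a s \<le> exp s * rhop a s" using t0 that z by (intro mult_right_mono) (auto simp: mult_left_le_one_le)
    with 1 show ?thesis by linarith
  qed
  have N: "exp s * rhop a s \<le> c * (s - z)" if "0 \<le> s" "s \<le> z" for s
  proof -
    have "exp (t0 * s) * rhop a s - c * s \<le> exp (t0 * z) * rhop a z - c * z"
    proof (rule DERIV_nonneg_imp_nondecreasing[OF that(2), where f = "\<lambda>s. exp (t0 * s) * rhop a s - c * s"])
      fix x assume "s \<le> x" "x \<le> z"
      then have "exp (t0 * x) * Q x - c \<ge> 0" using x0(2)[of x] that z by (simp add: c_def)
      then show "\<exists>y. ((\<lambda>s. exp (t0 * s) * rhop a s - c * s) has_real_derivative y) (at x) \<and> 0 \<le> y" using dA by blast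
    qed
    then have 1: "exp (t0 * s) * rhop a s \<le> c * (s - z)" using z by (simp add: algebra_simps)
    moreover have "c * (s - z) \<le> 0" using c that by (simp add: mult_le_0_iff)
    ultimately have "exp (t0 * s) * rhop a s \<le> 0" by linarith
    then have "rhop a s \<le> 0" by (simp add: mult_le_0_iff)
    then have "exp s * rhop a s \<le> exp (t0 * s) * rhop a s" using t0 that z by (intro mult_right_mono_neg) (auto simp: mult_left_le_one_le)
    with 1 show ?thesis by linarith
  qed
  have d: "((\<lambda>s. rhoe a s - c / 2 * (s - z)\<^sup>2) has_real_derivative (exp s * rhop a s - c * (s - z))) (at s)" for s
    by (auto intro!: derivative_eq_intros rhoe_deriv)
  show ?thesis
  proof (rule that[of "c / 2"])
    fix s assume s: "0 \<le> s" "s \<le> 2 * z"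
    have "rhoe a z - c / 2 * (z - z)\<^sup>2 \<le> rhoe a s - c / 2 * (s - z)\<^sup>2"
    proof (cases "s \<le> z")
      case True
      show ?thesis
      proof (rule DERIV_nonpos_imp_nonincreasing[OF True, where f = "\<lambda>s. rhoe a s - c / 2 * (s - z)\<^sup>2"])
        fix x assume "s \<le> x" "x \<le> z"
        then have "exp x * rhop a x - c * (x - z) \<le> 0" using N[of x] s by simp
        then show "\<exists>y. ((\<lambda>s. rhoe a s - c / 2 * (s - z)\<^sup>2) has_real_derivative y) (at x) \<and> y \<le> 0" using d by blast
      qed
    next
      case False
      then have "z \<le> s" by simp
      then show ?thesis
      proof (rule DERIV_nonneg_imp_nondecreasing[where f = "\<lambda>s. rhoe a s - c / 2 * (s - z)\<^sup>2"])
        fix x assume "z \<le> x" "x \<le> s"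
        then have "exp x * rhop a x - c * (x - z) \<ge> 0" using P[of x] s by simp
        then show "\<exists>y. ((\<lambda>s. rhoe a s - c / 2 * (s - z)\<^sup>2) has_real_derivative y) (at x) \<and> 0 \<le> y" using d by blast
      qed
    qed
    then show "rhoe a z + c / 2 * (s - z)\<^sup>2 \<le> rhoe a s" by simp
  qed (use c in auto)
qed

lemma rhop_antimono:
  assumes "a \<le> b"
  shows "rhop b s \<le> rhop a s"
  unfolding rhop_def Lcut_def
proof (rule integral_mono)
  show "wrho b \<tau> * (1 - tcut \<tau>) * exp (- (tcut \<tau> * s)) \<le> wrho a \<tau> * (1 - tcut \<tau>) * exp (- (tcut \<tau> * s))" for \<tau>
    using assms ucut_pos[of \<tau>] tcut_bounds[of \<tau>] unfolding wrho_def by (intro mult_right_mono) auto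
qed (intro integrable_mult_exp_tcut wrho_integrable1)+

section \<open>Power series of the density\<close>

text \<open>Moments of the whole measure representing \<open>Fg\<close>: \<open>wcut\<close> on the
  cut, and a unit mass at \<open>t = 1\<close> from the summand \<open>1 / (x + 1)\<close>.\<close>

definition cF :: "nat \<Rightarrow> real" where "cF n = 1 + moment wcut n"

definition crho :: "real \<Rightarrow> nat \<Rightarrow> real" where "crho a n = cF n + a * (real n / real (n + 1))"

lemma moment_wrho: "moment (wrho a) n = moment wcut n - a / real (n + 1)"
proof -
  have "moment (wrho a) n = (\<integral>\<tau>. wcut \<tau> * tcut \<tau> ^ n - a * (ucut \<tau> * tcut \<tau> ^ n) \<partial>lborel)"
    unfolding moment_def wrho_def by (simp add: left_diff_distrib mult.assoc)
  also have "\<dots> = moment wcut n - (\<integral>\<tau>. a * (ucut \<tau> * tcut \<tau> ^ n) \<partial>lborel)"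
    unfolding moment_def
    by (rule Bochner_Integration.integral_diff[OF integrable_mult_tcut_power[OF wcut_integrable]
          integrable_mult_right[OF integrable_mult_tcut_power[OF ucut_integrable]]])
  also have "(\<integral>\<tau>. a * (ucut \<tau> * tcut \<tau> ^ n) \<partial>lborel) = a / real (n + 1)"
    using ucut_moment[of n] by (simp add: has_bochner_integral_iff)
  finally show ?thesis .
qed

lemma crho_eq: "crho a n = 1 + a + moment (wrho a) n"
proof -
  have "real n / real (n + 1) = 1 - 1 / real (n + 1)" by (simp add: field_simps)
  then show ?thesis unfolding crho_def cF_def moment_wrho by (simp only: right_diff_distrib mult_1_right times_divide_eq_right)
qed

lemma exp_minus_sums: "(\<lambda>n. (- 1) ^ n / fact n * s ^ n) sums exp (- s)" for s :: real
proof -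
  have "(\<lambda>n. (- s) ^ n /\<^sub>R fact n) sums exp (- s)" by (rule exp_converges)
  then show ?thesis by (simp add: power_minus[of s] divide_inverse mult_ac)
qed

lemma rho_sums: "(\<lambda>n. (- 1) ^ n * crho a n / fact n * s ^ n) sums rho a s"
proof -
  have "(\<lambda>n. (1 + a) * ((- 1) ^ n / fact n * s ^ n) + (- 1) ^ n * moment (wrho a) n / fact n * s ^ n) sums rho a s"
    unfolding rho_eq by (intro sums_add sums_mult exp_minus_sums Lcut_sums wrho_integrable)
  moreover have "(1 + a) * ((- 1) ^ n / fact n * s ^ n) + (- 1) ^ n * moment (wrho a) n / fact n * s ^ n =
      (- 1) ^ n * crho a n / fact n * s ^ n" for n
    unfolding crho_eq by (simp add: field_simps)
  ultimately show ?thesis by simp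
qed

text \<open>The negated derivative of \<open>rho\<close>, so the coefficients shift by one. Its
  evaluation can reuse the coefficient list of \<open>rho\<close> without the entry for index
  0.\<close>

lemma rho_minus_rhop_sums: "(\<lambda>n. (- 1) ^ n * crho a (Suc n) / fact n * s ^ n) sums (rho a s - rhop a s)"
proof -
  have "(\<lambda>n. (1 + a) * ((- 1) ^ n / fact n * s ^ n) + (- 1) ^ n * moment (\<lambda>\<tau>. wrho a \<tau> * tcut \<tau>) n / fact n * s ^ n)
      sums ((1 + a) * exp (- s) + Lcut (\<lambda>\<tau>. wrho a \<tau> * tcut \<tau>) s)"
    by (intro sums_add sums_mult exp_minus_sums Lcut_sums integrable_mult_tcut wrho_integrable)
  moreover have "(1 + a) * ((- 1) ^ n / fact n * s ^ n) + (- 1) ^ n * moment (\<lambda>\<tau>. wrho a \<tau> * tcut \<tau>) n / fact n * s ^ n =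
      (- 1) ^ n * crho a (Suc n) / fact n * s ^ n" for n
  proof -
    have "moment (\<lambda>\<tau>. wrho a \<tau> * tcut \<tau>) n = moment (wrho a) (Suc n)" by (simp add: moment_def mult.assoc)
    then show ?thesis unfolding crho_eq by (simp add: field_simps)
  qed
  ultimately show ?thesis by (simp add: rho_eq rhop_eq)
qed

section \<open>Expansion at infinity and the coefficient recurrence\<close>

lemma Fg_dg_series:
  assumes x: "x > 1"
  shows "(\<lambda>n. (- 1) ^ n * cF n * (1 / x) ^ Suc n) sums Fg x"
    "(\<lambda>n. (- 1) ^ n * (1 / real (n + 1) - 1) * (1 / x) ^ Suc n) sums dg x"
proof -
  have key: "(\<lambda>n. d n * (1 / x) ^ Suc n) sums G x"
    if d: "\<And>n. \<bar>d n\<bar> \<le> C * 1 ^ n" and r: "\<And>s. (\<lambda>n. d n * (s ^ n / fact n)) sums r s" and L: "has_laplace 0 r G"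
    for d C r G
  proof -
    have "r = (\<lambda>s. \<Sum>n. d n * (s ^ n / fact n))" using r by (auto simp: sums_iff)
    then have "has_laplace 1 r (\<lambda>x. \<Sum>k. d k * (1 / x) ^ Suc k)"
      using has_laplace_powerseries[OF d] by simp
    then have "G x = (\<Sum>k. d k * (1 / x) ^ Suc k)"
      using L x unfolding has_laplace_def by (meson has_bochner_integral_eq less_trans zero_less_one)
    moreover have "summable (\<lambda>k. d k * (1 / x) ^ Suc k)"
    proof -
      have "summable (\<lambda>k. \<bar>d k * (1 / x) ^ k\<bar>)"
        by (rule summable_geometric_bound[OF d]) (use x in auto)
      then have "summable (\<lambda>k. d k * (1 / x) ^ k)" by (rule summable_rabs_cancel)
      from summable_mult2[OF this, of "1 / x"] show ?thesis by (simp add: mult_ac)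
    qed
    ultimately show ?thesis by (simp add: sums_iff)
  qed
  define I where "I = (\<integral>\<tau>. \<bar>wcut \<tau>\<bar> \<partial>lborel)"
  show "(\<lambda>n. (- 1) ^ n * cF n * (1 / x) ^ Suc n) sums Fg x"
  proof (rule key[OF _ _ has_laplace_rhoF])
    show "\<bar>(- 1) ^ n * cF n\<bar> \<le> (1 + I) * 1 ^ n" for n
      using abs_moment_le[OF wcut_integrable, of n] unfolding cF_def I_def by (simp add: abs_mult)
    fix s
    have "(\<lambda>n. (- 1) ^ n / fact n * s ^ n + (- 1) ^ n * moment wcut n / fact n * s ^ n) sums rhoF s"
      unfolding rhoF_def by (intro sums_add exp_minus_sums Lcut_sums wcut_integrable)
    moreover have "(- 1) ^ n / fact n * s ^ n + (- 1) ^ n * moment wcut n / fact n * s ^ n =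
        (- 1) ^ n * cF n * (s ^ n / fact n)" for n unfolding cF_def by (simp add: field_simps)
    ultimately show "(\<lambda>n. (- 1) ^ n * cF n * (s ^ n / fact n)) sums rhoF s" by simp
  qed
  show "(\<lambda>n. (- 1) ^ n * (1 / real (n + 1) - 1) * (1 / x) ^ Suc n) sums dg x"
  proof (rule key[OF _ _ has_laplace_rhog])
    show "\<bar>(- 1) ^ n * (1 / real (n + 1) - 1)\<bar> \<le> 1 * 1 ^ n" for n
      by (simp add: abs_mult field_simps)
    fix s
    have "(\<lambda>n. (- 1) ^ n * moment ucut n / fact n * s ^ n - (- 1) ^ n / fact n * s ^ n) sums rhog s"
      unfolding rhog_def by (intro sums_diff exp_minus_sums Lcut_sums ucut_integrable)
    moreover have "(- 1) ^ n * moment ucut n / fact n * s ^ n - (- 1) ^ n / fact n * s ^ n =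
        (- 1) ^ n * (1 / real (n + 1) - 1) * (s ^ n / fact n)" for n
    proof -
      have "moment ucut n = 1 / real (n + 1)" using ucut_moment[of n] by (simp add: moment_def has_bochner_integral_iff)
      then show ?thesis by (simp add: right_diff_distrib left_diff_distrib diff_divide_distrib)
    qed
    ultimately show "(\<lambda>n. (- 1) ^ n * (1 / real (n + 1) - 1) * (s ^ n / fact n)) sums rhog s" by simp
  qed
qed

text \<open>An identity theorem for a sum known only at positive arguments: convergence at
  \<open>r / 2\<close> gives a continuous sum around 0, whose value at 0 is the limit from the
  right, and zeros accumulating at 0 exclude a nonzero coefficient.\<close>

lemma powser_zero_right:
  fixes e :: "nat \<Rightarrow> real"
  assumes r: "r > 0" and s: "\<And>y. 0 < y \<Longrightarrow> y < r \<Longrightarrow> (\<lambda>n. e n * y ^ n) sums 0"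
  shows "e n = 0"
proof -
  have sm: "summable (\<lambda>n. e n * y ^ n)" if y: "\<bar>y\<bar> < r / 2" for y
  proof (rule powser_inside)
    show "summable (\<lambda>n. e n * (r / 2) ^ n)" using s[of "r / 2"] r by (auto simp: sums_iff)
    show "norm y < norm (r / 2)" using y r by simp
  qed
  define f where "f y = (\<Sum>n. e n * y ^ n)" for y
  have f: "(\<lambda>n. e n * y ^ n) sums f y" if "\<bar>y\<bar> < r / 2" for y
    using sm[OF that] unfolding f_def by (rule summable_sums)
  have f0: "f y = 0" if "0 < y" "y < r / 2" for y
    using s[of y] that r by (simp add: f_def sums_iff)
  have c: "isCont f 0" unfolding f_def
    by (rule isCont_powser[OF sm[of "r / 4"]]) (use r in auto)
  have "(f \<longlongrightarrow> f 0) (at_right 0)" using c by (simp add: isCont_def filterlim_at_split)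
  moreover have "\<forall>\<^sub>F y in at_right 0. f y = 0"
    using f0 r by (auto simp: eventually_at_right intro!: exI[of _ "r / 2"])
  then have "(f \<longlongrightarrow> 0) (at_right 0)" by (rule tendsto_eventually)
  ultimately have f00: "f 0 = 0" using tendsto_unique trivial_limit_at_right_real by blast
  have e0: "e 0 = 0" using f00 unfolding f_def by (simp add: powser_zero)
  show ?thesis
  proof (rule ccontr)
    assume n: "e n \<noteq> 0"
    then have "n > 0" using e0 by (cases n) auto
    obtain t where t: "0 < t" "\<And>z. z \<in> cball 0 t - {0} \<Longrightarrow> f z \<noteq> 0"
      using powser_0_nonzero[of "r / 2" 0 e f n] r f f00 n \<open>n > 0\<close> by auto
    have "f (min t (r / 4)) = 0" using t(1) r by (intro f0) auto
    moreover have "min t (r / 4) \<in> cball 0 t - {0}" using t(1) r by auto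
    ultimately show False using t(2) by blast
  qed
qed

text \<open>The coefficient \<open>1 / (n + 1) - 1\<close> of \<open>dg\<close> vanishes at
  \<open>n = 0\<close>, so the expansion starts with \<open>y\<^sup>2\<close> and the index moves by
  one.\<close>

lemma dg_over_square_series:
  assumes y: "0 < y" "y < 1"
  shows "(\<lambda>n. (- 1) ^ n * (real (n + 1) / real (n + 2)) * y ^ n) sums (dg (1 / y) / y\<^sup>2)"
proof -
  define x where "x = 1 / y"
  have x: "x > 1" "y = 1 / x" using y by (auto simp: x_def field_simps)
  define B where "B n = (- 1) ^ n * (real (n + 1) / real (n + 2)) * y ^ n" for n
  have "(\<lambda>n. (- 1) ^ Suc n * (1 / real (Suc n + 1) - 1) * y ^ Suc (Suc n)) sums (dg x - (- 1) ^ 0 * (1 / real (0 + 1) - 1) * y ^ Suc 0)"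
    using Fg_dg_series(2)[OF x(1)] unfolding x(2)[symmetric] by (subst sums_Suc_iff) simp
  moreover have "(- 1) ^ Suc n * (1 / real (Suc n + 1) - 1) * y ^ Suc (Suc n) = B n * y\<^sup>2" for n
  proof -
    define L where "L = 1 / real (Suc n + 1) - 1"
    have K: "real (n + 1) / real (n + 2) = - L" unfolding L_def by (simp add: field_simps)
    show ?thesis unfolding B_def K L_def[symmetric] by (simp add: power2_eq_square)
  qed
  ultimately have "(\<lambda>n. B n * y\<^sup>2) sums dg x" by simp
  then have "B sums (dg x / y\<^sup>2)" using y sums_mult2_iff[of "y\<^sup>2" B "dg x / y\<^sup>2"] by simp
  then show ?thesis by (simp add: B_def[abs_def] x_def)
qed

text \<open>Coefficient comparison in \<open>Fg x * dg x = 1 / (x * (x + 1)\<^sup>2)\<close> with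
  \<open>y = 1 / x\<close>: division by \<open>y ^ 3\<close> leaves
  \<open>1 / (1 + y)\<^sup>2\<close>, whose coefficients are
  \<open>(- 1) ^ n * (n + 1)\<close>.\<close>

lemma cF_recurrence: "(\<Sum>j\<le>n. cF j * (real (n - j + 1) / real (n - j + 2))) = real n + 1"
proof -
  define e where "e n = (- 1) ^ n * ((\<Sum>j\<le>n. cF j * (real (n - j + 1) / real (n - j + 2))) - (real n + 1))" for n
  have "(\<lambda>n. e n * y ^ n) sums 0" if y: "0 < y" "y < 1" for y
  proof -
    define x where "x = 1 / y"
    have x: "x > 1" "y = 1 / x" using y by (auto simp: x_def field_simps)
    define A where "A n = (- 1) ^ n * cF n * y ^ n" for n
    define B where "B n = (- 1) ^ n * (real (n + 1) / real (n + 2)) * y ^ n" for n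
    have "(\<lambda>n. A n * y) sums Fg x"
      using Fg_dg_series(1)[OF x(1)] unfolding A_def x(2)[symmetric] by (simp add: mult_ac)
    then have A: "A sums (Fg x / y)" using y sums_mult2_iff[of y A "Fg x / y"] by simp
    have B: "B sums (dg x / y\<^sup>2)"
      unfolding B_def x_def by (rule dg_over_square_series[OF y])
    have cb: "\<bar>cF n\<bar> \<le> (1 + (\<integral>\<tau>. \<bar>wcut \<tau>\<bar> \<partial>lborel)) * 1 ^ n" for n
      using abs_moment_le[OF wcut_integrable, of n] unfolding cF_def by simp
    have nA: "summable (\<lambda>n. norm (A n))"
      using summable_geometric_bound[OF cb, of y] y by (simp add: A_def abs_mult)
    have nB: "summable (\<lambda>n. norm (B n))"
      using summable_geometric_bound[of "\<lambda>n. real (n + 1) / real (n + 2)" 1 1 y] y by (simp add: B_def abs_mult)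
    have "(\<lambda>k. \<Sum>i\<le>k. A i * B (k - i)) sums ((\<Sum>k. A k) * (\<Sum>k. B k))"
      by (rule Cauchy_product_sums[OF nA nB])
    moreover have "(\<Sum>k. A k) * (\<Sum>k. B k) = 1 / (1 + y)\<^sup>2"
    proof -
      have "(\<Sum>k. A k) * (\<Sum>k. B k) = Fg x * dg x / y ^ 3" using A B by (simp add: sums_iff power2_eq_square power3_eq_cube)
      also have "Fg x * dg x = 1 / (x * (x + 1)\<^sup>2)" using dg_pos[of x] x by (simp add: Fg_def)
      also have "x * (x + 1)\<^sup>2 = (1 + y)\<^sup>2 / y ^ 3"
      proof -
        have "x + 1 = (1 + y) / y" using y by (simp add: x_def field_simps)
        then show ?thesis by (simp add: x_def power_divide power2_eq_square power3_eq_cube)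
      qed
      also have "1 / ((1 + y)\<^sup>2 / y ^ 3) / y ^ 3 = 1 / (1 + y)\<^sup>2" using y by simp
      finally show ?thesis .
    qed
    moreover have "(\<Sum>i\<le>k. A i * B (k - i)) = (- 1) ^ k * (\<Sum>j\<le>k. cF j * (real (k - j + 1) / real (k - j + 2))) * y ^ k" for k
    proof -
      have *: "A i * B (k - i) = (- 1) ^ k * y ^ k * (cF i * (real (k - i + 1) / real (k - i + 2)))" if "i \<le> k" for i
      proof -
        have "(- 1) ^ k = (- 1) ^ i * (- 1 :: real) ^ (k - i)" "y ^ k = y ^ i * y ^ (k - i)"
          using that power_add[of "- 1 :: real" i "k - i"] power_add[of y i "k - i"] by simp_all
        then show ?thesis unfolding A_def B_def by simp
      qed
      have "(\<Sum>i\<le>k. A i * B (k - i)) = (\<Sum>i\<le>k. (- 1) ^ k * y ^ k * (cF i * (real (k - i + 1) / real (k - i + 2))))"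
        by (rule sum.cong[OF refl], rule *) simp
      also have "\<dots> = (- 1) ^ k * y ^ k * (\<Sum>i\<le>k. cF i * (real (k - i + 1) / real (k - i + 2)))"
        by (rule sum_distrib_left[symmetric])
      finally show ?thesis by (simp only: mult_ac)
    qed
    ultimately have s1: "(\<lambda>k. (- 1) ^ k * (\<Sum>j\<le>k. cF j * (real (k - j + 1) / real (k - j + 2))) * y ^ k) sums (1 / (1 + y)\<^sup>2)"
      by simp
    have s2: "(\<lambda>k. real (Suc k) * (- y) ^ k) sums (1 / (1 - - y)\<^sup>2)"
      using geometric_deriv_sums[of "- y"] y by simp
    have "(- 1) ^ k * (\<Sum>j\<le>k. cF j * (real (k - j + 1) / real (k - j + 2))) * y ^ k - real (Suc k) * (- y) ^ k = e k * y ^ k" for k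
      by (simp add: e_def power_minus[of y] algebra_simps)
    then show ?thesis using sums_diff[OF s1 s2] by simp
  qed
  from powser_zero_right[of 1 e, OF _ this] have "e n = 0" by simp
  then show ?thesis by (simp add: e_def)
qed

text \<open>The term \<open>j = n\<close> of the recurrence carries the weight \<open>1 / 2\<close>,
  hence the factor 2.\<close>

lemma cF_rec: "cF n = 2 * (real n + 1 - (\<Sum>j<n. cF j * (1 - 1 / real (n - j + 2))))"
proof -
  have "real n + 1 = (\<Sum>j<n. cF j * (real (n - j + 1) / real (n - j + 2))) + cF n * (1 / 2)"
    using cF_recurrence[of n] by (simp add: lessThan_Suc_atMost[symmetric])
  moreover have eq: "real (n - j + 1) / real (n - j + 2) = 1 - 1 / real (n - j + 2)" for j
    by (simp add: field_simps)
  have "(\<Sum>j<n. cF j * (real (n - j + 1) / real (n - j + 2))) = (\<Sum>j<n. cF j * (1 - 1 / real (n - j + 2)))"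
    by (simp only: eq)
  moreover have "c = 2 * (m - S)" if "m = S + c * (1 / 2)" for c m S :: real using that by simp
  ultimately show ?thesis by metis
qed

lemma wcut_integral: "integral\<^sup>L lborel wcut = 1"
  using cF_rec[of 0] by (simp add: cF_def moment_def)

lemma cF_bounds: "1 \<le> cF n" "cF n \<le> 2"
proof -
  have "moment wcut n \<ge> 0" unfolding moment_def
  proof (rule Bochner_Integration.integral_nonneg)
    show "0 \<le> wcut \<tau> * tcut \<tau> ^ n" for \<tau> using wcut_pos[of \<tau>] tcut_bounds[of \<tau>] by (intro mult_nonneg_nonneg) auto
  qed
  then show "1 \<le> cF n" by (simp add: cF_def)
  have "\<bar>wcut \<tau>\<bar> = wcut \<tau>" for \<tau> using wcut_pos[of \<tau>] by simp
  then show "cF n \<le> 2" using abs_moment_le[OF wcut_integrable, of n] wcut_integral by (simp add: cF_def)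
qed

section \<open>Fixed-point evaluation\<close>

text \<open>
  Lists are indexed from the end: the entry with \<open>n\<close> elements to its
  right approximates \<open>f n\<close>, up to \<open>E n\<close>.
\<close>

fun approximates :: "(nat \<Rightarrow> real) \<Rightarrow> (nat \<Rightarrow> real) \<Rightarrow> int list \<Rightarrow> bool" where
  "approximates f E [] \<longleftrightarrow> True"
| "approximates f E (x # xs) \<longleftrightarrow> \<bar>real_of_int x - f (length xs)\<bar> \<le> E (length xs) \<and> approximates f E xs"

text \<open>The sum in \<open>cF_rec\<close>, with \<open>x - x div i\<close> for
  \<open>x * (1 - 1 / i)\<close>. The head of the list is the coefficient \<open>j = n - 1\<close>,
  whose denominator is \<open>n - j + 2 = 3\<close>; this is the starting value of \<open>i\<close>
  in \<open>cF_list\<close>.\<close>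

fun weighted_sum :: "int \<Rightarrow> int list \<Rightarrow> int" where
  "weighted_sum i [] = 0"
| "weighted_sum i (x # xs) = x - x div i + weighted_sum (i + 1) xs"

fun cF_list :: "int \<Rightarrow> nat \<Rightarrow> int list" where
  "cF_list S 0 = []"
| "cF_list S (Suc n) = (let cs = cF_list S n in 2 * ((int n + 1) * S - weighted_sum 3 cs) # cs)"

fun crho_list :: "int \<Rightarrow> int list \<Rightarrow> int list" where
  "crho_list A [] = []"
| "crho_list A (x # xs) = (let n = int (length xs) in (x + (A * n) div (n + 1)) # crho_list A xs)"

text \<open>Backward evaluation of \<open>x - s / (n + 1) * y\<close> at \<open>s = p / q\<close> on
  scaled integers, together with an error bound. \<open>E0 * 3 ^ n\<close> is the error of the
  entry, and 2 covers the two roundings by \<open>div\<close>.\<close>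

fun horner_int :: "int \<Rightarrow> int \<Rightarrow> int \<Rightarrow> int list \<Rightarrow> int \<Rightarrow> int \<Rightarrow> int \<times> int" where
  "horner_int E0 p q [] y e = (y, e)"
| "horner_int E0 p q (x # xs) y e = (let n = length xs; m = q * (int n + 1) in
     horner_int E0 p q xs (x - (p * y) div m) (E0 * 3 ^ n + (p * e) div m + 2))"

lemma div_error: "k > 0 \<Longrightarrow> 0 \<le> real_of_int x / real_of_int k - real_of_int (x div k)"
  "k > 0 \<Longrightarrow> real_of_int x / real_of_int k - real_of_int (x div k) \<le> 1"
  using real_of_int_div4[of x k] real_of_int_div3[of x k] by auto

text \<open>The weights lie between 0 and 1, so entry errors are not amplified, and each
  \<open>div\<close> adds at most 1.\<close>

lemma weighted_sum_error:
  assumes "approximates f E xs" "i > 0"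
  shows "\<bar>real_of_int (weighted_sum i xs) - (\<Sum>j<length xs. f j * (1 - 1 / (real_of_int i + real (length xs - 1 - j))))\<bar>
    \<le> (\<Sum>j<length xs. E j + 1)"
  using assms
proof (induction xs arbitrary: i)
  case (Cons x xs)
  let ?n = "length xs"
  let ?T = "\<Sum>j<?n. f j * (1 - 1 / (real_of_int (i + 1) + real (?n - 1 - j)))"
  have IH: "\<bar>real_of_int (weighted_sum (i + 1) xs) - ?T\<bar> \<le> (\<Sum>j<?n. E j + 1)"
    by (rule Cons.IH) (use Cons.prems in auto)
  have T: "?T = (\<Sum>j<?n. f j * (1 - 1 / (real_of_int i + real (?n - j))))"
    by (rule sum.cong) (auto simp: of_nat_diff)
  define w where "w = 1 - 1 / real_of_int i"
  have w: "0 \<le> w" "w \<le> 1" using Cons.prems(2) by (auto simp: w_def field_simps)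
  have "\<bar>(real_of_int x - f ?n) * w\<bar> \<le> E ?n * 1"
    using Cons.prems(1) w unfolding abs_mult by (intro mult_mono) auto
  moreover have "real_of_int (x - x div i) - f ?n * w = (real_of_int x - f ?n) * w + (real_of_int x / real_of_int i - real_of_int (x div i))"
    by (simp add: w_def algebra_simps)
  ultimately have A: "\<bar>real_of_int (x - x div i) - f ?n * w\<bar> \<le> E ?n + 1"
    using div_error[of i x] Cons.prems(2) by linarith
  have B: "(\<Sum>j<length (x # xs). f j * (1 - 1 / (real_of_int i + real (length (x # xs) - 1 - j)))) = f ?n * w + ?T"
    unfolding T by (simp add: w_def)
  have R: "(\<Sum>j<length (x # xs). E j + 1) = (\<Sum>j<?n. E j + 1) + (E ?n + 1)" by simp
  have "\<bar>X + W - (P + T)\<bar> \<le> C + D" if "\<bar>X - P\<bar> \<le> D" "\<bar>W - T\<bar> \<le> C" for X W P T C D :: real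
    using that unfolding abs_le_iff by linarith
  from this[OF A IH] show ?case unfolding weighted_sum.simps of_int_add B R .
qed simp

lemma length_cF_list [simp]: "length (cF_list S n) = n"
  by (induction n) (auto simp: Let_def)

lemma sum_power_3: "(\<Sum>j<n. (3::real) ^ j - 1 + 1) = (3 ^ n - 1) / 2"
  by (induction n) auto

text \<open>An error bound \<open>3 ^ j - 1\<close> for all \<open>j < n\<close> gives \<open>2 * (\<Sum>j<n. 3 ^ j) = 3 ^ n - 1\<close> for \<open>n\<close>, by \<open>cF_rec\<close>.\<close>

lemma cF_list_approximates: "approximates (\<lambda>n. real_of_int S * cF n) (\<lambda>n. 3 ^ n - 1) (cF_list S n)"
proof (induction n)
  case (Suc n)
  let ?W = "real_of_int (weighted_sum 3 (cF_list S n))"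
  have 1: "\<bar>?W - (\<Sum>j<n. real_of_int S * cF j * (1 - 1 / (3 + real (n - 1 - j))))\<bar> \<le> (3 ^ n - 1) / 2"
    using weighted_sum_error[OF Suc, of 3] sum_power_3[of n] by simp
  have 2: "(\<Sum>j<n. real_of_int S * cF j * (1 - 1 / (3 + real (n - 1 - j)))) =
      real_of_int S * (\<Sum>j<n. cF j * (1 - 1 / real (n - j + 2)))"
    unfolding sum_distrib_left
  proof (rule sum.cong)
    fix j assume "j \<in> {..<n}"
    then have "3 + real (n - 1 - j) = real (n - j + 2)" by auto
    then show "real_of_int S * cF j * (1 - 1 / (3 + real (n - 1 - j))) = real_of_int S * (cF j * (1 - 1 / real (n - j + 2)))"
      by simp
  qed simp
  have 3: "real_of_int S * cF n = 2 * ((real n + 1) * S - real_of_int S * (\<Sum>j<n. cF j * (1 - 1 / real (n - j + 2))))"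
    by (subst cF_rec) (simp add: algebra_simps)
  have "\<bar>2 * (k - w) - c\<bar> \<le> h" if "\<bar>w - t\<bar> \<le> h / 2" "t = T" "c = 2 * (k - T)" for c h k t T w :: real
  proof -
    have "2 * (k - w) - c = - (2 * (w - t))" using that by simp
    then have "\<bar>2 * (k - w) - c\<bar> = 2 * \<bar>w - t\<bar>" by (simp only: abs_minus_cancel abs_mult abs_numeral)
    then show ?thesis using that(1) by simp
  qed
  from this[OF 1 2 3] have "\<bar>2 * ((real n + 1) * S - ?W) - real_of_int S * cF n\<bar> \<le> 3 ^ n - 1" .
  then show ?case using Suc by (simp add: Let_def)
qed simp

text \<open>The bound \<open>3 ^ n - 1\<close> for \<open>cF_list\<close> leaves exactly the unit
  that the additional \<open>div\<close> may cost.\<close>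

lemma crho_list_approximates:
  fixes a :: real and S A :: int
  assumes "approximates (\<lambda>n. real_of_int S * cF n) (\<lambda>n. 3 ^ n - 1) xs" "real_of_int A = S * a"
  shows "approximates (\<lambda>n. real_of_int S * crho a n) (\<lambda>n. 3 ^ n) (crho_list A xs) \<and> length (crho_list A xs) = length xs"
  using assms(1)
proof (induction xs)
  case (Cons x xs)
  let ?n = "length xs"
  have "real_of_int S * crho a ?n = real_of_int S * cF ?n + real_of_int (A * int ?n) / real_of_int (int ?n + 1)"
    using assms(2) by (simp add: crho_def algebra_simps)
  moreover have "\<bar>real_of_int x - real_of_int S * cF ?n\<bar> \<le> 3 ^ ?n - 1" using Cons.prems by simp
  ultimately have "\<bar>real_of_int (x + (A * int ?n) div (int ?n + 1)) - real_of_int S * crho a ?n\<bar> \<le> 3 ^ ?n"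
    using div_error[of "int ?n + 1" "A * int ?n"] by linarith
  then show ?case using Cons by (simp add: Let_def)
qed simp

lemma approximates_butlast:
  "approximates f E xs \<Longrightarrow> approximates (\<lambda>n. f (Suc n)) (\<lambda>n. E (Suc n)) (butlast xs)"
  by (induction xs) auto

text \<open>The part of the series of \<open>e k * (- s) ^ k / fact k\<close> from index
  \<open>n\<close> on, divided by \<open>(- s) ^ n / fact n\<close>. This normalisation gives the
  Horner step \<open>Yfact_rec\<close> and a geometric bound once \<open>n + 1\<close> is at least
  \<open>2 * s\<close>.\<close>

definition Yfact :: "(nat \<Rightarrow> real) \<Rightarrow> real \<Rightarrow> nat \<Rightarrow> real" where
  "Yfact e s n = (\<Sum>k. e (n + k) * (- s) ^ k * (fact n / fact (n + k)))"

lemma fact_ratio_le: "fact n / fact (n + k) \<le> (1 / real (n + 1)) ^ k"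
proof (induction k)
  case (Suc k)
  have "fact n / fact (n + Suc k) = fact n / fact (n + k) * (1 / real (n + k + 1))"
    by (simp add: field_simps)
  also have "\<dots> \<le> (1 / real (n + 1)) ^ k * (1 / real (n + 1))"
    by (intro mult_mono Suc divide_left_mono) auto
  finally show ?case by (simp add: mult.commute)
qed simp

lemma Yfact_bound:
  assumes e: "\<And>n. \<bar>e n\<bar> \<le> M" and s: "0 \<le> s" "2 * s \<le> real (n + 1)"
  shows "\<bar>Yfact e s n\<bar> \<le> 2 * M"
proof -
  have b: "norm (e (n + k) * (- s) ^ k * (fact n / fact (n + k))) \<le> M * (1 / 2) ^ k" for k
  proof -
    have "norm (e (n + k) * (- s) ^ k * (fact n / fact (n + k))) = \<bar>e (n + k)\<bar> * (s ^ k * (fact n / fact (n + k)))"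
      using s(1) by (simp add: abs_mult power_abs)
    also have "\<dots> \<le> M * (s ^ k * (1 / real (n + 1)) ^ k)"
      using s(1) e[of "n + k"] by (intro mult_mono fact_ratio_le e) auto
    also have "s ^ k * (1 / real (n + 1)) ^ k = (s / real (n + 1)) ^ k" by (simp add: power_divide)
    also have "M * (s / real (n + 1)) ^ k \<le> M * (1 / 2) ^ k"
      using s e[of 0] by (intro mult_left_mono power_mono) (auto simp: field_simps)
    finally show ?thesis .
  qed
  have g: "(\<lambda>k. M * (1 / 2) ^ k) sums (M * 2)"
    using sums_mult[OF geometric_sums[of "1/2 :: real"], of M] by simp
  have "norm (Yfact e s n) \<le> (\<Sum>k. M * (1 / 2) ^ k)"
    unfolding Yfact_def by (rule norm_suminf_le[OF b sums_summable[OF g]])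
  then show "\<bar>Yfact e s n\<bar> \<le> 2 * M" using g by (simp add: sums_iff)
qed

lemma Yfact_summable:
  fixes e :: "nat \<Rightarrow> real" and s M :: real
  assumes e: "\<And>n. \<bar>e n\<bar> \<le> M"
  shows "summable (\<lambda>k. e (n + k) * (- s) ^ k * (fact n / fact (n + k)))"
proof (rule summable_comparison_test')
  show "summable (\<lambda>k. M * (\<bar>s\<bar> ^ k / fact k))"
    using summable_exp[of "\<bar>s\<bar>"] by (intro summable_mult) (simp add: field_simps)
  fix k
  have "(fact n :: real) * fact k \<le> fact (n + k)"
    using fact_fact_dvd_fact[of n k] by (metis dvd_imp_le fact_nonzero of_nat_fact of_nat_le_iff of_nat_mult gr0I)
  then have "fact n / fact (n + k) \<le> 1 / (fact k :: real)" by (simp add: field_simps)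
  then have "\<bar>e (n + k)\<bar> * \<bar>s\<bar> ^ k * (fact n / fact (n + k)) \<le> M * \<bar>s\<bar> ^ k * (1 / fact k)"
    using e[of "n + k"] by (intro mult_mono) auto
  then show "norm (e (n + k) * (- s) ^ k * (fact n / fact (n + k))) \<le> M * (\<bar>s\<bar> ^ k / fact k)"
    by (simp add: abs_mult power_abs)
qed

lemma Yfact_rec:
  assumes e: "\<And>n. \<bar>e n\<bar> \<le> M"
  shows "Yfact e s n = e n - s / real (n + 1) * Yfact e s (Suc n)"
proof -
  have "Yfact e s n = (\<Sum>k. e (n + Suc k) * (- s) ^ Suc k * (fact n / fact (n + Suc k))) + e n"
    unfolding Yfact_def using suminf_split_head[OF Yfact_summable[where e = e and M = M and n = n and s = s, OF e]] by simp
  also have "(\<lambda>k. e (n + Suc k) * (- s) ^ Suc k * (fact n / fact (n + Suc k))) =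
      (\<lambda>k. (- s / real (n + 1)) * (e (Suc n + k) * (- s) ^ k * (fact (Suc n) / fact (Suc n + k))))"
    by (simp add: fact_Suc mult_ac del: of_nat_Suc of_nat_add)
  also have "(\<Sum>k. (- s / real (n + 1)) * (e (Suc n + k) * (- s) ^ k * (fact (Suc n) / fact (Suc n + k)))) = - s / real (n + 1) * Yfact e s (Suc n)"
    unfolding Yfact_def by (rule suminf_mult[OF Yfact_summable[where e = e and M = M and s = s, OF e]])
  finally show ?thesis by simp
qed

lemma horner_int_error:
  assumes e: "\<And>n. \<bar>e n\<bar> \<le> M" and pq: "0 \<le> p" "0 < q" and
    xs: "approximates (\<lambda>n. real_of_int S * e n) (\<lambda>n. real_of_int E0 * 3 ^ n) xs" and
    y: "\<bar>real_of_int y - S * Yfact e (real_of_int p / real_of_int q) (length xs)\<bar> \<le> real_of_int err" and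
    res: "horner_int E0 p q xs y err = (y', err')"
  shows "\<bar>real_of_int y' - S * Yfact e (real_of_int p / real_of_int q) 0\<bar> \<le> real_of_int err'"
  using xs y res
proof (induction xs arbitrary: y err)
  case (Cons x xs)
  define n where "n = length xs"
  define m where "m = q * (int n + 1)"
  have m: "m > 0" using pq by (simp add: m_def)
  have mr: "real_of_int p / real_of_int q / real (n + 1) = real_of_int p / real_of_int m" by (simp add: m_def)
  have Y: "real_of_int S * Yfact e (real_of_int p / real_of_int q) n = real_of_int S * e n - real_of_int p / real_of_int m * (real_of_int S * Yfact e (real_of_int p / real_of_int q) (Suc n))"
  proof -
    have "Yfact e (real_of_int p / real_of_int q) n = e n - real_of_int p / real_of_int m * Yfact e (real_of_int p / real_of_int q) (Suc n)"
      using Yfact_rec[where e = e and M = M and s = "real_of_int p / real_of_int q" and n = n, OF e] unfolding mr .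
    from arg_cong[OF this, of "\<lambda>z. real_of_int S * z"]
    show ?thesis by (simp only: right_diff_distrib mult.left_commute)
  qed
  have 1: "\<bar>real_of_int p / m * (real_of_int y - S * Yfact e (real_of_int p / real_of_int q) (Suc n))\<bar> \<le> real_of_int p / m * err"
    using Cons.prems(2) pq m unfolding abs_mult by (intro mult_mono) (auto simp: n_def)
  have 2: "real_of_int p / m * err \<le> real_of_int ((p * err) div m) + 1" 
    using div_error(2)[OF m, of "p * err"] by simp
  have 3: "\<bar>real_of_int (p * y) / m - real_of_int ((p * y) div m)\<bar> \<le> 1"
    using div_error[OF m, of "p * y"] by simp
  have 4: "\<bar>real_of_int x - real_of_int S * e n\<bar> \<le> real_of_int E0 * 3 ^ n" using Cons.prems(1) by (simp add: n_def)
  have 5: "real_of_int (x - (p * y) div m) - S * Yfact e (real_of_int p / real_of_int q) n =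
      (real_of_int x - real_of_int S * e n) + (real_of_int (p * y) / m - real_of_int ((p * y) div m))
      - real_of_int p / m * (real_of_int y - S * Yfact e (real_of_int p / real_of_int q) (Suc n))"
    unfolding Y by (simp add: algebra_simps)
  have "\<bar>z\<bar> \<le> E + d + 2" if "\<bar>c\<bar> \<le> g" "g \<le> d + 1" "\<bar>b\<bar> \<le> 1" "\<bar>a\<bar> \<le> E" "z = a + b - c"
    for a b c d g z E :: real using that by linarith
  from this[OF 1 2 3 4 5]
  have "\<bar>real_of_int (x - (p * y) div m) - S * Yfact e (real_of_int p / real_of_int q) n\<bar> \<le>
      real_of_int (E0 * 3 ^ n + (p * err) div m + 2)" by simp
  then show ?case using Cons by (intro Cons.IH) (auto simp: Let_def n_def m_def)
qed simp

lemma Yfact_rho: "Yfact (crho a) s 0 = rho a s" "Yfact (\<lambda>n. crho a (Suc n)) s 0 = rho a s - rhop a s"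
proof -
  have pm: "(- s) ^ k = (- 1) ^ k * s ^ k" for k by (rule power_minus)
  have "Yfact (crho a) s 0 = (\<Sum>k. (- 1) ^ k * crho a k / fact k * s ^ k)"
    unfolding Yfact_def pm by (simp add: mult_ac)
  then show "Yfact (crho a) s 0 = rho a s" using rho_sums[of a s] by (simp add: sums_iff)
  have "Yfact (\<lambda>n. crho a (Suc n)) s 0 = (\<Sum>k. (- 1) ^ k * crho a (Suc k) / fact k * s ^ k)"
    unfolding Yfact_def pm by (simp add: mult_ac)
  then show "Yfact (\<lambda>n. crho a (Suc n)) s 0 = rho a s - rhop a s" using rho_minus_rhop_sums[of a s] by (simp add: sums_iff)
qed

lemma crho_bound: "0 \<le> a \<Longrightarrow> a \<le> 3 \<Longrightarrow> \<bar>crho a n\<bar> \<le> 5"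
proof -
  assume a: "0 \<le> a" "a \<le> 3"
  have "0 \<le> a * (real n / real (n + 1))" using a by simp
  moreover have "a * (real n / real (n + 1)) \<le> 3 * 1" using a by (intro mult_mono) auto
  ultimately show ?thesis using cF_bounds[of n] by (simp add: crho_def)
qed

text \<open>The evaluation starts from 0 in place of the true tail. Coefficients bounded by 5 and a
  ratio of at most \<open>1 / 2\<close> bound that tail by 10, hence the initial error
  \<open>10 * S\<close>, which the factors \<open>s / (n + 1)\<close> then damp. In the shifted list
  the entry bound is \<open>3 ^ Suc n\<close>, hence the 3.\<close>

lemma rho_rhop_enclosure:
  fixes a :: real and N :: nat and S A p q r r' e e' :: int
  assumes a: "0 \<le> a" "a \<le> 3" and S: "S > 0" "real_of_int A = S * a"
    and pq: "0 \<le> p" "0 < q" "2 * p \<le> q * int N" and N: "N > 0"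
    and ev: "horner_int 1 p q (crho_list A (cF_list S N)) 0 (10 * S) = (r, e)"
      "horner_int 3 p q (butlast (crho_list A (cF_list S N))) 0 (10 * S) = (r', e')"
  shows "\<bar>real_of_int r - S * rho a (real_of_int p / real_of_int q)\<bar> \<le> e"
    "\<bar>real_of_int (r - r') - S * rhop a (real_of_int p / real_of_int q)\<bar> \<le> e + e'"
proof -
  let ?dl = "crho_list A (cF_list S N)"
  have dl: "approximates (\<lambda>n. real_of_int S * crho a n) (\<lambda>n. 3 ^ n) ?dl" "length ?dl = N"
    using crho_list_approximates[OF cF_list_approximates S(2)] by auto
  have s: "0 \<le> real_of_int p / real_of_int q" "2 * (real_of_int p / real_of_int q) \<le> real N"
  proof -
    have "real_of_int (2 * p) \<le> real_of_int (q * int N)" using pq(3) by (simp only: of_int_le_iff)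
    then show "2 * (real_of_int p / real_of_int q) \<le> real N" using pq by (simp add: field_simps)
  qed (use pq in auto)
  have init: "\<bar>real_of_int 0 - S * Yfact e (real_of_int p / real_of_int q) n\<bar> \<le> real_of_int (10 * S)" if e: "\<And>n. \<bar>e n\<bar> \<le> 5" and n: "n \<ge> N - 1" for e n
  proof -
    have "\<bar>Yfact e (real_of_int p / real_of_int q) n\<bar> \<le> 2 * 5" by (rule Yfact_bound[where e = e, OF e]) (use s n N in auto)
    then show ?thesis using S by (simp add: abs_mult)
  qed
  show r: "\<bar>real_of_int r - S * rho a (real_of_int p / real_of_int q)\<bar> \<le> e"
    unfolding Yfact_rho(1)[symmetric]
    by (rule horner_int_error[where e = "crho a", OF crho_bound[OF a] pq(1,2) _ _ ev(1)]) (use dl init[where e = "crho a", OF crho_bound[OF a]] in auto)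
  have "approximates (\<lambda>n. real_of_int S * crho a (Suc n)) (\<lambda>n. real_of_int 3 * 3 ^ n) (butlast ?dl)"
    using approximates_butlast[OF dl(1)] by simp
  then have "\<bar>real_of_int r' - S * Yfact (\<lambda>n. crho a (Suc n)) (real_of_int p / real_of_int q) 0\<bar> \<le> e'"
    by (rule horner_int_error[where e = "\<lambda>n. crho a (Suc n)", OF crho_bound[OF a] pq(1,2) _ _ ev(2)]) (use dl init[where e = "\<lambda>n. crho a (Suc n)" and n = "N - 1", OF crho_bound[OF a]] in auto)
  then show "\<bar>real_of_int (r - r') - S * rhop a (real_of_int p / real_of_int q)\<bar> \<le> e + e'"
    using r unfolding Yfact_rho(2) by (simp add: algebra_simps)
qed

section \<open>A perturbation beyond the critical parameter\<close>

definition glog :: "real \<Rightarrow> real" where "glog x = x * ln (1 + 1 / x)"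

definition hfun :: "real \<Rightarrow> real \<Rightarrow> real" where "hfun a x = exp (a * glog x)"

lemma glog_deriv: "x > 0 \<Longrightarrow> (glog has_real_derivative dg x) (at x)"
proof -
  assume x: "x > 0"
  have p: "1 + 1 / x > 0" using x by (simp add: add_pos_pos)
  have "((\<lambda>x. 1 + 1 / x) has_real_derivative - (1 / x\<^sup>2)) (at x)"
    using x by (auto intro!: derivative_eq_intros simp: power2_eq_square)
  from DERIV_mult[OF DERIV_ident DERIV_chain2[OF DERIV_ln_divide[OF p] this]]
  have "(glog has_real_derivative (1 * ln (1 + 1 / x) + 1 / (1 + 1 / x) * - (1 / x\<^sup>2) * x)) (at x)"
    by (simp add: glog_def[abs_def])
  moreover have "1 / (1 + 1 / x) * - (1 / x\<^sup>2) * x = - (1 / (x + 1))"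
  proof -
    have "1 + 1 / x = (x + 1) / x" using x by (simp add: field_simps)
    then show ?thesis using x by (simp add: power2_eq_square)
  qed
  ultimately show ?thesis by (simp add: dg_def)
qed

lemma dg_deriv: "x > 0 \<Longrightarrow> (dg has_real_derivative - (1 / (x * (x + 1)\<^sup>2))) (at x)"
proof -
  assume x: "x > 0"
  have p: "1 + 1 / x > 0" using x by (simp add: add_pos_pos)
  have "((\<lambda>x. 1 + 1 / x) has_real_derivative - (1 / x\<^sup>2)) (at x)"
    using x by (auto intro!: derivative_eq_intros simp: power2_eq_square)
  from DERIV_chain2[OF DERIV_ln_divide[OF p] this]
  have 1: "((\<lambda>x. ln (1 + 1 / x)) has_real_derivative 1 / (1 + 1 / x) * - (1 / x\<^sup>2)) (at x)" .
  have 2: "((\<lambda>x. 1 / (x + 1)) has_real_derivative - (1 / (x + 1)\<^sup>2)) (at x)"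
    using x by (auto intro!: derivative_eq_intros simp: power2_eq_square)
  have "1 / (1 + 1 / x) * - (1 / x\<^sup>2) - - (1 / (x + 1)\<^sup>2) = - (1 / (x * (x + 1)\<^sup>2))"
  proof -
    have "1 + 1 / x = (x + 1) / x" using x by (simp add: field_simps)
    then have "1 / (1 + 1 / x) * - (1 / x\<^sup>2) = - (1 / (x * (x + 1)))" using x by (simp add: power2_eq_square)
    moreover have "1 / (x * (x + 1)) - 1 / (x + 1)\<^sup>2 = 1 / (x * (x + 1)\<^sup>2)"
    proof -
      have e: "1 / (x * (x + 1)) = (x + 1) / (x * (x + 1)\<^sup>2)" "1 / (x + 1)\<^sup>2 = x / (x * (x + 1)\<^sup>2)"
        using x by (simp_all add: power2_eq_square)
      show ?thesis unfolding e diff_divide_distrib[symmetric] by simp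
    qed
    ultimately show ?thesis by linarith
  qed
  with DERIV_diff[OF 1 2] show ?thesis unfolding dg_def[abs_def] by (rule DERIV_cong)
qed

lemma dg_deriv_Fg: "x > 0 \<Longrightarrow> (dg has_real_derivative - (Fg x * dg x)) (at x)"
  using dg_deriv[of x] dg_pos[of x] by (simp add: Fg_def)

lemma hfun_deriv: "x > 0 \<Longrightarrow> (hfun a has_real_derivative a * dg x * hfun a x) (at x)"
  unfolding hfun_def[abs_def] by (auto intro!: derivative_eq_intros glog_deriv)

lemma hfun_pos: "hfun a x > 0" by (simp add: hfun_def)

lemma cm_dg: "cm 0 dg"
  using has_laplace_rhog by (rule cm_laplace) (use rhog_pos less_imp_le in blast)

lemma neg_log_deriv:
  assumes "x > 0"
  shows "((\<lambda>x. - (ln (dg x) + a * glog x)) has_real_derivative Fg x - a * dg x) (at x)"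
proof -
  have "((\<lambda>x. - (ln (dg x) + a * glog x)) has_real_derivative - (1 / dg x * - (Fg x * dg x) + a * dg x)) (at x)"
    using dg_deriv_Fg[OF assms] glog_deriv[OF assms] dg_pos[OF assms]
    by (intro DERIV_minus DERIV_add DERIV_cmult DERIV_chain2[OF DERIV_ln_divide])
  then show ?thesis using dg_pos[OF assms] by simp
qed

lemma has_laplace_rho: "has_laplace 0 (rho a) (\<lambda>x. Fg x - a * dg x)"
  unfolding rho_def[abs_def] by (intro has_laplace_diff has_laplace_cmult has_laplace_rhoF has_laplace_rhog)

lemma rho_cm_iff: "cm 0 (\<lambda>x. Fg x - a * dg x) \<longleftrightarrow> (\<forall>s>0. rho a s \<ge> 0)"
proof
  assume c: "cm 0 (\<lambda>x. Fg x - a * dg x)"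
  have "isCont (rho a) s" for s by (rule DERIV_isCont[OF rho_deriv])
  then show "\<forall>s>0. rho a s \<ge> 0" using laplace_cm_imp_nonneg[OF has_laplace_rho c] by blast
next
  assume "\<forall>s>0. rho a s \<ge> 0"
  then show "cm 0 (\<lambda>x. Fg x - a * dg x)" by (intro cm_laplace[OF has_laplace_rho]) auto
qed

text \<open>Beyond \<open>1 + (y + y\<^sup>2 / 2)\<close>, the exponential series splits into
  \<open>y ^ 3\<close> and \<open>y\<^sup>2 * y\<^sup>2\<close> times power series in
  \<open>y\<^sup>2\<close> with positive coefficients. A negative part in the density of
  \<open>f\<close> thus has to be compensated only by \<open>f\<^sup>2 / 2\<close>.\<close>

lemma cm_exp:
  assumes c1: "cm a (\<lambda>x. f x + (f x)\<^sup>2 / 2)" and c2: "cm a (\<lambda>x. (f x)\<^sup>2)" and c3: "cm a (\<lambda>x. (f x) ^ 3)"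
  shows "cm a (\<lambda>x. exp (f x))"
proof -
  define C where "C y = (\<Sum>k. 1 / fact (2 * k + 4) * y ^ k)" for y :: real
  define D where "D y = (\<Sum>k. 1 / fact (2 * k + 3) * y ^ k)" for y :: real
  have sm: "summable (\<lambda>k. 1 / fact (2 * k + j) * y ^ k)" for y :: real and j
  proof (rule summable_comparison_test')
    show "summable (\<lambda>k. inverse (fact k) * \<bar>y\<bar> ^ k)" by (rule summable_exp)
    fix k
    have "fact k \<le> (fact (2 * k + j) :: real)" by (rule fact_mono) simp
    then have "1 / fact (2 * k + j) \<le> (1 / fact k :: real)" by (intro divide_left_mono) auto
    then show "norm (1 / fact (2 * k + j) * y ^ k) \<le> inverse (fact k) * \<bar>y\<bar> ^ k"
      using mult_right_mono[of "1 / fact (2 * k + j)" "1 / fact k" "\<bar>y\<bar> ^ k"]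
      by (simp add: abs_mult power_abs inverse_eq_divide)
  qed
  have eq: "exp y = 1 + ((y + y\<^sup>2 / 2) + (y\<^sup>2 * y\<^sup>2 * C (y\<^sup>2) + y ^ 3 * D (y\<^sup>2)))" for y :: real
  proof -
    define t where "t n = y ^ (n + 3) / fact (n + 3)" for n
    have "(\<lambda>n. y ^ n / fact n) sums exp y" using exp_converges[of y] by (simp add: divide_inverse mult.commute)
    then have "t sums (exp y - (\<Sum>i<3. y ^ i / fact i))" unfolding t_def by (subst sums_iff_shift) simp
    also have "(\<Sum>i<3. y ^ i / fact i) = 1 + y + y\<^sup>2 / 2" by (simp add: eval_nat_numeral)
    finally have "(\<lambda>n. sum t {n * 2..<n * 2 + 2}) sums (exp y - (1 + y + y\<^sup>2 / 2))"
      by (rule sums_group) simp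
    moreover have "sum t {n * 2..<n * 2 + 2} = y\<^sup>2 * y\<^sup>2 * (1 / fact (2 * n + 4) * (y\<^sup>2) ^ n) + y ^ 3 * (1 / fact (2 * n + 3) * (y\<^sup>2) ^ n)" for n
    proof -
      have "{n * 2..<n * 2 + 2} = {2 * n, 2 * n + 1}" by auto
      then have "sum t {n * 2..<n * 2 + 2} = t (2 * n) + t (2 * n + 1)" by simp
      moreover have "t (2 * n) = y ^ 3 * (1 / fact (2 * n + 3) * (y\<^sup>2) ^ n)"
        by (simp add: t_def power_add power_mult)
      moreover have "t (2 * n + 1) = y\<^sup>2 * y\<^sup>2 * (1 / fact (2 * n + 4) * (y\<^sup>2) ^ n)"
      proof -
        have "2 * n + 1 + 3 = 2 * n + 4" by simp
        then have "t (2 * n + 1) = y ^ (2 * n + 4) / fact (2 * n + 4)" unfolding t_def by metis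
        also have "y ^ (2 * n + 4) = (y\<^sup>2) ^ n * (y\<^sup>2 * y\<^sup>2)" by (simp add: power_add power_mult flip: power2_eq_square)
        finally show ?thesis by simp
      qed
      ultimately show ?thesis by simp
    qed
    moreover have "(\<lambda>n. y\<^sup>2 * y\<^sup>2 * (1 / fact (2 * n + 4) * (y\<^sup>2) ^ n) + y ^ 3 * (1 / fact (2 * n + 3) * (y\<^sup>2) ^ n))
        sums (y\<^sup>2 * y\<^sup>2 * C (y\<^sup>2) + y ^ 3 * D (y\<^sup>2))"
      unfolding C_def D_def by (intro sums_add sums_mult summable_sums sm)
    ultimately have "exp y - (1 + y + y\<^sup>2 / 2) = y\<^sup>2 * y\<^sup>2 * C (y\<^sup>2) + y ^ 3 * D (y\<^sup>2)"
      using sums_unique2 by simp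
    then show ?thesis by simp
  qed
  have "cm a (\<lambda>x. C ((f x)\<^sup>2))" "cm a (\<lambda>x. D ((f x)\<^sup>2))"
    unfolding C_def D_def by (intro cm_entire_nonneg_coeffs c2 sm; simp)+
  then have "cm a (\<lambda>x. 1 + ((f x + (f x)\<^sup>2 / 2) + ((f x)\<^sup>2 * (f x)\<^sup>2 * C ((f x)\<^sup>2) + (f x) ^ 3 * D ((f x)\<^sup>2))))"
    by (intro cm_add cm_mult cm_const c1 c2 c3) simp
  then show ?thesis unfolding eq[symmetric] .
qed

lemma has_laplace_poly_exp:
  "has_laplace (- t) (\<lambda>s. (\<Sum>k\<le>m. e k * s ^ k / fact k) * exp (- (t * s))) (\<lambda>x. \<Sum>k\<le>m. e k * (1 / (x + t)) ^ Suc k)"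
proof -
  have p: "has_laplace (- t) (\<lambda>s. e k * s ^ k / fact k * exp (- (t * s))) (\<lambda>x. e k * (1 / (x + t)) ^ Suc k)" for k
  proof -
    have "(\<lambda>s. e k / fact k * (s ^ k * exp (- (t * s)))) = (\<lambda>s. e k * s ^ k / fact k * exp (- (t * s)))"
      "(\<lambda>x. e k / fact k * (fact k / (x + t) ^ Suc k)) = (\<lambda>x. e k * (1 / (x + t)) ^ Suc k)"
      by (auto simp: fun_eq_iff power_one_over)
    then show ?thesis using has_laplace_cmult[OF has_laplace_power[of t k], of "e k / fact k"] by metis
  qed
  show ?thesis
  proof (induction m)
    case (Suc m)
    then show ?case using has_laplace_add[OF Suc p[of "Suc m"]] by (simp only: sum.atMost_Suc distrib_right)
  qed (use p[of 0] in simp)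
qed

text \<open>
  With \<open>y = s / z\<close> and \<open>k = \<kappa> / z\<^sup>2\<close> the next two polynomials are, up to positive factors, the densities of
  the second and third powers of the transform with density \<open>((s - z)\<^sup>2 - \<kappa>) * exp (- 2 * s)\<close>.
\<close>

lemma P2_lower:
  fixes y k :: real
  assumes "0 \<le> y" "0 \<le> k" "k \<le> 1 / 1000"
  shows "1 / 500 \<le> y ^ 4 / 30 - y ^ 3 / 3 + 2 / 3 * (1 + (1 - k)) * y\<^sup>2 - 2 * (1 - k) * y + (1 - k)\<^sup>2"
proof -
  \<comment> \<open>For \<open>k = 0\<close> the polynomial is the square \<open>A\<close> plus a
    quadratic with positive minimum. From the quadratic, \<open>1 / 500 * y\<^sup>2\<close> is set
    aside to absorb the correction \<open>k * B\<close>; \<open>N\<close> is the completed square of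
    what is left.\<close>
  define A where "A = 1 / 30 * (y\<^sup>2 - 5 * y + 23 / 5)\<^sup>2"
  define N where "N = 287 / 1500 * (y - 350 / 287)\<^sup>2"
  define B where "B = 2 / 3 * y\<^sup>2 - 2 * y + 2 - k"
  have eq: "y ^ 4 / 30 - y ^ 3 / 3 + 2 / 3 * (1 + (1 - k)) * y\<^sup>2 - 2 * (1 - k) * y + (1 - k)\<^sup>2 =
      A + (29 / 150 * y\<^sup>2 - 7 / 15 * y + 221 / 750) - k * B"
    unfolding A_def B_def by (simp add: field_simps power2_eq_square power3_eq_cube power4_eq_xxxx)
  have "29 / 150 * y\<^sup>2 - 7 / 15 * y + 221 / 750 \<ge> 1 / 200 + 1 / 500 * y\<^sup>2 + N"
    unfolding N_def by (simp add: field_simps power2_eq_square)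
  moreover have "N \<ge> 0" "A \<ge> 0" "y\<^sup>2 \<ge> 0" by (simp_all add: N_def A_def)
  moreover have "k * B \<le> 1 / 1000 * (y\<^sup>2 + 2)"
  proof (rule order_trans[OF mult_left_mono mult_right_mono])
    show "B \<le> y\<^sup>2 + 2" using assms zero_le_power2[of y] unfolding B_def by linarith
  qed (use assms in auto)
  moreover have "1 / 500 \<le> A + W - K" if "1 / 200 + 1 / 500 * q + N \<le> W" "N \<ge> 0" "A \<ge> 0" "q \<ge> 0" "K \<le> 1 / 1000 * (q + 2)"
    for A N W K q :: real using that by argo
  ultimately show ?thesis unfolding eq by blast
qed

lemma P3_nonneg:
  fixes y k :: real
  assumes y: "0 \<le> y" and k: "0 \<le> k" "k \<le> 1 / 4000"
  shows "0 \<le> y ^ 6 - 24 * y ^ 5 + (168 + 84 * (1 - k)) * y ^ 4 - (336 + 1008 * (1 - k)) * y ^ 3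
    + (2520 * (1 - k) + 1260 * (1 - k)\<^sup>2) * y\<^sup>2 - 5040 * (1 - k)\<^sup>2 * y + 2520 * (1 - k) ^ 3" (is "0 \<le> ?P")
proof -
  \<comment> \<open>A sum-of-squares certificate for \<open>k = 0\<close>. Its slack
    \<open>63 / 25 * (1 + y ^ 4)\<close> is exactly \<open>1 / 4000 * (10080 * (1 + y ^ 4))\<close>,
    the bound shown next for the terms containing \<open>k\<close>.\<close>
  have "?P = (y ^ 3 - 12 * y\<^sup>2 + 39 * y - 34)\<^sup>2 + 687 / 25 * (y\<^sup>2 - 4250 / 687 * y + 7)\<^sup>2
      + 113459 / 17175 * (y - 68700 / 113459)\<^sup>2 + 35563666 / 2836475 + 63 / 25 * (1 + y ^ 4)
      - k * (84 * y ^ 4 - 1008 * y ^ 3 + (5040 - 1260 * k) * y\<^sup>2 - 5040 * (2 - k) * y + 2520 * (3 - 3 * k + k\<^sup>2))"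
    by (simp add: field_simps power2_eq_square power3_eq_cube eval_nat_numeral)
  moreover have "k * (84 * y ^ 4 - 1008 * y ^ 3 + (5040 - 1260 * k) * y\<^sup>2 - 5040 * (2 - k) * y + 2520 * (3 - 3 * k + k\<^sup>2))
      \<le> 1 / 4000 * (10080 * (1 + y ^ 4))"
  proof (rule order_trans[OF mult_left_mono mult_right_mono])
    have "y\<^sup>2 * 2 \<le> 1 + y ^ 4" using zero_le_power2[of "y\<^sup>2 - 1"] by (simp add: power2_eq_square power4_eq_xxxx algebra_simps)
    moreover have "0 \<le> k * y\<^sup>2" "0 \<le> y ^ 3" "0 \<le> (2 - k) * y" "k\<^sup>2 \<le> k"
      using y k by (auto simp: power2_eq_square intro!: mult_left_le mult_nonneg_nonneg)
    moreover have "84 * y ^ 4 - 1008 * y ^ 3 + (5040 - 1260 * k) * y\<^sup>2 - 5040 * (2 - k) * y + 2520 * (3 - 3 * k + k\<^sup>2) =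
        84 * y ^ 4 - 1008 * y ^ 3 + 5040 * y\<^sup>2 - 1260 * (k * y\<^sup>2) - 5040 * ((2 - k) * y) + 7560 - 7560 * k + 2520 * k\<^sup>2"
      by (simp add: algebra_simps)
    ultimately show "84 * y ^ 4 - 1008 * y ^ 3 + (5040 - 1260 * k) * y\<^sup>2 - 5040 * (2 - k) * y + 2520 * (3 - 3 * k + k\<^sup>2)
      \<le> 10080 * (1 + y ^ 4)"
      using k(1) zero_le_power[OF y, of 4] unfolding distrib_left by linarith
  qed (use k y in auto)
  moreover have "0 \<le> (y ^ 3 - 12 * y\<^sup>2 + 39 * y - 34)\<^sup>2" "0 \<le> 687 / 25 * (y\<^sup>2 - 4250 / 687 * y + 7)\<^sup>2"
    "0 \<le> 113459 / 17175 * (y - 68700 / 113459)\<^sup>2" by simp_all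
  ultimately show ?thesis by linarith
qed

text \<open>The density of \<open>f\<close> is negative only near \<open>z\<close>, and that of
  \<open>f\<^sup>2 / 2\<close> fills the dip: relative to \<open>d * exp (- (2 * s))\<close> it
  contributes at least \<open>d * z ^ 5 / 2000\<close> for \<open>s \<ge> z / 2\<close>, because
  \<open>P2 \<ge> 1 / 500\<close>. This is one bound on \<open>\<kappa>\<close>. The other makes
  \<open>k \<le> 1 / 4000\<close>, as the polynomial estimates require, and keeps
  \<open>(s - z)\<^sup>2 - \<kappa>\<close> nonnegative for \<open>s < z / 2\<close>.\<close>

lemma cm_exp_perturbation:
  fixes z d \<kappa> :: real
  assumes z: "z > 0" and d: "d > 0" and \<kappa>: "\<kappa> \<ge> 0" "\<kappa> \<le> z\<^sup>2 / 4000" "\<kappa> \<le> d * z ^ 5 / 2000"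
  defines "f \<equiv> \<lambda>x. d * (2 * (1 / (x + 2)) ^ 3 - 2 * z * (1 / (x + 2))\<^sup>2 + (z\<^sup>2 - \<kappa>) * (1 / (x + 2)))"
  shows "cm 0 (\<lambda>x. exp (f x))"
    "has_laplace (- 2) (\<lambda>s. d * s * ((s - z)\<^sup>2 - \<kappa>) * exp (- (2 * s)))
       (\<lambda>x. d * (6 * (1 / (x + 2)) ^ 4 - 4 * z * (1 / (x + 2)) ^ 3 + (z\<^sup>2 - \<kappa>) * (1 / (x + 2))\<^sup>2))"
    "\<And>x. x > 0 \<Longrightarrow> (f has_real_derivative - (d * (6 * (1 / (x + 2)) ^ 4 - 4 * z * (1 / (x + 2)) ^ 3 + (z\<^sup>2 - \<kappa>) * (1 / (x + 2))\<^sup>2))) (at x)"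
proof -
  define k where "k = \<kappa> / z\<^sup>2"
  define c where "c = 1 - k"
  have k: "0 \<le> k" "k \<le> 1 / 4000" using z \<kappa> by (auto simp: k_def divide_le_eq)
  have b: "z\<^sup>2 - \<kappa> = z\<^sup>2 * c" using z by (simp add: k_def c_def right_diff_distrib)
  have \<kappa>_eq: "\<kappa> = z\<^sup>2 * (1 - c)" using b by (simp add: right_diff_distrib)
  define P2 where "P2 y = y ^ 4 / 30 - y ^ 3 / 3 + 2 / 3 * (1 + c) * y\<^sup>2 - 2 * c * y + c\<^sup>2" for y
  define P3 where "P3 y = y ^ 6 - 24 * y ^ 5 + (168 + 84 * c) * y ^ 4 - (336 + 1008 * c) * y ^ 3
    + (2520 * c + 1260 * c\<^sup>2) * y\<^sup>2 - 5040 * c\<^sup>2 * y + 2520 * c ^ 3" for y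
  have P2: "P2 y \<ge> 1 / 500" if "y \<ge> 0" for y
    using P2_lower[OF that, of k] k by (simp add: P2_def c_def)
  have P3: "P3 y \<ge> 0" if "y \<ge> 0" for y
    using P3_nonneg[OF that k] by (simp add: P3_def c_def)
  have f: "f x = d * (2 * (1 / (x + 2)) ^ 3 - 2 * z * (1 / (x + 2))\<^sup>2 + z\<^sup>2 * c * (1 / (x + 2)))" for x
    unfolding f_def b ..
  \<comment> \<open>\<open>e1\<close>, \<open>e2\<close> and \<open>e3\<close> list the coefficients
    of \<open>f\<close>, its square and its cube as polynomials in \<open>1 / (x + 2)\<close>, whose
    power \<open>Suc k\<close> has the density
    \<open>s ^ k / fact k * exp (- (2 * s))\<close>.\<close>
  define e1 where "e1 k = (if k = 0 then d * (z\<^sup>2 * c) else if k = Suc 0 then - 2 * z * d else 2 * d)" for k :: nat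
  define e2 where "e2 k = d\<^sup>2 * (if k = Suc 0 then z ^ 4 * c\<^sup>2 else if k = 2 then - 4 * z ^ 3 * c else if k = 3 then 4 * z\<^sup>2 * (1 + c)
    else if k = 4 then - 8 * z else if k = 5 then 4 else 0)" for k :: nat
  define e3 where "e3 k = d ^ 3 * (if k = 2 then z ^ 6 * c ^ 3 else if k = 3 then - 6 * z ^ 5 * c\<^sup>2 else if k = 4 then z ^ 4 * (12 * c + 6 * c\<^sup>2)
    else if k = 5 then - (z ^ 3 * (8 + 24 * c)) else if k = 6 then z\<^sup>2 * (24 + 12 * c) else if k = 7 then - 24 * z else if k = 8 then 8 else 0)" for k :: nat
  have S1: "(\<Sum>k\<le>2. e1 k * s ^ k / fact k) = d * ((s - z)\<^sup>2 - \<kappa>)" for s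
    unfolding \<kappa>_eq by (simp add: e1_def eval_nat_numeral algebra_simps)
  have S1': "(\<Sum>k\<le>2. e1 k * (1 / (x + 2)) ^ Suc k) = f x" for x
    unfolding f by (simp add: e1_def eval_nat_numeral algebra_simps)
  have S2: "(\<Sum>k\<le>5. e2 k * s ^ k / fact k) = d\<^sup>2 * z ^ 4 * s * P2 (s / z)" for s
    using z by (simp add: e2_def eval_nat_numeral P2_def field_simps)
  have S2': "(\<Sum>k\<le>5. e2 k * (1 / (x + 2)) ^ Suc k) = (f x)\<^sup>2" for x
  proof -
    define X where "X = 1 / (x + 2)"
    show ?thesis unfolding f X_def[symmetric] by (simp add: e2_def eval_nat_numeral algebra_simps)
  qed
  have S3: "(\<Sum>k\<le>8. e3 k * s ^ k / fact k) = d ^ 3 * z ^ 6 * s\<^sup>2 * P3 (s / z) / 5040" for s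
    using z by (simp add: e3_def eval_nat_numeral P3_def field_simps)
  have S3': "(\<Sum>k\<le>8. e3 k * (1 / (x + 2)) ^ Suc k) = (f x) ^ 3" for x
  proof -
    define X where "X = 1 / (x + 2)"
    show ?thesis unfolding f X_def[symmetric] by (simp add: e3_def eval_nat_numeral algebra_simps)
  qed
  have L1: "has_laplace 0 (\<lambda>s. d * ((s - z)\<^sup>2 - \<kappa>) * exp (- (2 * s))) f"
    using has_laplace_restrict[OF has_laplace_poly_exp[where t = 2 and e = e1 and m = 2], of 0] unfolding S1 S1' by simp
  have L2: "has_laplace 0 (\<lambda>s. d\<^sup>2 * z ^ 4 * s * P2 (s / z) * exp (- (2 * s))) (\<lambda>x. (f x)\<^sup>2)"
    using has_laplace_restrict[OF has_laplace_poly_exp[where t = 2 and e = e2 and m = 5], of 0] unfolding S2 S2' by simp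
  have L3: "has_laplace 0 (\<lambda>s. d ^ 3 * z ^ 6 * s\<^sup>2 * P3 (s / z) / 5040 * exp (- (2 * s))) (\<lambda>x. (f x) ^ 3)"
    using has_laplace_restrict[OF has_laplace_poly_exp[where t = 2 and e = e3 and m = 8], of 0] unfolding S3 S3' by simp
  show "cm 0 (\<lambda>x. exp (f x))"
  proof (rule cm_exp)
    show "cm 0 (\<lambda>x. (f x)\<^sup>2)"
    proof (rule cm_laplace[OF L2])
      fix s :: real assume "s > 0"
      then show "0 \<le> d\<^sup>2 * z ^ 4 * s * P2 (s / z) * exp (- (2 * s))"
        using z P2[of "s / z"] by (intro mult_nonneg_nonneg) auto
    qed
    show "cm 0 (\<lambda>x. (f x) ^ 3)"
    proof (rule cm_laplace[OF L3])
      fix s :: real assume "s > 0"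
      then show "0 \<le> d ^ 3 * z ^ 6 * s\<^sup>2 * P3 (s / z) / 5040 * exp (- (2 * s))"
        using z d P3[of "s / z"] by (intro mult_nonneg_nonneg divide_nonneg_nonneg) auto
    qed
    show "cm 0 (\<lambda>x. f x + (f x)\<^sup>2 / 2)"
    proof (rule cm_laplace)
      show "has_laplace 0 (\<lambda>s. d * ((s - z)\<^sup>2 - \<kappa>) * exp (- (2 * s)) + 1 / 2 * (d\<^sup>2 * z ^ 4 * s * P2 (s / z) * exp (- (2 * s))))
          (\<lambda>x. f x + (f x)\<^sup>2 / 2)"
        using has_laplace_add[OF L1 has_laplace_cmult[OF L2, of "1 / 2"]] by simp
      fix s :: real assume s: "s > 0"
      have "0 \<le> (s - z)\<^sup>2 - \<kappa> + d / 2 * (z ^ 4 * s * P2 (s / z))"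
      proof (cases "s \<ge> z / 2")
        case True
        have "z / 2 * (1 / 500) \<le> s * P2 (s / z)" using True z s P2[of "s / z"] by (intro mult_mono) auto
        then have "d / 2 * z ^ 4 * (z / 2 * (1 / 500)) \<le> d / 2 * z ^ 4 * (s * P2 (s / z))"
          using d z by (intro mult_left_mono) auto
        moreover have "d / 2 * z ^ 4 * (z / 2 * (1 / 500)) = d * z ^ 5 / 2000" by (simp add: eval_nat_numeral)
        moreover have "d / 2 * z ^ 4 * (s * P2 (s / z)) = d / 2 * (z ^ 4 * s * P2 (s / z))" by (simp add: mult_ac)
        ultimately show ?thesis using \<kappa>(3) zero_le_power2[of "s - z"] by linarith
      next
        case False
        then have "(z / 2)\<^sup>2 \<le> (z - s)\<^sup>2" using z by (intro power_mono) auto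
        then have "z\<^sup>2 / 4 \<le> (s - z)\<^sup>2" by (simp add: power2_commute power_divide)
        moreover have "0 \<le> d / 2 * (z ^ 4 * s * P2 (s / z))" using d z s P2[of "s / z"] by (intro mult_nonneg_nonneg) auto
        moreover have "z\<^sup>2 / 4000 \<le> z\<^sup>2 / 4" by simp
        ultimately show ?thesis using \<kappa>(2) by linarith
      qed
      then have "0 \<le> d * exp (- (2 * s)) * ((s - z)\<^sup>2 - \<kappa> + d / 2 * (z ^ 4 * s * P2 (s / z)))"
        using d by (intro mult_nonneg_nonneg) auto
      then show "0 \<le> d * ((s - z)\<^sup>2 - \<kappa>) * exp (- (2 * s)) + 1 / 2 * (d\<^sup>2 * z ^ 4 * s * P2 (s / z) * exp (- (2 * s)))"
        by (simp add: algebra_simps power2_eq_square)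
    qed
  qed
  \<comment> \<open>The same for the negated derivative of \<open>f\<close>, whose density is
    \<open>s\<close> times that of \<open>f\<close>.\<close>
  define e4 where "e4 k = (if k = Suc 0 then d * (z\<^sup>2 * c) else if k = 2 then - 4 * z * d else if k = 3 then 6 * d else 0)" for k :: nat
  have S4: "(\<Sum>k\<le>3. e4 k * s ^ k / fact k) = d * s * ((s - z)\<^sup>2 - \<kappa>)" for s
    unfolding \<kappa>_eq by (simp add: e4_def eval_nat_numeral algebra_simps)
  have S4': "(\<Sum>k\<le>3. e4 k * (1 / (x + 2)) ^ Suc k) = d * (6 * (1 / (x + 2)) ^ 4 - 4 * z * (1 / (x + 2)) ^ 3 + (z\<^sup>2 - \<kappa>) * (1 / (x + 2))\<^sup>2)" for x
    unfolding b by (simp add: e4_def eval_nat_numeral algebra_simps)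
  show "has_laplace (- 2) (\<lambda>s. d * s * ((s - z)\<^sup>2 - \<kappa>) * exp (- (2 * s)))
       (\<lambda>x. d * (6 * (1 / (x + 2)) ^ 4 - 4 * z * (1 / (x + 2)) ^ 3 + (z\<^sup>2 - \<kappa>) * (1 / (x + 2))\<^sup>2))"
    using has_laplace_poly_exp[where t = 2 and e = e4 and m = 3] unfolding S4 S4' .
  fix x :: real assume x: "x > 0"
  have dX: "((\<lambda>x. 1 / (x + 2)) has_real_derivative - (1 / (x + 2))\<^sup>2) (at x)"
    using x by (auto intro!: derivative_eq_intros simp: power2_eq_square)
  define X where "X = 1 / (x + 2)"
  show "(f has_real_derivative - (d * (6 * (1 / (x + 2)) ^ 4 - 4 * z * (1 / (x + 2)) ^ 3 + (z\<^sup>2 - \<kappa>) * (1 / (x + 2))\<^sup>2))) (at x)"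
    unfolding f_def
    by (rule derivative_eq_intros dX refl)+ (unfold X_def[symmetric], simp add: algebra_simps eval_nat_numeral)
qed

text \<open>After multiplication by \<open>exp s\<close> the perturbation still carries
  \<open>exp (- s)\<close>, so \<open>s * exp (- s) \<le> 1\<close> and
  \<open>s ^ 3 * exp (- s) \<le> 6\<close> control it. Keeping \<open>rhoe \<gamma>\<close> above it
  uses the quadratic growth around \<open>z\<close> up to \<open>2 * z\<close> and monotonicity
  beyond.\<close>

lemma exists_larger_cm:
  fixes \<beta> z :: real
  assumes \<beta>: "\<beta> \<ge> 2" and z: "z > 0" "rhop \<beta> z = 0" and r: "\<And>s. s > 0 \<Longrightarrow> rho \<beta> s \<ge> 0"
  obtains \<gamma> where "\<gamma> > \<beta>" "cm 0 (\<lambda>x. dg x * hfun \<gamma> x)"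
proof -
  obtain c where c: "c > 0" "\<And>s. 0 \<le> s \<Longrightarrow> s \<le> 2 * z \<Longrightarrow> rhoe \<beta> z + c * (s - z)\<^sup>2 \<le> rhoe \<beta> s"
    using rhoe_quadratic[OF \<beta> z(2,1)] by blast
  have vz: "rhoe \<beta> z \<ge> 0" using r[OF z(1)] by (simp add: rhoe_def)
  \<comment> \<open>\<open>c / 2\<close> spends half of the quadratic growth up to
    \<open>2 * z\<close>; \<open>c * z\<^sup>2 / 12\<close> fits the bound \<open>6 * d\<close>
    valid beyond \<open>2 * z\<close> under \<open>rhoe \<gamma> (2 * z)\<close>.\<close>
  define d where "d = min (c / 2) (c * z\<^sup>2 / 12)"
  have d: "d > 0" "d \<le> c / 2" "6 * d \<le> c * z\<^sup>2 / 2" using c z by (auto simp: d_def min_def)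
  define \<kappa> where "\<kappa> = min (z\<^sup>2 / 4000) (d * z ^ 5 / 2000)"
  have \<kappa>: "\<kappa> > 0" "\<kappa> \<le> z\<^sup>2 / 4000" "\<kappa> \<le> d * z ^ 5 / 2000" using d z by (auto simp: \<kappa>_def)
  define K where "K = exp (2 * z)"
  have K: "K > 0" by (simp add: K_def)
  \<comment> \<open>\<open>rhop\<close> is affine in its parameter, with slope \<open>- Q\<close> at
    the point \<open>2 * z\<close>.\<close>
  define Q where "Q = rhop \<beta> (2 * z) - rhop (\<beta> + 1) (2 * z)"
  have p2: "rhop \<beta> (2 * z) > 0" using rhop_pos_after[OF \<beta>, of z "2 * z"] z by simp
  have Q: "rhop (\<beta> + e) (2 * z) = rhop \<beta> (2 * z) - e * Q" for e
  proof -
    define q where "q = Lcut (\<lambda>\<tau>. ucut \<tau> - ucut \<tau> * tcut \<tau>) (2 * z)"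
    define w where "w = Lcut (\<lambda>\<tau>. wcut \<tau> - wcut \<tau> * tcut \<tau>) (2 * z)"
    have "rhop a (2 * z) = w - a * q" for a
    proof -
      have "(\<lambda>\<tau>. wrho a \<tau> * (1 - tcut \<tau>)) = (\<lambda>\<tau>. (wcut \<tau> - wcut \<tau> * tcut \<tau>) - a * (ucut \<tau> - ucut \<tau> * tcut \<tau>))"
        by (simp add: wrho_def algebra_simps)
      moreover have "Lcut (\<lambda>\<tau>. (wcut \<tau> - wcut \<tau> * tcut \<tau>) - a * (ucut \<tau> - ucut \<tau> * tcut \<tau>)) (2 * z) = w - Lcut (\<lambda>\<tau>. a * (ucut \<tau> - ucut \<tau> * tcut \<tau>)) (2 * z)"
        unfolding w_def
        by (rule Lcut_diff[OF Bochner_Integration.integrable_diff[OF wcut_integrable integrable_mult_tcut[OF wcut_integrable]]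
              integrable_mult_right[OF Bochner_Integration.integrable_diff[OF ucut_integrable integrable_mult_tcut[OF ucut_integrable]]]])
      ultimately show ?thesis unfolding rhop_def q_def by (simp only: Lcut_cmult)
    qed
    then have eq: "rhop a (2 * z) = w - a * q" for a .
    show ?thesis unfolding Q_def eq by (simp add: algebra_simps)
  qed
  \<comment> \<open>The three bounds serve \<open>s \<le> z / 2\<close>, where
    \<open>(s - z)\<^sup>2\<close> is large; \<open>z / 2 < s \<le> 2 * z\<close>, where the
    \<open>\<kappa>\<close> term pays; and \<open>s > 2 * z\<close>, where
    \<open>rhop \<gamma> (2 * z) \<ge> 0\<close> is needed.\<close>
  define e where "e = Min {c / 2 * (z / 2)\<^sup>2 / K, d * \<kappa> * (z / 2) * exp (- (2 * z)) / K, rhop \<beta> (2 * z) / (1 + \<bar>Q\<bar>)}"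
  have e: "e > 0" "e * K \<le> c / 2 * (z / 2)\<^sup>2" "e * K \<le> d * \<kappa> * (z / 2) * exp (- (2 * z))" "e * (1 + \<bar>Q\<bar>) \<le> rhop \<beta> (2 * z)"
  proof -
    show "e > 0" using c z d \<kappa> K p2 by (auto simp: e_def intro!: divide_pos_pos mult_pos_pos)
    have "e \<le> c / 2 * (z / 2)\<^sup>2 / K" "e \<le> d * \<kappa> * (z / 2) * exp (- (2 * z)) / K" "e \<le> rhop \<beta> (2 * z) / (1 + \<bar>Q\<bar>)"
      unfolding e_def by (rule Min_le; simp)+
    then show "e * K \<le> c / 2 * (z / 2)\<^sup>2" "e * K \<le> d * \<kappa> * (z / 2) * exp (- (2 * z))" "e * (1 + \<bar>Q\<bar>) \<le> rhop \<beta> (2 * z)"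
      using K by (simp_all add: pos_le_divide_eq add_pos_nonneg)
  qed
  define \<gamma> where "\<gamma> = \<beta> + e"
  have \<gamma>: "\<gamma> \<ge> 2" "\<gamma> > \<beta>" using \<beta> e by (auto simp: \<gamma>_def)
  have vg: "rhoe \<gamma> s = rhoe \<beta> s - e * (exp s * rhog s)" for s
    by (simp add: rhoe_def rho_def \<gamma>_def algebra_simps)
  have vg_low: "c * (s - z)\<^sup>2 - e * K \<le> rhoe \<gamma> s" if "0 \<le> s" "s \<le> 2 * z" for s
  proof -
    have "exp s * rhog s \<le> K * 1" unfolding K_def using that rhog_le_1[OF that(1)] rhog_pos[of s]
      by (intro mult_mono) (cases "s = 0"; auto simp: rhog_eq)+
    then have "e * (exp s * rhog s) \<le> e * K" using e by (intro mult_left_mono) auto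
    then show ?thesis unfolding vg using c(2)[OF that] vz by linarith
  qed
  have se1: "s * exp (- s) \<le> 1" for s :: real using mult_exp_minus_le[of 1 s] by simp
  have main: "d * s * ((s - z)\<^sup>2 - \<kappa>) * exp (- s) \<le> rhoe \<gamma> s" if s: "s > 0" for s
  proof (cases "s \<le> 2 * z")
    case True
    have u: "d * s * ((s - z)\<^sup>2 - \<kappa>) * exp (- s) = d * (s - z)\<^sup>2 * (s * exp (- s)) - d * \<kappa> * (s * exp (- s))"
      by (simp add: algebra_simps)
    have "d * (s - z)\<^sup>2 * (s * exp (- s)) \<le> d * (s - z)\<^sup>2 * 1"
      using d se1[of s] by (intro mult_left_mono) auto
    also have "\<dots> \<le> c / 2 * (s - z)\<^sup>2 * 1" using d by (intro mult_right_mono) auto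
    finally have 1: "d * (s - z)\<^sup>2 * (s * exp (- s)) \<le> c / 2 * (s - z)\<^sup>2" by simp
    have 2: "e * K \<le> c / 2 * (s - z)\<^sup>2 + d * \<kappa> * (s * exp (- s))"
    proof (cases "s \<le> z / 2")
      case True
      then have "(z / 2)\<^sup>2 \<le> (z - s)\<^sup>2" using z by (intro power_mono) auto
      then have "c / 2 * (z / 2)\<^sup>2 \<le> c / 2 * (s - z)\<^sup>2" using c by (intro mult_left_mono) (auto simp: power2_commute)
      moreover have "0 \<le> d * \<kappa> * (s * exp (- s))" using d \<kappa> s by simp
      ultimately show ?thesis using e(2) by linarith
    next
      case False
      have "d * \<kappa> * (z / 2 * exp (- (2 * z))) \<le> d * \<kappa> * (s * exp (- s))"
        using False \<open>s \<le> 2 * z\<close> d \<kappa> z s by (intro mult_left_mono mult_mono) auto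
      moreover have "0 \<le> c / 2 * (s - z)\<^sup>2" using c by simp
      ultimately show ?thesis using e(3) by (simp add: mult.assoc)
    qed
    have "c * (s - z)\<^sup>2 = c / 2 * (s - z)\<^sup>2 + c / 2 * (s - z)\<^sup>2" by simp
    then show ?thesis using vg_low[of s] True s 1 2 unfolding u by linarith
  next
    case False
    have "rhop \<gamma> (2 * z) \<ge> 0"
    proof -
      have "e * Q \<le> e * (1 + \<bar>Q\<bar>)" using e by (intro mult_left_mono) auto
      then show ?thesis unfolding \<gamma>_def Q using e(4) by linarith
    qed
    then have "rhoe \<gamma> (2 * z) \<le> rhoe \<gamma> s" using False by (intro rhoe_mono_after[OF \<gamma>(1)]) auto
    moreover have "c * z\<^sup>2 / 2 \<le> rhoe \<gamma> (2 * z)"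
    proof -
      have "c / 2 * (z / 2)\<^sup>2 \<le> c * z\<^sup>2 / 2" using c by (simp add: power_divide)
      then show ?thesis using vg_low[of "2 * z"] z e(2) by simp
    qed
    moreover have "d * s * ((s - z)\<^sup>2 - \<kappa>) * exp (- s) \<le> 6 * d"
    proof -
      have "(s - z)\<^sup>2 \<le> s\<^sup>2" using False z by (intro power_mono) auto
      then have "s * ((s - z)\<^sup>2 - \<kappa>) * exp (- s) \<le> s * s\<^sup>2 * exp (- s)"
        using \<kappa> s by (intro mult_right_mono mult_left_mono) auto
      also have "\<dots> \<le> 6"
      proof -
        have "s ^ 3 / fact 3 \<le> exp s"
          using exp_converges[of s] s sum_le_suminf[of "\<lambda>n. s ^ n /\<^sub>R fact n" "{3}"] 
          by (simp add: sums_iff divide_inverse mult.commute)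
        then have "s * s\<^sup>2 \<le> 6 * exp s" by (simp add: fact_numeral power3_eq_cube power2_eq_square mult.assoc)
        then have "s * s\<^sup>2 * exp (- s) \<le> 6 * exp s * exp (- s)" by (intro mult_right_mono) auto
        then show ?thesis by (simp add: mult.assoc flip: exp_add)
      qed
      finally have "d * (s * ((s - z)\<^sup>2 - \<kappa>) * exp (- s)) \<le> d * 6" using d by (intro mult_left_mono) auto
      then show ?thesis by (simp add: mult_ac)
    qed
    ultimately show ?thesis using d(3) by linarith
  qed
  define f where "f x = d * (2 * (1 / (x + 2)) ^ 3 - 2 * z * (1 / (x + 2))\<^sup>2 + (z\<^sup>2 - \<kappa>) * (1 / (x + 2)))" for x
  define g where "g x = d * (6 * (1 / (x + 2)) ^ 4 - 4 * z * (1 / (x + 2)) ^ 3 + (z\<^sup>2 - \<kappa>) * (1 / (x + 2))\<^sup>2)" for x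
  note P = cm_exp_perturbation[OF z(1) d(1) less_imp_le[OF \<kappa>(1)] \<kappa>(2,3), folded f_def g_def]
  have "cm 0 (\<lambda>x. Fg x - \<gamma> * dg x - g x)"
  proof (rule cm_laplace)
    show "has_laplace 0 (\<lambda>s. rho \<gamma> s - d * s * ((s - z)\<^sup>2 - \<kappa>) * exp (- (2 * s))) (\<lambda>x. Fg x - \<gamma> * dg x - g x)"
      by (intro has_laplace_diff has_laplace_rho has_laplace_restrict[OF P(2)]) simp
    fix s :: real assume "s > 0"
    have "d * s * ((s - z)\<^sup>2 - \<kappa>) * exp (- s) * exp (- s) \<le> rhoe \<gamma> s * exp (- s)"
      using main[OF \<open>s > 0\<close>] by (intro mult_right_mono) auto
    moreover have "rhoe \<gamma> s * exp (- s) = rho \<gamma> s" by (simp add: rhoe_def exp_minus)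
    moreover have "exp (- s) * exp (- s) = exp (- (2 * s))" by (simp flip: exp_add)
    ultimately show "0 \<le> rho \<gamma> s - d * s * ((s - z)\<^sup>2 - \<kappa>) * exp (- (2 * s))" by (simp add: mult.assoc)
  qed
  \<comment> \<open>Adding \<open>f\<close> to the negative logarithm of
    \<open>dg x * hfun \<gamma> x\<close> subtracts \<open>g\<close> from its derivative, which
    restores a nonnegative density; the factor \<open>exp (f x)\<close> then compensates.\<close>
  then have "cm 0 (\<lambda>x. exp (- (- (ln (dg x) + \<gamma> * glog x) + f x)))"
    by (rule cm_exp_minus[rotated]) (use DERIV_add[OF neg_log_deriv P(3)] in simp)
  then have "cm 0 (\<lambda>x. exp (- (- (ln (dg x) + \<gamma> * glog x) + f x)) * exp (f x))"
    by (intro cm_mult P(1))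
  moreover have "exp (- (- (ln (dg x) + \<gamma> * glog x) + f x)) * exp (f x) = dg x * hfun \<gamma> x" if "x > 0" for x
    using dg_pos[OF that] by (simp add: hfun_def exp_diff exp_add)
  ultimately have "cm 0 (\<lambda>x. dg x * hfun \<gamma> x)" using cm_cong[of 0 "\<lambda>x. exp (- (- (ln (dg x) + \<gamma> * glog x) + f x)) * exp (f x)"] by simp
  with \<gamma>(2) that show ?thesis by blast
qed

section \<open>The threshold for Bernstein functions\<close>

text \<open>Once \<open>n + 1 \<ge> \<bar>a\<bar>\<close> the prefactor of the recursion is at most
  1 in absolute value, and the powers of 2 up to exponent \<open>n\<close> sum to less than
  \<open>2 ^ Suc n\<close>.\<close>

lemma p_coeff_bound_aux:
  assumes "\<And>k. k \<le> n \<Longrightarrow> \<bar>p_coeff k a\<bar> \<le> C * 2 ^ k" "\<bar>a\<bar> \<le> real (n + 1)"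
  shows "\<bar>p_coeff (Suc n) a\<bar> \<le> C * 2 ^ Suc n"
proof -
  have C: "C \<ge> 0" using assms(1)[of 0] by simp
  have "\<bar>\<Sum>k\<le>n. real (k + 1) / real (k + 2) * p_coeff (n - k) a\<bar> \<le> (\<Sum>k\<le>n. C * 2 ^ (n - k))"
  proof (rule order_trans[OF sum_abs sum_mono])
    fix k assume "k \<in> {..n}"
    have "\<bar>real (k + 1) / real (k + 2) * p_coeff (n - k) a\<bar> \<le> 1 * (C * 2 ^ (n - k))"
      unfolding abs_mult by (intro mult_mono assms(1)) auto
    then show "\<bar>real (k + 1) / real (k + 2) * p_coeff (n - k) a\<bar> \<le> C * 2 ^ (n - k)" by simp
  qed
  also have "(\<Sum>k\<le>n. C * 2 ^ (n - k)) = (\<Sum>k\<le>n. C * 2 ^ k)"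
    using sum.nat_diff_reindex[of "\<lambda>k. C * 2 ^ k" "Suc n"] by (simp only: lessThan_Suc_atMost diff_Suc_Suc)
  also have "\<dots> \<le> C * 2 ^ Suc n"
  proof -
    have "(\<Sum>k\<le>n. (2::real) ^ k) = 2 ^ Suc n - 1" by (induction n) auto
    then have "(\<Sum>k\<le>n. (2::real) ^ k) \<le> 2 ^ Suc n" by simp
    then show ?thesis unfolding sum_distrib_left[symmetric] using C by (intro mult_left_mono)
  qed
  finally have "\<bar>\<Sum>k\<le>n. real (k + 1) / real (k + 2) * p_coeff (n - k) a\<bar> \<le> C * 2 ^ Suc n" .
  moreover have "\<bar>a / real (n + 1)\<bar> \<le> 1" using assms(2) by (simp add: abs_divide)
  ultimately have "\<bar>a / real (n + 1)\<bar> * \<bar>\<Sum>k\<le>n. real (k + 1) / real (k + 2) * p_coeff (n - k) a\<bar> \<le> 1 * (C * 2 ^ Suc n)"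
    by (intro mult_mono) auto
  then show ?thesis by (simp only: p_coeff.simps abs_mult mult_1)
qed

lemma p_coeff_bound:
  obtains C where "\<And>n. \<bar>p_coeff n a\<bar> \<le> C * 2 ^ n"
proof -
  define N where "N = nat \<lceil>\<bar>a\<bar>\<rceil>"
  define C where "C = (\<Sum>k\<le>N. \<bar>p_coeff k a\<bar>)"
  have "\<bar>p_coeff n a\<bar> \<le> C * 2 ^ n" for n
  proof (induction n rule: less_induct)
    case (less n)
    show ?case
    proof (cases "n \<le> N")
      case True
      then have "\<bar>p_coeff n a\<bar> \<le> C * 1" unfolding C_def mult_1_right by (intro member_le_sum) auto
      also have "C * 1 \<le> C * 2 ^ n"
        by (intro mult_left_mono) (auto simp: C_def intro!: sum_nonneg)
      finally show ?thesis .
    next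
      case False
      then obtain m where m: "n = Suc m" "N \<le> m" by (cases n) auto
      have "\<bar>a\<bar> \<le> real N" unfolding N_def by (rule real_nat_ceiling_ge)
      then have "\<bar>a\<bar> \<le> real (m + 1)" using m(2) by simp
      then show ?thesis unfolding m(1) using less m by (intro p_coeff_bound_aux) auto
    qed
  qed
  with that show ?thesis by blast
qed

text \<open>For nonnegative parameters every term of the recursion is nonnegative and increasing.
  The largest parameter then dominates a family of series.\<close>

lemma p_coeff_mono:
  assumes "0 \<le> a" "a \<le> b"
  shows "0 \<le> p_coeff n a \<and> p_coeff n a \<le> p_coeff n b"
proof (induction n rule: less_induct)
  case (less n)
  show ?case
  proof (cases n)
    case (Suc m)
    have le: "p_coeff (m - k) a \<ge> 0" "p_coeff (m - k) a \<le> p_coeff (m - k) b" for k using less[of "m - k"] Suc by auto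
    have 0: "0 \<le> (\<Sum>k\<le>m. real (k + 1) / real (k + 2) * p_coeff (m - k) a)"
      using le by (intro sum_nonneg mult_nonneg_nonneg) auto
    moreover have "(\<Sum>k\<le>m. real (k + 1) / real (k + 2) * p_coeff (m - k) a) \<le> (\<Sum>k\<le>m. real (k + 1) / real (k + 2) * p_coeff (m - k) b)"
      using le by (intro sum_mono mult_left_mono) auto
    ultimately show ?thesis unfolding Suc p_coeff.simps using assms
      by (intro conjI mult_mono mult_nonneg_nonneg divide_right_mono) auto
  qed simp
qed

text \<open>The recursion of \<open>p_coeff\<close> says that the power series in
  \<open>y = 1 / x\<close> solves the linear differential equation of
  \<open>exp (a * glog (1 / y))\<close>. Their quotient is constant on \<open>0 < y < 1 / 2\<close>,
  and its limit at 0 is \<open>exp (- a)\<close> because \<open>glog\<close> tends to 1 at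
  infinity.\<close>

lemma hfun_series:
  assumes x: "x > 2"
  shows "(\<lambda>n. (- 1) ^ n * p_coeff n a * (1 / x) ^ n) sums (exp (- a) * hfun a x)"
proof -
  obtain C where C: "\<And>n. \<bar>p_coeff n a\<bar> \<le> C * 2 ^ n" using p_coeff_bound by blast
  define e where "e n = (- 1) ^ n * p_coeff n a" for n
  have eC: "\<bar>e n\<bar> \<le> C * 2 ^ n" for n using C by (simp add: e_def abs_mult)
  have abs: "summable (\<lambda>n. \<bar>e n * y ^ n\<bar>)" if "\<bar>y\<bar> < 1 / 2" for y
    by (rule summable_geometric_bound[OF eC]) (use that in auto)
  have sm: "summable (\<lambda>n. e n * y ^ n)" if "\<bar>y\<bar> < 1 / 2" for y
    using abs[OF that] by (rule summable_rabs_cancel)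
  define P where "P y = (\<Sum>n. e n * y ^ n)" for y
  have Pd: "(P has_real_derivative - a * (dg (1 / y) / y\<^sup>2) * P y) (at y)" if y: "0 < y" "y < 1 / 2" for y
  proof -
    define w where "w = (y + 1 / 2) / 2"
    have w: "y < w" "w < 1 / 2" using y by (auto simp: w_def field_simps)
    have "(P has_real_derivative (\<Sum>n. diffs e n * y ^ n)) (at y)"
      unfolding P_def[abs_def] by (rule termdiffs_strong[OF sm[of w]]) (use w y in auto)
    moreover have "(\<Sum>n. diffs e n * y ^ n) = - a * (dg (1 / y) / y\<^sup>2) * P y"
    proof -
      define B where "B n = (- 1) ^ n * (real (n + 1) / real (n + 2)) * y ^ n" for n
      have B: "B sums (dg (1 / y) / y\<^sup>2)" unfolding B_def by (rule dg_over_square_series) (use y in auto)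
      have nB: "summable (\<lambda>n. norm (B n))"
        using summable_geometric_bound[of "\<lambda>n. real (n + 1) / real (n + 2)" 1 1 y] y by (simp add: B_def abs_mult)
      have nE: "summable (\<lambda>n. norm (e n * y ^ n))" using abs[of y] y by simp
      have "(\<lambda>n. \<Sum>k\<le>n. B k * (e (n - k) * y ^ (n - k))) sums ((\<Sum>n. B n) * P y)"
        unfolding P_def by (rule Cauchy_product_sums[OF nB nE])
      then have "(\<lambda>n. - a * (\<Sum>k\<le>n. B k * (e (n - k) * y ^ (n - k)))) sums (- a * ((dg (1 / y) / y\<^sup>2) * P y))"
        using B by (intro sums_mult) (simp add: sums_iff)
      moreover have "- a * (\<Sum>k\<le>n. B k * (e (n - k) * y ^ (n - k))) = diffs e n * y ^ n" for n
      proof -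
        have "B k * (e (n - k) * y ^ (n - k)) = (- 1) ^ n * y ^ n * (real (k + 1) / real (k + 2) * p_coeff (n - k) a)" if "k \<le> n" for k
        proof -
          have "(- 1) ^ n = (- 1) ^ k * (- 1 :: real) ^ (n - k)" "y ^ n = y ^ k * y ^ (n - k)"
            using that power_add[of "- 1 :: real" k "n - k"] power_add[of y k "n - k"] by simp_all
          then show ?thesis unfolding B_def e_def by simp
        qed
        then have "(\<Sum>k\<le>n. B k * (e (n - k) * y ^ (n - k))) = (\<Sum>k\<le>n. (- 1) ^ n * y ^ n * (real (k + 1) / real (k + 2) * p_coeff (n - k) a))"
          by (intro sum.cong) auto
        also have "\<dots> = (- 1) ^ n * y ^ n * (\<Sum>k\<le>n. real (k + 1) / real (k + 2) * p_coeff (n - k) a)"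
          by (rule sum_distrib_left[symmetric])
        finally have "- a * (\<Sum>k\<le>n. B k * (e (n - k) * y ^ (n - k))) =
            - a * ((- 1) ^ n * y ^ n * (\<Sum>k\<le>n. real (k + 1) / real (k + 2) * p_coeff (n - k) a))" by simp
        also have "\<dots> = diffs e n * y ^ n"
          unfolding diffs_def e_def p_coeff.simps by simp
        finally show ?thesis .
      qed
      ultimately show ?thesis by (simp add: sums_iff mult.assoc)
    qed
    ultimately show ?thesis by simp
  qed
  define q where "q y = P y * exp (- (a * glog (1 / y)))" for y
  have qd: "(q has_real_derivative 0) (at y)" if y: "0 < y" "y < 1 / 2" for y
  proof -
    have i: "((\<lambda>y. 1 / y) has_real_derivative - (1 / y\<^sup>2)) (at y)"
      using y by (auto intro!: derivative_eq_intros simp: power2_eq_square)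
    have "1 / y > 0" using y by simp
    from DERIV_chain2[OF glog_deriv[OF this] i]
    have "((\<lambda>y. glog (1 / y)) has_real_derivative dg (1 / y) * - (1 / y\<^sup>2)) (at y)" .
    then have "((\<lambda>y. exp (- (a * glog (1 / y)))) has_real_derivative exp (- (a * glog (1 / y))) * - (a * (dg (1 / y) * - (1 / y\<^sup>2)))) (at y)"
      by (auto intro!: derivative_eq_intros)
    from DERIV_mult[OF Pd[OF y] this] show ?thesis unfolding q_def[abs_def] by (rule DERIV_cong) (simp add: algebra_simps)
  qed
  have qc: "q y = q w" if "0 < y" "y < w" "w < 1 / 2" for y w
    by (rule DERIV_isconst_end[symmetric, OF that(2)])
       (use that qd in \<open>auto intro!: continuous_at_imp_continuous_on DERIV_isCont[OF qd]\<close>)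
  define y where "y = 1 / x"
  have y: "0 < y" "y < 1 / 2" using x by (auto simp: y_def field_simps)
  have qy: "q w = q y" if "0 < w" "w < y" for w using qc[OF that y(2)] .
  have "(q \<longlongrightarrow> exp (- a)) (at_right 0)"
  proof -
    have "isCont P 0" unfolding P_def[abs_def] by (rule isCont_powser[OF sm[of "1/4"]]) auto
    then have "(P \<longlongrightarrow> P 0) (at_right 0)" by (simp add: isCont_def filterlim_at_split)
    moreover have "P 0 = 1" unfolding P_def by (simp add: powser_zero e_def)
    moreover have "((\<lambda>y. glog (1 / y)) \<longlongrightarrow> 1) (at_right 0)" unfolding glog_def by real_asymp
    ultimately have "((\<lambda>y. P y * exp (- (a * glog (1 / y)))) \<longlongrightarrow> 1 * exp (- (a * 1))) (at_right 0)"
      by (intro tendsto_intros) auto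
    then show ?thesis by (simp add: q_def[abs_def])
  qed
  moreover have "(q \<longlongrightarrow> q y) (at_right 0)"
  proof (rule tendsto_eventually)
    show "\<forall>\<^sub>F w in at_right 0. q w = q y"
      using qy y by (auto simp: eventually_at_right intro!: exI[of _ y])
  qed
  ultimately have "q y = exp (- a)" using tendsto_unique trivial_limit_at_right_real by blast
  then have "P y = exp (- a) * hfun a x"
    by (simp add: q_def y_def hfun_def exp_minus field_simps)
  moreover have "(\<lambda>n. e n * y ^ n) sums P y" unfolding P_def using sm y by (intro summable_sums) auto
  ultimately show ?thesis by (simp add: e_def y_def)
qed

text \<open>The abscissa 2 reflects the growth bound \<open>C * 2 ^ n\<close>. It is good enough,
  since the sign of \<open>phi\<close> can be recovered from complete monotonicity on any
  half-line.\<close>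

lemma has_laplace_phi: "has_laplace 2 (phi a) (\<lambda>x. exp a - hfun a x)"
proof -
  obtain C where C: "\<And>n. \<bar>p_coeff n a\<bar> \<le> C * 2 ^ n" using p_coeff_bound by blast
  define d where "d n = exp a * ((- 1) ^ n * p_coeff (Suc n) a)" for n
  have d: "\<bar>d n\<bar> \<le> exp a * C * 2 * 2 ^ n" for n
    using mult_left_mono[OF C[of "Suc n"], of "exp a"] by (simp add: d_def abs_mult mult.assoc del: p_coeff.simps)
  have L: "has_laplace 2 (\<lambda>s. \<Sum>k. d k * (s ^ k / fact k)) (\<lambda>x. \<Sum>k. d k * (1 / x) ^ Suc k)"
    by (rule has_laplace_powerseries[OF d]) simp
  have r: "(\<lambda>s. \<Sum>k. d k * (s ^ k / fact k)) = phi a"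
  proof
    fix s
    have "summable (\<lambda>k. \<bar>d k * (s ^ k / fact k)\<bar>)" by (rule summable_exp_bound[OF d]) simp
    then have "summable (\<lambda>k. d k * (s ^ k / fact k))" by (rule summable_rabs_cancel)
    then have "summable (\<lambda>k. exp (- a) * (d k * (s ^ k / fact k)))" by (rule summable_mult)
    moreover have "exp (- a) * (d k * (s ^ k / fact k)) = (- 1) ^ k * p_coeff (Suc k) a * (s ^ k / fact k)" for k
      unfolding d_def by (simp add: exp_minus del: p_coeff.simps)
    ultimately have "summable (\<lambda>k. (- 1) ^ k * p_coeff (Suc k) a * (s ^ k / fact k))" by simp
    from suminf_mult[OF this, of "exp a"] show "(\<Sum>k. d k * (s ^ k / fact k)) = phi a s"
      unfolding phi_def d_def by (simp add: mult.assoc del: p_coeff.simps)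
  qed
  have g: "(\<Sum>k. d k * (1 / x) ^ Suc k) = exp a - hfun a x" if x: "x > 2" for x
  proof -
    have "(\<lambda>n. (- 1) ^ Suc n * p_coeff (Suc n) a * (1 / x) ^ Suc n) sums (exp (- a) * hfun a x - 1)"
      using hfun_series[OF x, of a] by (subst sums_Suc_iff) simp
    from sums_mult[OF this, of "- exp a"]
    have "(\<lambda>n. - exp a * ((- 1) ^ Suc n * p_coeff (Suc n) a * (1 / x) ^ Suc n)) sums (- exp a * (exp (- a) * hfun a x - 1))" .
    moreover have "- exp a * (exp (- a) * hfun a x - 1) = exp a - hfun a x" by (simp add: exp_minus algebra_simps)
    moreover have "- exp a * ((- 1) ^ Suc n * p_coeff (Suc n) a * (1 / x) ^ Suc n) = d n * (1 / x) ^ Suc n" for n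
      unfolding d_def by (simp del: p_coeff.simps)
    ultimately show ?thesis by (simp add: sums_iff)
  qed
  show ?thesis using L unfolding r by (rule iffD1[OF has_laplace_cong, rotated]) (rule g)
qed

lemma phi_continuous: "isCont (phi a) s"
proof -
  obtain C where C: "\<And>n. \<bar>p_coeff n a\<bar> \<le> C * 2 ^ n" using p_coeff_bound by blast
  define d where "d n = (- 1) ^ n * p_coeff (Suc n) a" for n
  have d: "\<bar>d n\<bar> \<le> C * 2 * 2 ^ n" for n
    using C[of "Suc n"] by (simp add: d_def abs_mult mult.assoc del: p_coeff.simps)
  have sm: "summable (\<lambda>n. (d n / fact n) * s ^ n)" for s
  proof -
    have "summable (\<lambda>k. d k * (s ^ k / fact k))"
      by (rule summable_rabs_cancel[OF summable_exp_bound[OF d]]) simp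
    then show ?thesis by simp
  qed
  have "phi a = (\<lambda>s. exp a * (\<Sum>n. (d n / fact n) * s ^ n))"
    by (simp add: phi_def d_def fun_eq_iff del: p_coeff.simps)
  moreover have "isCont (\<lambda>s. \<Sum>n. (d n / fact n) * s ^ n) s"
    by (rule isCont_powser_converges_everywhere) (rule sm)
  ultimately show ?thesis by (simp add: continuous_mult)
qed

text \<open>Differentiating the transform of \<open>phi a\<close> shows that
  \<open>s * phi a s\<close> is the density of the derivative of \<open>hfun a\<close>.\<close>

lemma phi_nonneg_iff: "(\<forall>s>0. phi a s \<ge> 0) \<longleftrightarrow> cm 2 (\<lambda>x. a * dg x * hfun a x)"
proof -
  obtain H where H: "has_laplace 2 (\<lambda>s. s * phi a s) H"
    "\<And>x. x > 2 \<Longrightarrow> ((\<lambda>x. exp a - hfun a x) has_real_derivative - H x) (at x)"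
    using has_laplace_deriv[OF has_laplace_phi] by blast
  have Hx: "H x = a * dg x * hfun a x" if "x > 2" for x
  proof -
    have "((\<lambda>x. exp a - hfun a x) has_real_derivative 0 - a * dg x * hfun a x) (at x)"
      by (rule DERIV_diff[OF DERIV_const hfun_deriv]) (use that in simp)
    from DERIV_unique[OF H(2)[OF that] this] show ?thesis by simp
  qed
  have L: "has_laplace 2 (\<lambda>s. s * phi a s) (\<lambda>x. a * dg x * hfun a x)"
    using H(1) by (rule iffD1[OF has_laplace_cong, rotated]) (rule Hx)
  show ?thesis
  proof
    assume "\<forall>s>0. phi a s \<ge> 0"
    then show "cm 2 (\<lambda>x. a * dg x * hfun a x)" by (intro cm_laplace[OF L]) auto
  next
    assume c: "cm 2 (\<lambda>x. a * dg x * hfun a x)"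
    have "s * phi a s \<ge> 0" if "s > 0" for s
      by (rule laplace_cm_imp_nonneg[OF L c that]) (intro continuous_mult continuous_ident phi_continuous)
    then show "\<forall>s>0. phi a s \<ge> 0" by (auto simp: zero_le_mult_iff)
  qed
qed

text \<open>Tannery's theorem, with the coefficients at \<open>A\<close> as majorant. It shows that
  the admissible parameters contain their supremum.\<close>

lemma phi_continuous_param:
  assumes A: "\<And>n. 0 \<le> u n" "\<And>n. u n \<le> A" and lim: "u \<longlonglongrightarrow> a"
  shows "(\<lambda>n. phi (u n) s) \<longlonglongrightarrow> phi a s"
proof -
  obtain C where C: "\<And>n. \<bar>p_coeff n A\<bar> \<le> C * 2 ^ n" using p_coeff_bound by blast
  have pc: "continuous_on UNIV (p_coeff n)" for n
  proof (induction n rule: less_induct)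
    case (less n)
    show ?case
    proof (cases n)
      case (Suc m)
      have "continuous_on UNIV (\<lambda>a. a / real (m + 1) * (\<Sum>k\<le>m. real (k + 1) / real (k + 2) * p_coeff (m - k) a))"
        by (intro continuous_intros less) (use Suc in auto)
      then show ?thesis unfolding Suc by (simp only: p_coeff.simps)
    qed simp
  qed
  have "(\<lambda>n. \<Sum>k. (- 1) ^ k * p_coeff (Suc k) (u n) * (s ^ k / fact k)) \<longlonglongrightarrow> (\<Sum>k. (- 1) ^ k * p_coeff (Suc k) a * (s ^ k / fact k))"
  proof (rule tannerys_theorem[THEN conjunct2, THEN conjunct2])
    fix k
    have "(\<lambda>n. p_coeff (Suc k) (u n)) \<longlonglongrightarrow> p_coeff (Suc k) a"
      using continuous_on_tendsto_compose[OF pc[of "Suc k"] lim] by (simp del: p_coeff.simps)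
    then show "(\<lambda>n. (- 1) ^ k * p_coeff (Suc k) (u n) * (s ^ k / fact k)) \<longlonglongrightarrow> (- 1) ^ k * p_coeff (Suc k) a * (s ^ k / fact k)"
      by (intro tendsto_intros)
  next
    have "norm ((- 1) ^ k * p_coeff (Suc k) (u n) * (s ^ k / fact k)) \<le> \<bar>(C * 2 * 2 ^ k) * (s ^ k / fact k)\<bar>" for k n
    proof -
      have "\<bar>p_coeff (Suc k) (u n)\<bar> \<le> \<bar>p_coeff (Suc k) A\<bar>"
        using p_coeff_mono[OF A(1)[of n] A(2)[of n], of "Suc k"] by linarith
      also have "\<dots> \<le> C * 2 ^ Suc k" by (rule C)
      also have "\<dots> \<le> \<bar>C * 2 * 2 ^ k\<bar>" by simp
      finally show ?thesis unfolding abs_mult real_norm_def by (intro mult_right_mono) (auto simp: abs_mult)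
    qed
    then show "\<forall>\<^sub>F (k, n) in sequentially \<times>\<^sub>F sequentially.
        norm ((- 1) ^ k * p_coeff (Suc k) (u n) * (s ^ k / fact k)) \<le> \<bar>(C * 2 * 2 ^ k) * (s ^ k / fact k)\<bar>"
      by (intro always_eventually) auto
    have C0: "C \<ge> 0" using C[of 0] by simp
    show "summable (\<lambda>k. \<bar>(C * 2 * 2 ^ k) * (s ^ k / fact k)\<bar>)"
      by (rule summable_exp_bound[of _ "C * 2" 2]) (use C0 in \<open>auto simp: abs_mult\<close>)
  qed simp
  then have "(\<lambda>n. exp (u n) * (\<Sum>k. (- 1) ^ k * p_coeff (Suc k) (u n) * (s ^ k / fact k)))
      \<longlonglongrightarrow> exp a * (\<Sum>k. (- 1) ^ k * p_coeff (Suc k) a * (s ^ k / fact k))"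
    by (intro tendsto_mult tendsto_exp lim)
  then show ?thesis unfolding phi_def .
qed

text \<open>
  This includes that the definite description defining \<open>alpha_star\<close> denotes the maximum of the set
  of all \<open>a\<close> with \<open>phi a \<ge> 0\<close>.
\<close>

lemma alpha_star_ge:
  assumes \<gamma>: "\<gamma> > 0" "cm 0 (\<lambda>x. dg x * hfun \<gamma> x)"
  shows "\<gamma> \<le> alpha_star"
proof -
  define S where "S = {a. \<forall>s>0. phi a s \<ge> 0}"
  have S_iff: "a \<in> S \<longleftrightarrow> cm 2 (\<lambda>x. a * dg x * hfun a x)" for a
    unfolding S_def using phi_nonneg_iff by simp
  have S_pos: "a \<ge> 0" if "a \<in> S" for a
  proof (rule ccontr)
    assume "\<not> a \<ge> 0"
    then have "a * dg 3 * hfun a 3 < 0" using dg_pos[of 3] hfun_pos[of a 3] by (simp add: mult_neg_pos)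
    moreover have "a * dg 3 * hfun a 3 \<ge> 0" using that unfolding S_iff by (rule cm_nonneg) simp
    ultimately show False by simp
  qed
  \<comment> \<open>Lowering the parameter multiplies by \<open>exp (- ((a - b) * glog x))\<close>,
    which is completely monotonic because \<open>dg\<close> is.\<close>
  have S_down: "b \<in> S" if "a \<in> S" "0 \<le> b" "b \<le> a" for a b
  proof (cases "a = 0")
    case True
    then show ?thesis using that by simp
  next
    case False
    then have a: "a > 0" using S_pos[OF that(1)] by simp
    have "cm 2 (\<lambda>x. exp (- ((a - b) * glog x)))"
    proof (rule cm_exp_minus)
      show "((\<lambda>x. (a - b) * glog x) has_real_derivative (a - b) * dg x) (at x)" if "x > 2" for x
        by (intro DERIV_cmult glog_deriv) (use that in simp)
      show "cm 2 (\<lambda>x. (a - b) * dg x)" using that(3) by (intro cm_cmult cm_restrict[OF _ cm_dg]) auto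
    qed
    from cm_mult[OF _ this] that(1) have "cm 2 (\<lambda>x. (a * dg x * hfun a x) * exp (- ((a - b) * glog x)))"
      unfolding S_iff by blast
    then have "cm 2 (\<lambda>x. b / a * ((a * dg x * hfun a x) * exp (- ((a - b) * glog x))))"
      using that a by (intro cm_cmult) auto
    moreover have "b / a * ((a * dg x * hfun a x) * exp (- ((a - b) * glog x))) = b * dg x * hfun b x" for x
    proof -
      have "hfun a x * exp (- ((a - b) * glog x)) = hfun b x" unfolding hfun_def by (simp add: algebra_simps flip: exp_add)
      then have "b / a * ((a * dg x) * (hfun a x * exp (- ((a - b) * glog x)))) = b * dg x * hfun b x" using a by simp
      then show ?thesis by (simp only: mult.assoc)
    qed
    ultimately show ?thesis by (simp add: S_iff)
  qed
  \<comment> \<open>For \<open>a > 0\<close> the negated derivative of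
    \<open>a * dg x * hfun a x\<close> has the sign of \<open>Fg x - a * dg x\<close>; the choice
    \<open>x = 3\<close> is just a point beyond 2.\<close>
  have S_bound: "a \<le> Fg 3 / dg 3" if "a \<in> S" for a
  proof (cases "a = 0")
    case True
    then show ?thesis using dg_pos[of 3] by (simp add: Fg_def)
  next
    case False
    then have a: "a > 0" using S_pos[OF that] by simp
    from that have aS: "cm 2 (\<lambda>x. a * dg x * hfun a x)" unfolding S_iff .
    obtain g where g: "\<And>x. x > 2 \<Longrightarrow> ((\<lambda>x. a * dg x * hfun a x) has_real_derivative - g x) (at x)" "cm 2 g"
      using cm_obtain_deriv[OF aS] by blast
    have 3: "(dg has_real_derivative - (Fg 3 * dg 3)) (at 3)"
      by (rule dg_deriv_Fg) simp
    have "(hfun a has_real_derivative a * dg 3 * hfun a 3) (at 3)" by (rule hfun_deriv) simp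
    from DERIV_mult[OF DERIV_cmult[OF 3, of a] this]
    have "((\<lambda>x. a * dg x * hfun a x) has_real_derivative a * - (Fg 3 * dg 3) * hfun a 3 + a * dg 3 * hfun a 3 * (a * dg 3)) (at 3)" .
    from DERIV_unique[OF g(1)[of 3] this] have "a * (a * dg 3 - Fg 3) * dg 3 * hfun a 3 = - g 3" by (simp add: algebra_simps)
    moreover have "g 3 \<ge> 0" using cm_nonneg[OF g(2)] by simp
    ultimately have "(a * dg 3 - Fg 3) * (a * dg 3 * hfun a 3) \<le> 0" by (simp add: mult_ac)
    moreover have "a * dg 3 * hfun a 3 > 0" using a dg_pos[of 3] hfun_pos[of a 3] by simp
    ultimately have "a * dg 3 - Fg 3 \<le> 0" by (metis mult_pos_pos not_less)
    then show ?thesis using dg_pos[of 3] by (simp add: field_simps)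
  qed
  have \<gamma>S: "\<gamma> \<in> S"
    unfolding S_iff mult.assoc using \<gamma> by (intro cm_cmult cm_restrict[OF _ \<gamma>(2)]) auto
  have bdd: "bdd_above S" using S_bound by (auto simp: bdd_above_def)
  define m where "m = Sup S"
  have upper: "a \<le> m" if "a \<in> S" for a unfolding m_def using that bdd by (rule cSup_upper)
  have m0: "m > 0" using upper[OF \<gamma>S] \<gamma>(1) by simp
  have mS: "m \<in> S"
  proof -
    define u where "u n = m * (1 - 1 / real (n + 2))" for n
    have u: "0 \<le> u n" "u n < m" for n using m0 by (auto simp: u_def field_simps)
    have "u \<longlonglongrightarrow> m * (1 - 0)" unfolding u_def by (intro tendsto_intros) real_asymp
    then have lim: "u \<longlonglongrightarrow> m" by simp
    have uS: "u n \<in> S" for n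
    proof -
      obtain a where "a \<in> S" "u n < a" using u(2)[of n] \<gamma>S bdd unfolding m_def by (metis empty_iff less_cSup_iff)
      then show ?thesis using S_down u(1) by (meson less_imp_le)
    qed
    have "phi m s \<ge> 0" if "s > 0" for s
    proof (rule LIMSEQ_le_const)
      show "(\<lambda>n. phi (u n) s) \<longlonglongrightarrow> phi m s"
        by (rule phi_continuous_param[OF u(1) _ lim, of m]) (use u(2) less_imp_le in blast)
      show "\<exists>N. \<forall>n\<ge>N. 0 \<le> phi (u n) s" using uS that by (auto simp: S_def)
    qed
    then show ?thesis by (simp add: S_def)
  qed
  have char: "(\<forall>s>0. phi a s \<ge> 0) \<longleftrightarrow> 0 \<le> a \<and> a \<le> m" for a
    using S_pos[of a] upper[of a] S_down[OF mS, of a] by (auto simp: S_def)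
  have "alpha_star = m"
    unfolding alpha_star_def
  proof (rule the_equality)
    show "\<forall>\<alpha>. (\<forall>s>0. 0 \<le> phi \<alpha> s) \<longleftrightarrow> 0 \<le> \<alpha> \<and> \<alpha> \<le> m" using char by blast
    fix a assume a: "\<forall>\<alpha>. (\<forall>s>0. 0 \<le> phi \<alpha> s) \<longleftrightarrow> 0 \<le> \<alpha> \<and> \<alpha> \<le> a"
    have "m \<le> a" using a char[of m] m0 by (meson less_imp_le order_refl)
    moreover have "a \<le> m" using a char[of a] m0 \<open>m \<le> a\<close> by (meson less_imp_le order_refl order_trans)
    ultimately show "a = m" by simp
  qed
  then show ?thesis using upper[OF \<gamma>S] by simp
qed

text \<open>Evaluated once for all later computations. With 41 coefficients the truncation error for
  \<open>s\<close> near 3.37 is about \<open>10 * s ^ 41 / fact 41\<close>, slightly above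
  \<open>10^-27\<close>; at 32 decimals the rounding errors add up to less than that.\<close>

lemma cF_list_value: "cF_list (10 ^ 32) 41 = [102146650305155228386611116987822,
  102195946454348101222103788717694,
  102247613007315687932079546344566,
  102301827720676728079842181776148,
  102358786772784299251040032298754,
  102418707233550566715061396516788,
  102481829945253544671191391969996,
  102548422896834505666126307099850,
  102618785193774837450412965661298,
  102693251750630246596735610869652,
  102772198865417142061461023334066,
  102856050876632269611575685615094,
  102945288157961357435036557265818,
  103040456777165160270230136914418,
  103142180240492526915983321866514,
  103251173871156359485974254656560,
  103368262542692576466382649549014,
  103494402723979141164655625939728,
  103630710119707063738910380380602,
  103778494649144739504078113066214,
  103939305159423582725231943806594,
  104114987213681398300079841369194,
  104307758681183755713673204102838,
  104520309930555454956698742434004,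
  104755938591087588364058643650806,
  105018733780264007558118030861954,
  105313832577310042353198601963746,
  105647784462954019472455734833468,
  106029081354601600499075477483242,
  106468949278118176587486579430316,
  106982567817093259643393551552150,
  107591017497464685393354803505696,
  108324525878023820410651686371848,
  109228166438042981252857796067674,
  110372525965118557711150303742896,
  111875367430922986478542034097588,
  113950617283950617283950617283950,
  117037037037037037037037037037036,
  122222222222222222222222222222224,
  133333333333333333333333333333332,
  200000000000000000000000000000000]"
  by code_simp

text \<open>\<open>low\<close> and \<open>high\<close> refer to the parameter, ending in 764 or 766;
  \<open>left\<close> and \<open>right\<close> refer to the points 3.3655641377 and 3.3655641378
  around the minimiser. Values and errors are in units of \<open>10^-32\<close>; the second equation
  evaluates \<open>rho - rhop\<close>.\<close>

lemma horner_low_left: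
  "horner_int 1 33655641377 (10 ^ 10) (crho_list (218858634466175709764 * 10 ^ 12) (cF_list (10 ^ 32) 41)) 0 (10 * 10 ^ 32) = (391955239936, 145903)"
  "horner_int 3 33655641377 (10 ^ 10) (butlast (crho_list (218858634466175709764 * 10 ^ 12) (cF_list (10 ^ 32) 41))) 0 (10 * 10 ^ 32) = (330608922995908583165, 1554222)"
  unfolding cF_list_value by code_simp+

lemma horner_high_left:
  "horner_int 1 33655641377 (10 ^ 10) (crho_list (218858634466175709766 * 10 ^ 12) (cF_list (10 ^ 32) 41)) 0 (10 * 10 ^ 32) = (- 112686693354, 145903)"
  "horner_int 3 33655641377 (10 ^ 10) (butlast (crho_list (218858634466175709766 * 10 ^ 12) (cF_list (10 ^ 32) 41))) 0 (10 * 10 ^ 32) = (330608922915050883557, 1554222)"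
  unfolding cF_list_value by code_simp+

lemma horner_high_right:
  "horner_int 1 33655641378 (10 ^ 10) (crho_list (218858634466175709766 * 10 ^ 12) (cF_list (10 ^ 32) 41)) 0 (10 * 10 ^ 32) = (- 117082150750, 145903)"
  "horner_int 3 33655641378 (10 ^ 10) (butlast (crho_list (218858634466175709766 * 10 ^ 12) (cF_list (10 ^ 32) 41))) 0 (10 * 10 ^ 32) = (- 242699774911857330567, 1554222)"
  unfolding cF_list_value by code_simp+

section \<open>Horn--Bernstein functions\<close>

text \<open>As \<open>rhog\<close> is positive on the positive axis, \<open>rho a s \<ge> 0\<close>
  means \<open>a \<le> rhoF s / rhog s\<close>.\<close>

definition beta_star :: real where
  "beta_star = Inf ((\<lambda>s. rhoF s / rhog s) ` {0<..})"

lemma rho_nonneg_iff_le_beta_star: "(\<forall>s>0. rho a s \<ge> 0) \<longleftrightarrow> a \<le> beta_star"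
proof -
  have "rhoF s / rhog s \<ge> 0" if "s > 0" for s using rhoF_pos[of s] rhog_pos[OF that] by simp
  then have "bdd_below ((\<lambda>s. rhoF s / rhog s) ` {0<..})" by (intro bdd_belowI2[of _ 0]) auto
  then have "a \<le> beta_star \<longleftrightarrow> (\<forall>s>0. a \<le> rhoF s / rhog s)"
    unfolding beta_star_def by (subst le_cInf_iff) auto
  also have "\<dots> \<longleftrightarrow> (\<forall>s>0. rho a s \<ge> 0)"
    using rhog_pos by (auto simp: rho_def pos_le_divide_eq)
  finally show ?thesis by blast
qed

text \<open>The lower end passes \<open>rho_nonneg_criterion\<close>; at the upper end one negative
  value of \<open>rho\<close> suffices. Since \<open>rhop\<close> is antitone in the parameter, its
  signs at the two points carry over to \<open>beta_star\<close>, which yields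
  \<open>z\<close>.\<close>

lemma beta_star_location:
  obtains z where "z > 0" "rhop beta_star z = 0"
    and "218858634466175709764 / 10 ^ 20 \<le> beta_star" "beta_star < 218858634466175709766 / 10 ^ 20"
proof -
  define b1 b2 :: real where "b1 = 218858634466175709764 / 10 ^ 20" and "b2 = 218858634466175709766 / 10 ^ 20"
  define s1 s2 :: real where "s1 = real_of_int 33655641377 / real_of_int (10 ^ 10)" and "s2 = real_of_int 33655641378 / real_of_int (10 ^ 10)"
  note E1 = rho_rhop_enclosure[of b1 "10 ^ 32" "218858634466175709764 * 10 ^ 12" 33655641377 "10 ^ 10" 41, OF _ _ _ _ _ _ _ _ horner_low_left, folded s1_def]
  note E2 = rho_rhop_enclosure[of b2 "10 ^ 32" "218858634466175709766 * 10 ^ 12" 33655641377 "10 ^ 10" 41, OF _ _ _ _ _ _ _ _ horner_high_left, folded s1_def]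
  note E3 = rho_rhop_enclosure[of b2 "10 ^ 32" "218858634466175709766 * 10 ^ 12" 33655641378 "10 ^ 10" 41, OF _ _ _ _ _ _ _ _ horner_high_right, folded s2_def]
  have e1: "\<bar>391955239936 - 10 ^ 32 * rho b1 s1\<bar> \<le> 145903" "\<bar>- 330608922603953343229 - 10 ^ 32 * rhop b1 s1\<bar> \<le> 1700125"
    using E1 by (simp_all add: b1_def)
  have e2: "\<bar>- 112686693354 - 10 ^ 32 * rho b2 s1\<bar> \<le> 145903"
    using E2(1) by (simp add: b2_def)
  have e3: "\<bar>242699774794775179817 - 10 ^ 32 * rhop b2 s2\<bar> \<le> 1700125"
    using E3(2) by (simp add: b2_def)
  have s: "s2 - s1 = 1 / 10 ^ 10" "s1 > 0" by (simp_all add: s1_def s2_def)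
  have p1: "rhop b1 s1 \<le> 0" using e1(2) by (simp add: abs_le_iff)
  have p2: "0 \<le> rhop b2 s2" using e3 by (simp add: abs_le_iff)
  have b: "2 \<le> b1" "b1 \<le> b2" by (simp_all add: b1_def b2_def)
  have "rho b1 t \<ge> 0" for t
  proof (rule rho_nonneg_criterion[OF b(1)])
    show "s1 < s2" "s2 - s1 \<le> 1 / 2" using s by simp_all
    show "0 \<le> rhop b1 s2" using p2 rhop_antimono[OF b(2), of s2] by linarith
    \<comment> \<open>Here \<open>rho\<close> is about \<open>3.9 * 10^-21\<close>, while the loss,
      \<open>2 * 10^-10\<close> times \<open>3.3 * 10^-12\<close>, is about six times
      smaller.\<close>
    show "0 \<le> rho b1 s1 + 2 * (s2 - s1) * rhop b1 s1"
      using e1 unfolding s by (simp add: abs_le_iff)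
  qed (rule p1)
  then have lower: "b1 \<le> beta_star" using rho_nonneg_iff_le_beta_star by blast
  have "rho b2 s1 < 0" using e2 by (simp add: abs_le_iff)
  then have "\<not> b2 \<le> beta_star" using s(2) rho_nonneg_iff_le_beta_star[of b2] by force
  then have upper: "beta_star < b2" by simp
  have "rhop beta_star s1 \<le> 0" using rhop_antimono[OF lower, of s1] p1 by linarith
  moreover have "0 \<le> rhop beta_star s2" using rhop_antimono[of beta_star b2 s2] upper p2 by linarith
  ultimately obtain z where "s1 \<le> z" "rhop beta_star z = 0" using rhop_zero[of beta_star s1 s2] s by auto
  then show ?thesis using that[of z] s(2) lower upper by (simp add: b1_def b2_def)
qed

lemma beta_star_lt_alpha_star: "beta_star < alpha_star"
proof -
  obtain z where z: "z > 0" "rhop beta_star z = 0" and b: "218858634466175709764 / 10 ^ 20 \<le> beta_star"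
    by (rule beta_star_location)
  have b2: "beta_star \<ge> 2" using b by simp
  have "\<And>s. s > 0 \<Longrightarrow> rho beta_star s \<ge> 0" using rho_nonneg_iff_le_beta_star[of beta_star] by blast
  from exists_larger_cm[OF b2 z this] obtain \<gamma> where g: "\<gamma> > beta_star" "cm 0 (\<lambda>x. dg x * hfun \<gamma> x)" by blast
  have "\<gamma> \<le> alpha_star" by (rule alpha_star_ge) (use g b2 in auto)
  with g(1) show ?thesis by linarith
qed

lemma h_fun_real: "x > 0 \<Longrightarrow> h_fun (complex_of_real a) x = complex_of_real (hfun a x)"
  by (simp add: h_fun_def hfun_def glog_def exp_of_real flip: of_real_mult)

text \<open>As \<open>glog x\<close> tends to 0 with \<open>x\<close>, a nonzero phase
  \<open>Im \<alpha> * glog x\<close> can be brought strictly between 0 and pi in absolute value,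
  where the sine does not vanish.\<close>

lemma real_h_fun_imp_Im_0:
  assumes "\<And>x. x > 0 \<Longrightarrow> h_fun \<alpha> x = complex_of_real (f x)"
  shows "Im \<alpha> = 0"
proof (rule ccontr)
  assume nz: "Im \<alpha> \<noteq> 0"
  have "(glog \<longlongrightarrow> 0) (at_right 0)" unfolding glog_def[abs_def] by real_asymp
  then have "\<forall>\<^sub>F x in at_right 0. glog x < pi / \<bar>Im \<alpha>\<bar>"
    using nz by (intro order_tendstoD(2)) auto
  then obtain d where d: "d > 0" "\<And>x. 0 < x \<Longrightarrow> x < d \<Longrightarrow> glog x < pi / \<bar>Im \<alpha>\<bar>"
    by (auto simp: eventually_at_right_field)
  define x where "x = d / 2"
  have x: "x > 0" "x < d" using d(1) by (auto simp: x_def)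
  have glog: "glog x > 0" unfolding glog_def using x by (intro mult_pos_pos ln_gt_zero) auto
  have "exp (\<alpha> * complex_of_real (glog x)) = complex_of_real (f x)"
    using assms[OF x(1)] by (simp add: h_fun_def glog_def)
  then have "Im (exp (\<alpha> * complex_of_real (glog x))) = 0" by simp
  then have "sin (Im \<alpha> * glog x) = 0" by (simp add: Im_exp)
  then have "sin (\<bar>Im \<alpha>\<bar> * glog x) = 0" by (auto simp: abs_if)
  moreover have "sin (\<bar>Im \<alpha>\<bar> * glog x) > 0"
  proof (rule sin_gt_zero)
    show "0 < \<bar>Im \<alpha>\<bar> * glog x" using nz glog by simp
    show "\<bar>Im \<alpha>\<bar> * glog x < pi" using d(2)[OF x] nz by (simp add: pos_less_divide_eq mult.commute)
  qed
  ultimately show False by simp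
qed

lemma neg_log_deriv_deriv:
  assumes f: "\<And>x. x > 0 \<Longrightarrow> deriv f x = a * dg x * hfun a x" and a: "a \<noteq> 0" and x: "x > 0"
  shows "- (deriv (deriv f) x / deriv f x) = Fg x - a * dg x"
proof -
  have "((\<lambda>x. a * dg x * hfun a x) has_real_derivative a * - (Fg x * dg x) * hfun a x + a * dg x * hfun a x * (a * dg x)) (at x)"
    using DERIV_mult[OF DERIV_cmult[OF dg_deriv_Fg[OF x], of a] hfun_deriv[OF x, of a]] .
  then have "(deriv f has_real_derivative a * - (Fg x * dg x) * hfun a x + a * dg x * hfun a x * (a * dg x)) (at x)"
    using has_real_derivative_cong_gt[of 0 "deriv f" "\<lambda>x. a * dg x * hfun a x", OF f x] by blast
  then have "deriv (deriv f) x = a * - (Fg x * dg x) * hfun a x + a * dg x * hfun a x * (a * dg x)"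
    by (rule DERIV_imp_deriv)
  also have "\<dots> = - (Fg x - a * dg x) * (a * dg x * hfun a x)" by (simp add: algebra_simps)
  finally show ?thesis using f[OF x] a dg_pos[OF x] hfun_pos[of a x] by simp
qed

text \<open>The sign of \<open>a\<close> comes from \<open>deriv f 1 \<ge> 0\<close>. For
  \<open>a > 0\<close> the derivative is nonzero at 1, which excludes the zero function in
  \<open>log_completely_monotonic0\<close>.\<close>

lemma HBF_imp:
  assumes f: "f \<in> HBF" "\<And>x. x > 0 \<Longrightarrow> f x = hfun a x"
  shows "0 \<le> a \<and> a \<le> beta_star"
proof -
  have df: "deriv f x = a * dg x * hfun a x" if "x > 0" for x
  proof (rule DERIV_imp_deriv)
    show "(f has_real_derivative a * dg x * hfun a x) (at x)"
      using has_real_derivative_cong_gt[of 0 f "hfun a", OF f(2) that] hfun_deriv[OF that] by blast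
  qed
  have "cm 0 (deriv f)" using f(1) by (intro completely_monotonic_imp_cm) (simp add: HBF_def BF_def)
  then have "deriv f 1 \<ge> 0" by (rule cm_nonneg) simp
  then have a0: "a \<ge> 0" using df[of 1] dg_pos[of 1] hfun_pos[of a 1] by (simp add: zero_le_mult_iff)
  show ?thesis
  proof (cases "a = 0")
    case True
    have "0 \<le> beta_star" by (rule beta_star_location) simp
    with True show ?thesis by simp
  next
    case False
    then have a: "a > 0" using a0 by simp
    have "deriv f 1 \<noteq> 0" using df[of 1] dg_pos[of 1] hfun_pos[of a 1] a by simp
    then have "deriv f \<in> log_completely_monotonic"
      using f(1) by (auto simp: HBF_def log_completely_monotonic0_def dest: spec[of _ 1])
    then have "cm 0 (\<lambda>x. - (deriv (deriv f) x / deriv f x))"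
      by (intro completely_monotonic_imp_cm) (simp add: log_completely_monotonic_def)
    moreover have "- (deriv (deriv f) x / deriv f x) = Fg x - a * dg x" if "x > 0" for x
      using df a that by (intro neg_log_deriv_deriv) auto
    ultimately have "cm 0 (\<lambda>x. Fg x - a * dg x)"
      using cm_cong[of 0 "\<lambda>x. - (deriv (deriv f) x / deriv f x)" "\<lambda>x. Fg x - a * dg x"] by blast
    then show ?thesis using a0 by (simp add: rho_cm_iff rho_nonneg_iff_le_beta_star)
  qed
qed

lemma smooth_pos_if_cm_deriv:
  assumes "\<And>x. x > 0 \<Longrightarrow> (f has_real_derivative f' x) (at x)" "cm 0 f'"
  shows "smooth_pos f" "cm 0 (deriv f)"
proof -
  have eq: "deriv f x = f' x" if "x > 0" for x using assms(1)[OF that] by (rule DERIV_imp_deriv)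
  show cm: "cm 0 (deriv f)" using cm_cong[of 0 "deriv f" f', OF eq] assms(2) by blast
  show "smooth_pos f"
    unfolding smooth_pos_def
  proof (intro allI impI)
    fix n and x :: real assume x: "x > 0"
    show "(deriv ^^ n) f field_differentiable at x"
    proof (cases n)
      case 0
      then show ?thesis using assms(1)[OF x] by (auto simp: field_differentiable_def)
    next
      case (Suc m)
      then show ?thesis using cm_higher_deriv(1)[OF cm x, of m] by (simp add: funpow_swap1)
    qed
  qed
qed

text \<open>Complete monotonicity of \<open>Fg - a * dg\<close> gives that of \<open>h'\<close>
  through \<open>cm_exp_minus\<close>, so it accounts for both requirements of the class. For
  \<open>a = 0\<close> the derivative is the zero function.\<close>

lemma hfun_in_HBF:
  assumes a: "0 \<le> a" "a \<le> beta_star"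
  shows "hfun a \<in> HBF"
proof -
  have d: "(hfun a has_real_derivative a * dg x * hfun a x) (at x)" if "x > 0" for x by (rule hfun_deriv[OF that])
  have eq: "deriv (hfun a) x = a * dg x * hfun a x" if "x > 0" for x using d[OF that] by (rule DERIV_imp_deriv)
  have L: "cm 0 (\<lambda>x. Fg x - a * dg x)"
    using a(2) by (simp add: rho_cm_iff rho_nonneg_iff_le_beta_star)
  have "cm 0 (\<lambda>x. exp (- (- (ln (dg x) + a * glog x))))"
    by (rule cm_exp_minus[OF neg_log_deriv L])
  moreover have "exp (- (- (ln (dg x) + a * glog x))) = dg x * hfun a x" if "x > 0" for x
    using dg_pos[OF that] by (simp add: exp_add hfun_def)
  ultimately have g: "cm 0 (\<lambda>x. dg x * hfun a x)"
    using cm_cong[of 0 "\<lambda>x. exp (- (- (ln (dg x) + a * glog x)))" "\<lambda>x. dg x * hfun a x"] by blast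
  have c: "cm 0 (\<lambda>x. a * dg x * hfun a x)"
    using cm_cmult[OF a(1) g] by (simp add: mult.assoc)
  note sm = smooth_pos_if_cm_deriv[OF d c]
  have BF: "hfun a \<in> BF"
    using sm hfun_pos[of a] cm_imp_completely_monotonic[OF sm(2)] by (auto simp: BF_def less_imp_le)
  moreover have "deriv (hfun a) \<in> log_completely_monotonic0"
  proof (cases "a = 0")
    case True
    then show ?thesis using eq by (auto simp: log_completely_monotonic0_def)
  next
    case False
    then have a0: "a > 0" using a(1) by simp
    have "deriv (hfun a) \<in> completely_monotonic" by (rule cm_imp_completely_monotonic[OF sm(2)])
    then have "smooth_pos (deriv (hfun a))" by (simp add: completely_monotonic_def)
    moreover have "\<forall>x>0. deriv (hfun a) x > 0" using eq a0 dg_pos hfun_pos by simp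
    moreover have "cm 0 (\<lambda>x. - (deriv (deriv (hfun a)) x / deriv (hfun a) x))"
    proof -
      have "- (deriv (deriv (hfun a)) x / deriv (hfun a) x) = Fg x - a * dg x" if "x > 0" for x
        using eq a0 that by (intro neg_log_deriv_deriv) auto
      then show ?thesis using cm_cong[of 0 "\<lambda>x. - (deriv (deriv (hfun a)) x / deriv (hfun a) x)" "\<lambda>x. Fg x - a * dg x"] L by blast
    qed
    ultimately show ?thesis
      using cm_imp_completely_monotonic by (simp add: log_completely_monotonic0_def log_completely_monotonic_def)
  qed
  ultimately show ?thesis by (simp add: HBF_def)
qed

theorem theorem1p2:
  "\<exists>\<beta>::real. 0 \<le> \<beta> \<and> \<beta> < alpha_star \<and>
     (\<forall>\<alpha>::complex.
        (\<exists>f\<in>HBF. \<forall>x>0. h_fun \<alpha> x = complex_of_real (f x)) \<longleftrightarrow>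
        \<alpha> \<in> \<real> \<and> 0 \<le> Re \<alpha> \<and> Re \<alpha> \<le> \<beta>) \<and>
     \<bar>\<beta> - 2.18858634466175709765\<bar> \<le> 1 / 10 ^ 20"
proof (intro exI[of _ beta_star] conjI allI)
  show "0 \<le> beta_star" by (rule beta_star_location) simp
  show "beta_star < alpha_star" by (rule beta_star_lt_alpha_star)
  show "\<bar>beta_star - 2.18858634466175709765\<bar> \<le> 1 / 10 ^ 20"
  proof (rule beta_star_location)
    assume "218858634466175709764 / 10 ^ 20 \<le> beta_star" "beta_star < 218858634466175709766 / 10 ^ 20"
    then show ?thesis by (intro abs_leI) simp_all
  qed
  fix \<alpha> :: complex
  show "(\<exists>f\<in>HBF. \<forall>x>0. h_fun \<alpha> x = complex_of_real (f x)) \<longleftrightarrow> \<alpha> \<in> \<real> \<and> 0 \<le> Re \<alpha> \<and> Re \<alpha> \<le> beta_star"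
  proof
    assume "\<exists>f\<in>HBF. \<forall>x>0. h_fun \<alpha> x = complex_of_real (f x)"
    then obtain f where f: "f \<in> HBF" "\<And>x. x > 0 \<Longrightarrow> h_fun \<alpha> x = complex_of_real (f x)" by blast
    have "Im \<alpha> = 0" using f(2) by (rule real_h_fun_imp_Im_0)
    then have \<alpha>: "\<alpha> = complex_of_real (Re \<alpha>)" by (simp add: complex_eq_iff)
    have "f x = hfun (Re \<alpha>) x" if "x > 0" for x
      using f(2)[OF that] h_fun_real[OF that, of "Re \<alpha>"] \<alpha> by (metis of_real_eq_iff)
    from HBF_imp[OF f(1) this] show "\<alpha> \<in> \<real> \<and> 0 \<le> Re \<alpha> \<and> Re \<alpha> \<le> beta_star"
      using \<alpha> by (metis Reals_of_real)
  next
    assume *: "\<alpha> \<in> \<real> \<and> 0 \<le> Re \<alpha> \<and> Re \<alpha> \<le> beta_star"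
    then have "\<alpha> = complex_of_real (Re \<alpha>)" by (simp add: of_real_Re)
    then have "\<forall>x>0. h_fun \<alpha> x = complex_of_real (hfun (Re \<alpha>) x)" using h_fun_real by metis
    then show "\<exists>f\<in>HBF. \<forall>x>0. h_fun \<alpha> x = complex_of_real (f x)" using hfun_in_HBF * by blast
  qed
qed

end
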